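(* Let $X_1,\ldots,X_n$ be i.i.d. $N_p(0,\Sigma)$ with $\Sigma$ a $p\times p$ positive definite matrix, where $p=p_n$ may grow with $n$. Put on $\Sigma$ the prior $$\pi(\Sigma)=\frac{\pi^u(\Sigma)\,I(\Sigma\in\mathcal{U}(\tau))}{\pi^u(\Sigma\in\mathcal{U}(\tau))},$$ where $\pi^u$ is the unconstrained prior on symmetric matrices under which, independently, for $1\le j<k\le p$: $\sigma_{jk}=\sigma_{kj}$, $\sigma_{jk}\mid\rho_{jk}\sim N\big(0,\frac{\rho_{jk}}{1-\rho_{jk}}\tau_1^2\big)$, $\rho_{jk}\sim \mathrm{Beta}(a,b)$, and for $j=1,\ldots,p$: $\sigma_{jj}\sim\mathrm{Gamma}(1,\lambda/2)$ (shape $1$, rate $\lambda/2$); and $\mathcal{U}(\tau)=\{\Sigma\in\mathcal{C}_p:\tau^{-1}\le\lambda_{\min}(\Sigma)\le\lambda_{\max}(\Sigma)\le\tau\}$. Assume: (A1) the true covariance $\Sigma_0$ belongs to $\mathcal{U}(s_0,\tau_0)=\{\Sigma\in\mathcal{C}_p: |s(\Sigma)|\le s_0,\ \tau_0^{-1}\le\lambda_{\min}(\Sigma)\le\lambda_{\max}(\Sigma)\le\tau_0\}$ for some integer $0<s_0<p(p-1)$ and constant $\tau_0>1$; (A2) $p\asymp n^{\beta}$ for some $0<\beta<1$; (A3) $\tau\ge\max(3,\tau_0)$, $\tau=O(1)$, $\lambda=O(1)$, $a=b=1/2$ and $\tau_1^2\asymp 1/(np^4)$. If $(p+s_0)\log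 p=o(n)$, then for some sufficiently large constant $M>0$, $$\pi\Big(\|\Sigma-\Sigma_0\|_F^2\ge M\frac{(p+s_0)\log p}{n}\ \Big|\ X_1,\ldots,X_n\Big)\longrightarrow 0$$ in $\mathbb{P}_0$-probability as $n\to\infty$, where $\mathbb{P}_0$ is the law of the data under $\Sigma_0$.
   Context: $\mathcal{C}_p$ denotes the set of $p\times p$ positive definite matrices; $\lambda_{\min},\lambda_{\max}$ denote minimal and maximal eigenvalues; $\|A\|_F=(\sum_{i,j}a_{ij}^2)^{1/2}$. $|s(\Sigma)|$ is the number of nonzero off-diagonal entries of $\Sigma$. For positive sequences, $a_n\asymp b_n$ means $a_n/b_n$ and $b_n/a_n$ are both bounded, $a_n=O(b_n)$ means $a_n/b_n$ is bounded, and $a_n=o(b_n)$ means $a_n/b_n\to0$. The quantities $p,s_0,\tau_1$ (and possibly $\tau,\lambda$) may depend on $n$; all asymptotics are as $n\to\infty$. *)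

theory Defs
  imports "HOL-Probability.Probability" "HOL-Library.Landau_Symbols"
    "Jordan_Normal_Form.Determinant" "Jordan_Normal_Form.Char_Poly"
    "Jordan_Normal_Form.Gauss_Jordan_Elimination"
begin

definition pos_def :: "nat \<Rightarrow> real mat \<Rightarrow> bool" where
  "pos_def p A \<longleftrightarrow> A \<in> carrier_mat p p \<and> A\<^sup>T = A \<and>
     (\<forall>v \<in> carrier_vec p. v \<noteq> 0\<^sub>v p \<longrightarrow> v \<bullet> (A *\<^sub>v v) > 0)"

definition lam_min :: "real mat \<Rightarrow> real" where
  "lam_min A = Min {k. eigenvalue A k}"

definition lam_max :: "real mat \<Rightarrow> real" where
  "lam_max A = Max {k. eigenvalue A k}"

definition frob_sq :: "real mat \<Rightarrow> real" where
  "frob_sq A = (\<Sum>i<dim_row A. \<Sum>j<dim_col A. (A $$ (i,j))\<^sup>2)"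

definition num_offdiag :: "real mat \<Rightarrow> nat" where
  "num_offdiag A = card {(i,j). i < dim_row A \<and> j < dim_col A \<and> i \<noteq> j \<and> A $$ (i,j) \<noteq> 0}"

definition U_set :: "nat \<Rightarrow> real \<Rightarrow> real mat set" where
  "U_set p \<tau> = {A. pos_def p A \<and> 1/\<tau> \<le> lam_min A \<and> lam_min A \<le> lam_max A \<and> lam_max A \<le> \<tau>}"

definition U_sparse :: "nat \<Rightarrow> nat \<Rightarrow> real \<Rightarrow> real mat set" where
  "U_sparse p s0 \<tau>0 = {A. pos_def p A \<and> num_offdiag A \<le> s0 \<and>
     1/\<tau>0 \<le> lam_min A \<and> lam_min A \<le> lam_max A \<and> lam_max A \<le> \<tau>0}"

text \<open>Free coordinates of a symmetric p x p matrix: the upper triangle j \<le> k.\<close>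
definition tri :: "nat \<Rightarrow> (nat \<times> nat) set" where
  "tri p = {(j,k). j \<le> k \<and> k < p}"

definition symm_of :: "nat \<Rightarrow> (nat \<times> nat \<Rightarrow> real) \<Rightarrow> real mat" where
  "symm_of p s = mat p p (\<lambda>(i,j). if i \<le> j then s (i,j) else s (j,i))"

definition beta_density :: "real \<Rightarrow> real \<Rightarrow> real \<Rightarrow> real" where
  "beta_density a b x = (if 0 < x \<and> x < 1 then x powr (a-1) * (1-x) powr (b-1) / Beta a b else 0)"

text \<open>Marginal density of an off-diagonal entry: sigma | rho ~ N(0, rho/(1-rho) tau1^2),
  rho ~ Beta(a,b) (rho integrated out).\<close>
definition offdiag_density :: "real \<Rightarrow> real \<Rightarrow> real \<Rightarrow> real \<Rightarrow> real" where
  "offdiag_density \<tau>1 a b x =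
     (LINT \<rho>:{0<..<1}|lborel. normal_density 0 (sqrt (\<rho>/(1-\<rho>)) * \<tau>1) x * beta_density a b \<rho>)"

text \<open>Unconstrained prior pi^u on the free coordinates; diagonal entries Gamma(1, lambda/2),
  i.e. exponential with rate lambda/2.\<close>
definition prior_u :: "nat \<Rightarrow> real \<Rightarrow> real \<Rightarrow> real \<Rightarrow> real \<Rightarrow> (nat \<times> nat \<Rightarrow> real) measure" where
  "prior_u p \<tau>1 a b lam = PiM (tri p) (\<lambda>(j,k).
     if j = k then density lborel (\<lambda>x. ennreal (exponential_density (lam/2) x))
     else density lborel (\<lambda>x. ennreal (offdiag_density \<tau>1 a b x)))"

definition prior :: "nat \<Rightarrow> real \<Rightarrow> real \<Rightarrow> real \<Rightarrow> real \<Rightarrow> real \<Rightarrow> (nat \<times> nat \<Rightarrow> real) measure" where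
  "prior p \<tau>1 a b lam \<tau> = density (prior_u p \<tau>1 a b lam)
     (\<lambda>s. indicator {s. symm_of p s \<in> U_set p \<tau>} s /
          emeasure (prior_u p \<tau>1 a b lam) {s \<in> space (prior_u p \<tau>1 a b lam). symm_of p s \<in> U_set p \<tau>})"

definition mat_inv :: "real mat \<Rightarrow> real mat" where
  "mat_inv A = the (mat_inverse A)"

definition mvn_density :: "nat \<Rightarrow> real mat \<Rightarrow> (nat \<Rightarrow> real) \<Rightarrow> real" where
  "mvn_density p S y =
     exp (- (\<Sum>i<p. \<Sum>j<p. y i * (mat_inv S) $$ (i,j) * y j) / 2) / sqrt ((2*pi)^p * det S)"

definition mvn :: "nat \<Rightarrow> real mat \<Rightarrow> (nat \<Rightarrow> real) measure" where
  "mvn p S = density (PiM {..<p} (\<lambda>_. lborel)) (\<lambda>y. ennreal (mvn_density p S y))"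

definition sample_law :: "nat \<Rightarrow> nat \<Rightarrow> real mat \<Rightarrow> (nat \<Rightarrow> nat \<Rightarrow> real) measure" where
  "sample_law n p S = PiM {..<n} (\<lambda>_. mvn p S)"

definition likelihood :: "nat \<Rightarrow> nat \<Rightarrow> (nat \<times> nat \<Rightarrow> real) \<Rightarrow> (nat \<Rightarrow> nat \<Rightarrow> real) \<Rightarrow> real" where
  "likelihood n p s x = (\<Prod>i<n. mvn_density p (symm_of p s) (x i))"

definition posterior :: "(nat \<times> nat \<Rightarrow> real) measure \<Rightarrow> nat \<Rightarrow> nat \<Rightarrow> real mat set
     \<Rightarrow> (nat \<Rightarrow> nat \<Rightarrow> real) \<Rightarrow> real" where
  "posterior Pr n p B x = enn2real
     ((\<integral>\<^sup>+ s. indicator {s. symm_of p s \<in> B} s * ennreal (likelihood n p s x) \<partial>Pr) /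
      (\<integral>\<^sup>+ s. ennreal (likelihood n p s x) \<partial>Pr))"

end

theory Submission
  imports Defs "HOL-Real_Asymp.Real_Asymp"
begin

text \<open>
  The proof needs neither a sieve entropy bound nor explicit tests. Write \<open>R = (p + s0) ln p\<close>.
  With high probability every entry of the sample covariance is within \<open>A sqrt (ln p / n)\<close> of
  its mean. If \<open>S\<close> has at most \<open>k\<close> of order \<open>p + s0\<close> large off-diagonal entries, pairing the
  sample covariance with \<open>S - \<Sigma>0\<close> thresholded to its \<open>O(k)\<close> relevant entries therefore costs only
  \<open>A sqrt (k ln p / n)\<close> times the Frobenius norm, and a Chernoff bound for quadratic forms shows that
  the expected likelihood ratio on this event is at most \<open>exp (- c n v)\<close> when the squared distance
  is at least \<open>v\<close>. The prior mass of matrices with more large entries is \<open>exp (- c R)\<close>.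
  The denominator of the posterior is bounded below on a small box around a slightly shrunk
  \<open>\<Sigma>0\<close>, using Jensen's inequality for \<open>1/y\<close> and the chi-square divergence of Gaussians.

  All Gaussian estimates come from the normalising constant and the second moments: by Jensen, the
  ratio of the normalising constants for the precisions \<open>H = Om - 2D\<close> and \<open>Om\<close> lies between
  \<open>exp (tr (D Om\<^sup>-\<^sup>1))\<close> and \<open>exp (tr (D H\<^sup>-\<^sup>1))\<close>, so no eigenvalue expansion is needed.

  Symmetric matrices are handled as kernels \<open>nat \<Rightarrow> nat \<Rightarrow> real\<close>, of which only the entries below
  \<open>p\<close> matter.
\<close>

section \<open>Quadratic forms and Gaussian integrals\<close>

text \<open>The estimates hold for each fixed \<open>n\<close> with explicit constants; the scales
  make them fit together. With \<open>\<tau>1\<close> of order \<open>1 / (sqrt n * p^2)\<close>, an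
  off-diagonal entry exceeds \<open>d\<close> with prior probability at most of order
  \<open>\<tau>1 / d\<close>. The cut-off \<open>d = sqrt (R / n) / p\<close> makes all entries
  below it cost at most \<open>R / n\<close> in squared distance, while the expected number of
  entries above it is at most of order \<open>p / sqrt R\<close>. As \<open>p \<le> R\<close>, a
  Chernoff weight \<open>sqrt p\<close> per large entry is affordable: it costs
  \<open>exp (C * p)\<close> and gains \<open>exp (c * R)\<close> once there are of order
  \<open>p + s0\<close> such entries. In the denominator, a box of radius
  \<open>1 / (2 * p * sqrt n)\<close> keeps the Frobenius error at \<open>1 / (2 * sqrt n)\<close>.
  The zero entries, up to \<open>p^2\<close> of them, then cost \<open>exp (- C * p)\<close> in
  total, and each remaining entry a fixed power of \<open>p\<close> (apart from
  \<open>lam / 2\<close> on the diagonal), because A2 bounds \<open>n\<close> by a power of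
  \<open>p\<close>. Shrinking \<open>\<Sigma>0\<close> by \<open>1 / sqrt n\<close> adds a squared
  distance of order \<open>p / n\<close>, which \<open>R / n\<close> absorbs.\<close>

definition quad_form :: "nat \<Rightarrow> (nat \<Rightarrow> nat \<Rightarrow> real) \<Rightarrow> (nat \<Rightarrow> real) \<Rightarrow> real" where
  "quad_form p A x = (\<Sum>i<p. \<Sum>j<p. x i * A i j * x j)"

definition norm_sq :: "nat \<Rightarrow> (nat \<Rightarrow> real) \<Rightarrow> real" where
  "norm_sq p x = (\<Sum>i<p. (x i)\<^sup>2)"

definition sym_kernel :: "nat \<Rightarrow> (nat \<Rightarrow> nat \<Rightarrow> real) \<Rightarrow> bool" where
  "sym_kernel p A \<longleftrightarrow> (\<forall>i<p. \<forall>j<p. A i j = A j i)"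

text \<open>Positive definiteness with an explicit modulus: \<open>c\<close> is a lower bound for
  the spectrum. Tracking \<open>c\<close> is what makes the later constants uniform in
  \<open>p\<close>.\<close>

definition coercive :: "nat \<Rightarrow> real \<Rightarrow> (nat \<Rightarrow> nat \<Rightarrow> real) \<Rightarrow> bool" where
  "coercive p c A \<longleftrightarrow> 0 < c \<and> sym_kernel p A \<and> (\<forall>x. c * norm_sq p x \<le> quad_form p A x)"

definition kernel_mat :: "nat \<Rightarrow> (nat \<Rightarrow> nat \<Rightarrow> real) \<Rightarrow> real mat" where
  "kernel_mat p A = mat p p (\<lambda>(i,j). A i j)"

text \<open>Here \<open>A\<close> plays the precision matrix; for coercive \<open>A\<close> the
  value is the integral of \<open>exp (- quad_form p A x / 2)\<close>, by
  \<open>gauss_integral\<close>.\<close>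

definition gauss_const :: "nat \<Rightarrow> (nat \<Rightarrow> nat \<Rightarrow> real) \<Rightarrow> real" where
  "gauss_const p A = sqrt ((2 * pi) ^ p / Determinant.det (kernel_mat p A))"

abbreviation leb :: "nat \<Rightarrow> (nat \<Rightarrow> real) measure" where
  "leb p \<equiv> PiM {..<p} (\<lambda>_. lborel)"

interpretation lebprod: product_sigma_finite "\<lambda>_::nat. lborel :: real measure"
  by standard

lemma symkD: "sym_kernel p A \<Longrightarrow> i < p \<Longrightarrow> j < p \<Longrightarrow> A i j = A j i"
  by (auto simp: sym_kernel_def)

lemma quad_form_cong:
  "(\<And>i. i < p \<Longrightarrow> x i = y i) \<Longrightarrow> (\<And>i j. i < p \<Longrightarrow> j < p \<Longrightarrow> A i j = B i j) \<Longrightarrow> quad_form p A x = quad_form p B y"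
  unfolding quad_form_def by (intro sum.cong refl) auto

lemma norm_sq_cong: "(\<And>i. i < p \<Longrightarrow> x i = y i) \<Longrightarrow> norm_sq p x = norm_sq p y"
  unfolding norm_sq_def by (intro sum.cong refl) auto

lemma quad_form_measurable [measurable]:
  "(\<lambda>x. quad_form p A (\<lambda>i. x i - m i)) \<in> borel_measurable (leb p)"
  "(\<lambda>x. quad_form p A x) \<in> borel_measurable (leb p)"
  unfolding quad_form_def by measurable

lemma quad_form_Suc:
  assumes "sym_kernel (Suc p) A"
  shows "quad_form (Suc p) A x = quad_form p A x + 2 * x p * (\<Sum>i<p. A p i * x i) + A p p * (x p)\<^sup>2"
proof -
  have "(\<Sum>i<p. x i * A i p * x p) = x p * (\<Sum>i<p. A p i * x i)"
    unfolding sum_distrib_left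
    by (intro sum.cong refl) (use symkD[OF assms] in \<open>auto simp: algebra_simps\<close>)
  moreover have "(\<Sum>j<p. x p * A p j * x j) = x p * (\<Sum>i<p. A p i * x i)"
    unfolding sum_distrib_left by (intro sum.cong refl) (auto simp: algebra_simps)
  ultimately show ?thesis
    by (simp add: quad_form_def sum.distrib power2_eq_square algebra_simps)
qed

definition schur_compl :: "nat \<Rightarrow> (nat \<Rightarrow> nat \<Rightarrow> real) \<Rightarrow> nat \<Rightarrow> nat \<Rightarrow> real" where
  "schur_compl p A i j = A i j - A i p * A p j / A p p"

text \<open>Completing the square in the last variable; the remainder is the form of the Schur
  complement of the pivot \<open>A p p\<close>.\<close>

lemma quad_form_schur_compl:
  assumes S: "sym_kernel (Suc p) A" and a: "A p p > 0"
  shows "quad_form (Suc p) A x =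
    quad_form p (schur_compl p A) x + A p p * (x p + (\<Sum>i<p. A p i * x i) / A p p)\<^sup>2"
proof -
  let ?b = "\<Sum>i<p. A p i * x i"
  have "quad_form p (schur_compl p A) x = quad_form p A x - (\<Sum>i<p. \<Sum>j<p. (A p i * x i) * (A p j * x j)) / A p p"
    unfolding quad_form_def schur_compl_def sum_subtractf[symmetric] sum_divide_distrib
    by (intro sum.cong refl) (use symkD[OF S] in \<open>auto simp: field_simps\<close>)
  also have "(\<Sum>i<p. \<Sum>j<p. (A p i * x i) * (A p j * x j)) = ?b * ?b"
    by (simp add: sum_product)
  finally have "quad_form p (schur_compl p A) x = quad_form p A x - ?b * ?b / A p p" .
  moreover have "A p p * (x p + ?b / A p p)\<^sup>2 = A p p * (x p)\<^sup>2 + 2 * x p * ?b + ?b * ?b / A p p"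
    using a by (simp add: power2_eq_square field_simps)
  ultimately show ?thesis
    using quad_form_Suc[OF S, of x] by simp
qed

lemma coercive_diag:
  assumes "coercive p c A" "i < p"
  shows "A i i \<ge> c"
proof -
  let ?x = "\<lambda>j. if j = i then 1 else (0::real)"
  have q: "quad_form p A ?x = A i i"
    using assms(2) by (simp add: quad_form_def if_distrib[of "\<lambda>z. z * _"] if_distrib[of "\<lambda>z. _ * z"] cong: if_cong)
  have n: "norm_sq p ?x = 1"
    using assms(2) by (simp add: norm_sq_def if_distrib[of "\<lambda>z. z\<^sup>2"] cong: if_cong)
  have "c * norm_sq p ?x \<le> quad_form p A ?x" using assms(1) by (auto simp: coercive_def)
  then show ?thesis unfolding q n by simp
qed

text \<open>The last coordinate of \<open>?y\<close> is the minimiser, so the square in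
  \<open>quad_form_schur_compl\<close> vanishes, while appending a coordinate can only increase the
  norm. The modulus \<open>c\<close> therefore survives, which lets the induction in
  \<open>gauss_integral\<close> run.\<close>

lemma coercive_schur_compl:
  assumes "coercive (Suc p) c A"
  shows "coercive p c (schur_compl p A)"
proof -
  have S: "sym_kernel (Suc p) A" and c: "c > 0" and a: "A p p > 0"
    using assms coercive_diag[OF assms, of p] by (auto simp: coercive_def)
  have "c * norm_sq p x \<le> quad_form p (schur_compl p A) x" for x
  proof -
    let ?y = "x(p := - (\<Sum>i<p. A p i * x i) / A p p)"
    have "c * norm_sq p x \<le> c * norm_sq (Suc p) ?y"
      using c by (intro mult_left_mono) (auto simp: norm_sq_def)
    also have "\<dots> \<le> quad_form (Suc p) A ?y" using assms by (auto simp: coercive_def)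
    also have "\<dots> = quad_form p (schur_compl p A) ?y"
      unfolding quad_form_schur_compl[where A=A, OF S a] by simp
    also have "\<dots> = quad_form p (schur_compl p A) x" by (rule quad_form_cong) auto
    finally show ?thesis .
  qed
  then show ?thesis using S c by (auto simp: coercive_def sym_kernel_def schur_compl_def)
qed

text \<open>One step of block elimination: the matrix is a unipotent upper block triangular factor
  times a lower block triangular one whose diagonal blocks are the Schur complement and the
  pivot.\<close>

lemma det_schur_compl:
  assumes a: "A p p \<noteq> 0"
  shows "Determinant.det (kernel_mat (Suc p) A) = A p p * Determinant.det (kernel_mat p (schur_compl p A))"
proof -
  let ?I = "1\<^sub>m p :: real mat"
  let ?b = "mat p 1 (\<lambda>(i,j). A i p / A p p)"
  let ?O = "0\<^sub>m 1 p :: real mat"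
  let ?C = "kernel_mat p (schur_compl p A)"
  let ?Z = "0\<^sub>m p 1 :: real mat"
  let ?r = "mat 1 p (\<lambda>(i,j). A p j)"
  let ?a = "mat 1 1 (\<lambda>(i,j). A p p)"
  have C: "?C \<in> carrier_mat p p" by (simp add: kernel_mat_def)
  have "four_block_mat ?I ?b ?O (1\<^sub>m 1) * four_block_mat ?C ?Z ?r ?a =
     four_block_mat (?I * ?C + ?b * ?r) (?I * ?Z + ?b * ?a) (?O * ?C + 1\<^sub>m 1 * ?r) (?O * ?Z + 1\<^sub>m 1 * ?a)"
    by (rule mult_four_block_mat) (use C in auto)
  also have "\<dots> = kernel_mat (Suc p) A"
  proof (rule eq_matI)
    fix i j assume "i < dim_row (kernel_mat (Suc p) A)" "j < dim_col (kernel_mat (Suc p) A)"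
    then have "i < Suc p" "j < Suc p" by (auto simp: kernel_mat_def)
    then show "four_block_mat (?I * ?C + ?b * ?r) (?I * ?Z + ?b * ?a) (?O * ?C + 1\<^sub>m 1 * ?r)
      (?O * ?Z + 1\<^sub>m 1 * ?a) $$ (i,j) = kernel_mat (Suc p) A $$ (i,j)"
      using a C by (auto simp: kernel_mat_def schur_compl_def scalar_prod_def less_Suc_eq)
  qed (auto simp: kernel_mat_def)
  finally have eq: "kernel_mat (Suc p) A = four_block_mat ?I ?b ?O (1\<^sub>m 1) * four_block_mat ?C ?Z ?r ?a" ..
  have "Determinant.det (kernel_mat (Suc p) A) =
      Determinant.det (four_block_mat ?I ?b ?O (1\<^sub>m 1)) * Determinant.det (four_block_mat ?C ?Z ?r ?a)"
    unfolding eq by (rule det_mult[of _ "p + 1"]) (use C in auto)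
  also have "Determinant.det (four_block_mat ?I ?b ?O (1\<^sub>m 1)) = 1"
    by (subst det_four_block_mat_lower_left_zero[where n = p and m = 1]) auto
  also have "Determinant.det (four_block_mat ?C ?Z ?r ?a) = Determinant.det ?C * A p p"
    by (subst det_four_block_mat_upper_right_zero[where n = p and m = 1]) (use C in \<open>auto simp: det_single\<close>)
  finally show ?thesis by simp
qed

lemma nn_integral_exp_square:
  assumes "a > (0::real)"
  shows "(\<integral>\<^sup>+ y. ennreal (exp (- (a * (y - m)\<^sup>2) / 2)) \<partial>lborel) = ennreal (sqrt (2 * pi / a))"
proof -
  have eq: "exp (- (a * (y - m)\<^sup>2) / 2) = sqrt (2 * pi / a) * normal_density m (1 / sqrt a) y" for y
    using assms by (simp add: normal_density_def real_sqrt_divide real_sqrt_mult power_divide field_simps)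
  interpret prob_space "density lborel (normal_density m (1 / sqrt a))"
    using assms by (intro prob_space_normal_density) auto
  have "(\<integral>\<^sup>+ y. ennreal (normal_density m (1 / sqrt a) y) \<partial>lborel) = 1"
    using emeasure_space_1 by (simp add: emeasure_density)
  then show ?thesis
    unfolding eq using assms by (simp add: ennreal_mult nn_integral_cmult)
qed

text \<open>Induction on the dimension, integrating out the last variable and passing to the Schur
  complement. The arbitrary centre \<open>m\<close> is carried along because moment generating
  functions are computed by translating the Gaussian.\<close>

proposition gauss_integral:
  assumes "coercive p c A"
  shows "Determinant.det (kernel_mat p A) > 0 \<and>
    (\<integral>\<^sup>+ x. ennreal (exp (- quad_form p A (\<lambda>i. x i - m i) / 2)) \<partial>leb p) = ennreal (gauss_const p A)"
  using assms
proof (induction p arbitrary: A)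
  case 0
  have "kernel_mat 0 A = 1\<^sub>m 0" by (auto simp: kernel_mat_def)
  then show ?case by (simp add: quad_form_def gauss_const_def PiM_empty)
next
  case (Suc p)
  have S: "sym_kernel (Suc p) A" and c: "c > 0" and a: "A p p > 0"
    using Suc.prems coercive_diag[OF Suc.prems, of p] by (auto simp: coercive_def)
  note IH = Suc.IH[OF coercive_schur_compl[OF Suc.prems]]
  let ?q = "quad_form p (schur_compl p A)"
  have "(\<integral>\<^sup>+ x. ennreal (exp (- quad_form (Suc p) A (\<lambda>i. x i - m i) / 2)) \<partial>leb (Suc p)) =
    (\<integral>\<^sup>+ x. (\<integral>\<^sup>+ y. ennreal (exp (- quad_form (Suc p) A (\<lambda>i. (x(p := y)) i - m i) / 2)) \<partial>lborel) \<partial>leb p)"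
    unfolding lessThan_Suc
    by (rule lebprod.product_nn_integral_insert) (auto simp flip: lessThan_Suc)
  also have "\<dots> = (\<integral>\<^sup>+ x. ennreal (exp (- ?q (\<lambda>i. x i - m i) / 2)) * ennreal (sqrt (2 * pi / A p p)) \<partial>leb p)"
  proof (intro nn_integral_cong)
    fix x :: "nat \<Rightarrow> real"
    \<comment> \<open>\<open>b\<close> is the conditional mean of the last coordinate given the
      others; it affects only the centre of the inner Gaussian, not its integral.\<close>
    define b where "b = m p - (\<Sum>i<p. A p i * (x i - m i)) / A p p"
    have "quad_form (Suc p) A (\<lambda>i. (x(p := y)) i - m i) = ?q (\<lambda>i. x i - m i) + A p p * (y - b)\<^sup>2" for y
      unfolding quad_form_schur_compl[where A=A, OF S a] b_def
      by (intro arg_cong2[where f="(+)"] quad_form_cong) (auto simp: algebra_simps)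
    then have "ennreal (exp (- quad_form (Suc p) A (\<lambda>i. (x(p := y)) i - m i) / 2)) =
        ennreal (exp (- ?q (\<lambda>i. x i - m i) / 2)) * ennreal (exp (- (A p p * (y - b)\<^sup>2) / 2))" for y
      by (simp add: ennreal_mult[symmetric] exp_add[symmetric] field_simps)
    then show "(\<integral>\<^sup>+ y. ennreal (exp (- quad_form (Suc p) A (\<lambda>i. (x(p := y)) i - m i) / 2)) \<partial>lborel) =
        ennreal (exp (- ?q (\<lambda>i. x i - m i) / 2)) * ennreal (sqrt (2 * pi / A p p))"
      by (simp only: nn_integral_exp_square[OF a, of b, symmetric]) (simp add: nn_integral_cmult)
  qed
  also have "\<dots> = ennreal (gauss_const p (schur_compl p A)) * ennreal (sqrt (2 * pi / A p p))"
    using IH by (simp add: nn_integral_multc)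
  also have "\<dots> = ennreal (gauss_const (Suc p) A)"
    using IH a by (simp add: gauss_const_def det_schur_compl ennreal_mult[symmetric] real_sqrt_mult[symmetric] field_simps)
  finally show ?case using IH a by (simp add: det_schur_compl)
qed

section \<open>Inverse kernels and the Gaussian law with a given precision\<close>

definition inverse_kernel :: "nat \<Rightarrow> (nat \<Rightarrow> nat \<Rightarrow> real) \<Rightarrow> (nat \<Rightarrow> nat \<Rightarrow> real) \<Rightarrow> bool" where
  "inverse_kernel p H W \<longleftrightarrow> sym_kernel p H \<and> sym_kernel p W \<and>
     (\<forall>i<p. \<forall>k<p. (\<Sum>j<p. H i j * W j k) = (if i = k then 1 else 0))"

definition kernel_app :: "nat \<Rightarrow> (nat \<Rightarrow> nat \<Rightarrow> real) \<Rightarrow> (nat \<Rightarrow> real) \<Rightarrow> nat \<Rightarrow> real" where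
  "kernel_app p A x i = (\<Sum>j<p. A i j * x j)"

definition kernel_inner :: "nat \<Rightarrow> (nat \<Rightarrow> nat \<Rightarrow> real) \<Rightarrow> (nat \<Rightarrow> nat \<Rightarrow> real) \<Rightarrow> real" where
  "kernel_inner p A B = (\<Sum>i<p. \<Sum>j<p. A i j * B i j)"

definition inner_sum :: "nat \<Rightarrow> (nat \<Rightarrow> real) \<Rightarrow> (nat \<Rightarrow> real) \<Rightarrow> real" where
  "inner_sum p x y = (\<Sum>i<p. x i * y i)"

definition gauss_density :: "nat \<Rightarrow> (nat \<Rightarrow> nat \<Rightarrow> real) \<Rightarrow> (nat \<Rightarrow> real) \<Rightarrow> real" where
  "gauss_density p H x = exp (- quad_form p H x / 2) / gauss_const p H"

lemma quad_form_kernel_app: "quad_form p A x = inner_sum p x (kernel_app p A x)"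
  by (simp add: quad_form_def inner_sum_def kernel_app_def sum_distrib_left mult.assoc)

lemma inner_sum_kernel_app_sym: "sym_kernel p A \<Longrightarrow> inner_sum p x (kernel_app p A y) = inner_sum p y (kernel_app p A x)"
  unfolding inner_sum_def kernel_app_def sum_distrib_left
  by (subst sum.swap, intro sum.cong refl) (auto simp: sym_kernel_def algebra_simps)

lemma kernel_app_inv:
  assumes "inverse_kernel p H W" "i < p"
  shows "kernel_app p H (kernel_app p W x) i = x i"
proof -
  have "kernel_app p H (kernel_app p W x) i = (\<Sum>k<p. (\<Sum>j<p. H i j * W j k) * x k)"
    unfolding kernel_app_def sum_distrib_left sum_distrib_right by (subst sum.swap) (simp add: mult.assoc)
  also have "\<dots> = (\<Sum>k<p. (if i = k then x k else 0))"
    using assms by (intro sum.cong refl) (auto simp: inverse_kernel_def)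
  finally show ?thesis using assms(2) by simp
qed

lemma inner_sum_cong: "(\<And>i. i < p \<Longrightarrow> x i = x' i) \<Longrightarrow> (\<And>i. i < p \<Longrightarrow> y i = y' i) \<Longrightarrow> inner_sum p x y = inner_sum p x' y'"
  unfolding inner_sum_def by (intro sum.cong refl) auto

lemma inner_sum_commute: "inner_sum p x y = inner_sum p y x"
  by (simp add: inner_sum_def mult.commute)

text \<open>Transposing \<open>H W = 1\<close> with both kernels symmetric gives
  \<open>W H = 1\<close>, so the one-sided identity in \<open>inverse_kernel\<close> is
  enough.\<close>

lemma inverse_kernel_sym: 
  assumes "inverse_kernel p H W"
  shows "inverse_kernel p W H"
proof -
  have "(\<Sum>j<p. W i j * H j k) = (\<Sum>j<p. H k j * W j i)" if "i < p" "k < p" for i k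
    by (intro sum.cong refl) (use assms that in \<open>auto simp: inverse_kernel_def sym_kernel_def\<close>)
  then show ?thesis using assms by (auto simp: inverse_kernel_def)
qed

lemma gauss_const_pos: "coercive p c H \<Longrightarrow> gauss_const p H > 0"
  using gauss_integral[of p c H "\<lambda>_. 0"] by (auto simp: gauss_const_def)

text \<open>Adjugate over determinant. The formula is rational in the entries, which later makes the
  inverse a measurable function of the matrix.\<close>

lemma inverse_kernel_adj_mat:
  assumes S: "sym_kernel p H" and d: "Determinant.det (kernel_mat p H) \<noteq> 0"
  shows "inverse_kernel p H (\<lambda>i j. adj_mat (kernel_mat p H) $$ (i,j) / Determinant.det (kernel_mat p H))"
proof -
  let ?M = "kernel_mat p H"
  have M: "?M \<in> carrier_mat p p" by (simp add: kernel_mat_def)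
  define W where "W i j = adj_mat ?M $$ (i,j) / Determinant.det ?M" for i j
  note adj = adj_mat[OF M]
  have HW: "(\<Sum>j<p. H i j * W j k) = (if i = k then 1 else 0)" if "i < p" "k < p" for i k
  proof -
    have "(?M * adj_mat ?M) $$ (i,k) = (\<Sum>j<p. H i j * adj_mat ?M $$ (j,k))"
      using adj(1) M that
      by (auto simp: kernel_mat_def scalar_prod_def atLeast0LessThan intro!: sum.cong)
    then show ?thesis using adj(2) that d
      by (auto simp: W_def sum_divide_distrib[symmetric] split: if_splits)
  qed
  have WH: "(\<Sum>j<p. W i j * H j k) = (if i = k then 1 else 0)" if "i < p" "k < p" for i k
  proof -
    have "(adj_mat ?M * ?M) $$ (i,k) = (\<Sum>j<p. adj_mat ?M $$ (i,j) * H j k)"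
      using adj(1) M that
      by (auto simp: kernel_mat_def scalar_prod_def atLeast0LessThan intro!: sum.cong)
    then show ?thesis using adj(3) that d
      by (auto simp: W_def sum_divide_distrib[symmetric] split: if_splits)
  qed
  \<comment> \<open>Symmetry of the inverse: insert \<open>W H = 1\<close> on one side, transpose
    \<open>H\<close>, and use \<open>W H = 1\<close> again on the other.\<close>
  have "W i k = W k i" if i: "i < p" and k: "k < p" for i k
  proof -
    have "W k i = (\<Sum>l<p. (if i = l then 1 else 0) * W k l)"
      using i by (simp add: if_distrib[of "\<lambda>z. z * _"] cong: if_cong)
    also have "\<dots> = (\<Sum>l<p. (\<Sum>j<p. W i j * H j l) * W k l)"
      using WH i by (intro sum.cong refl) simp
    also have "\<dots> = (\<Sum>j<p. W i j * (\<Sum>l<p. W k l * H l j))"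
      unfolding sum_distrib_left sum_distrib_right
      by (subst sum.swap) (intro sum.cong refl, use symkD[OF S] in \<open>simp add: algebra_simps\<close>)
    also have "\<dots> = (\<Sum>j<p. W i j * (if k = j then 1 else 0))"
      using WH k by (intro sum.cong refl) simp
    finally show ?thesis using k by (simp add: if_distrib[of "\<lambda>z. _ * z"] cong: if_cong)
  qed
  then have "inverse_kernel p H W" using HW S by (auto simp: inverse_kernel_def sym_kernel_def)
  then show ?thesis unfolding W_def .
qed

lemma coercive_inv_exists:
  assumes "coercive p c H"
  shows "\<exists>W. inverse_kernel p H W"
  using inverse_kernel_adj_mat[of p H] gauss_integral[OF assms, of "\<lambda>_. 0"] assms
  by (auto simp: coercive_def)

text \<open>Completing the square: \<open>kernel_app p W h\<close> is the mean of the Gaussian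
  tilted by \<open>exp (inner_sum p h x)\<close>.\<close>

lemma quad_form_shift:
  assumes "inverse_kernel p H W"
  shows "quad_form p H (\<lambda>i. x i - kernel_app p W h i) = quad_form p H x - 2 * inner_sum p h x + quad_form p W h"
proof -
  let ?m = "kernel_app p W h"
  have S: "sym_kernel p H" "sym_kernel p W" using assms by (auto simp: inverse_kernel_def)
  have "quad_form p H (\<lambda>i. x i - ?m i) = quad_form p H x - inner_sum p x (kernel_app p H ?m) - inner_sum p ?m (kernel_app p H x) + inner_sum p ?m (kernel_app p H ?m)"
    unfolding quad_form_kernel_app inner_sum_def kernel_app_def
    by (simp add: algebra_simps sum_subtractf sum.distrib)
  also have "inner_sum p ?m (kernel_app p H x) = inner_sum p x (kernel_app p H ?m)" by (rule inner_sum_kernel_app_sym[OF S(1)])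
  also have "inner_sum p x (kernel_app p H ?m) = inner_sum p h x"
    using kernel_app_inv[OF assms] by (subst inner_sum_commute) (intro inner_sum_cong, auto)
  also have "inner_sum p ?m (kernel_app p H ?m) = quad_form p W h"
    unfolding quad_form_kernel_app using kernel_app_inv[OF assms] by (subst inner_sum_commute) (intro inner_sum_cong, auto)
  finally show ?thesis by simp
qed

lemma gauss_density_measurable [measurable]: "gauss_density p H \<in> borel_measurable (leb p)"
  unfolding gauss_density_def by measurable

lemma inner_sum_measurable [measurable]: "(\<lambda>x. inner_sum p h x) \<in> borel_measurable (leb p)"
  unfolding inner_sum_def by measurable

lemma gauss_density_pos: "coercive p c H \<Longrightarrow> gauss_density p H x > 0"
  using gauss_const_pos[of p c H] by (simp add: gauss_density_def)

lemma nn_integral_gauss_density: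
  assumes "coercive p c H"
  shows "(\<integral>\<^sup>+ x. ennreal (gauss_density p H x) \<partial>leb p) = 1"
proof -
  have Z: "gauss_const p H > 0" by (rule gauss_const_pos[OF assms])
  have "(\<integral>\<^sup>+ x. ennreal (gauss_density p H x) \<partial>leb p) =
      (\<integral>\<^sup>+ x. ennreal (exp (- quad_form p H x / 2)) * ennreal (1 / gauss_const p H) \<partial>leb p)"
    using Z by (intro nn_integral_cong) (simp add: gauss_density_def ennreal_mult[symmetric])
  also have "\<dots> = ennreal (gauss_const p H) * ennreal (1 / gauss_const p H)"
    using gauss_integral[OF assms, of "\<lambda>_. 0"] by (simp add: nn_integral_multc)
  also have "\<dots> = 1" using Z by (simp add: ennreal_mult[symmetric])
  finally show ?thesis .
qed

definition gauss_law :: "nat \<Rightarrow> (nat \<Rightarrow> nat \<Rightarrow> real) \<Rightarrow> (nat \<Rightarrow> real) measure" where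
  "gauss_law p H = density (leb p) (\<lambda>x. ennreal (gauss_density p H x))"

lemma sets_gauss_law [measurable_cong, simp]: "sets (gauss_law p H) = sets (leb p)"
  by (simp add: gauss_law_def)

lemma space_gauss_law [simp]: "space (gauss_law p H) = space (leb p)"
  by (simp add: gauss_law_def)

lemma nn_integral_gauss_law:
  "f \<in> borel_measurable (leb p) \<Longrightarrow>
    (\<integral>\<^sup>+ x. f x \<partial>gauss_law p H) = (\<integral>\<^sup>+ x. ennreal (gauss_density p H x) * f x \<partial>leb p)"
  unfolding gauss_law_def by (rule nn_integral_density) auto

lemma prob_space_gauss_law: "coercive p c H \<Longrightarrow> prob_space (gauss_law p H)"
  using nn_integral_gauss_density[of p c H]
  by (intro prob_spaceI) (simp add: gauss_law_def emeasure_density cong: nn_integral_cong)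

lemma gauss_law_linear_mgf:
  assumes H: "coercive p c H" and W: "inverse_kernel p H W"
  shows "(\<integral>\<^sup>+ x. ennreal (exp (inner_sum p h x)) \<partial>gauss_law p H) = ennreal (exp (quad_form p W h / 2))"
proof -
  have Z: "gauss_const p H > 0" by (rule gauss_const_pos[OF H])
  let ?m = "kernel_app p W h"
  have "(\<integral>\<^sup>+ x. ennreal (exp (inner_sum p h x)) \<partial>gauss_law p H) =
     (\<integral>\<^sup>+ x. ennreal (exp (quad_form p W h / 2) / gauss_const p H) * ennreal (exp (- quad_form p H (\<lambda>i. x i - ?m i) / 2)) \<partial>leb p)"
    using Z unfolding quad_form_shift[OF W]
    by (subst nn_integral_gauss_law)
      (auto intro!: nn_integral_cong simp: gauss_density_def ennreal_mult[symmetric] exp_add[symmetric] exp_diff field_simps)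
  also have "\<dots> = ennreal (exp (quad_form p W h / 2) / gauss_const p H) * ennreal (gauss_const p H)"
    using gauss_integral[OF H, of ?m] by (simp add: nn_integral_cmult)
  also have "\<dots> = ennreal (exp (quad_form p W h / 2))"
    using Z by (simp add: ennreal_mult[symmetric])
  finally show ?thesis .
qed

text \<open>Serves to dominate second difference quotients of the exponential. For
  \<open>y \<ge> 0\<close> the left side is \<open>exp y * (1 - exp (- y))^2\<close>, and
  \<open>1 - exp (- y) \<le> y\<close>.\<close>

lemma exp_sym_bound: "exp y + exp (- y) - 2 \<le> y\<^sup>2 * (exp \<bar>y\<bar> :: real)"
proof -
  have *: "exp y + exp (- y) - 2 \<le> y\<^sup>2 * exp y" if "y \<ge> 0" for y :: real
  proof -
    have 1: "1 - exp (- y) \<le> y" using exp_ge_add_one_self[of "-y"] by linarith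
    have "exp y + exp (- y) - 2 = exp y * (1 - exp (- y))\<^sup>2"
      by (simp add: power2_eq_square algebra_simps exp_add[symmetric])
    also have "\<dots> \<le> exp y * y\<^sup>2"
      using 1 that by (intro mult_left_mono power_mono) auto
    finally show ?thesis by (simp add: mult.commute)
  qed
  show ?thesis using *[of y] *[of "-y"] by (cases "y \<ge> 0") auto
qed

lemma exp_sym_nonneg: "0 \<le> exp y + exp (- y) - (2::real)"
  using exp_ge_add_one_self[of y] exp_ge_add_one_self[of "-y"] by linarith

lemma square_le_exp_abs: "u\<^sup>2 \<le> 2 * exp \<bar>u :: real\<bar>"
proof -
  have "u\<^sup>2 / 2 \<le> exp \<bar>u\<bar>" using exp_lower_Taylor_quadratic[of "\<bar>u\<bar>"] abs_ge_zero[of u] by (simp del: abs_ge_zero)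
  then show ?thesis by simp
qed

text \<open>The second moment is the second derivative at \<open>0\<close> of the moment generating
  function. It is obtained as a limit of symmetric second difference quotients, passed under the
  integral by dominated convergence.\<close>

lemma gauss_law_second_moment_lin:
  assumes H: "coercive p c H" and W: "inverse_kernel p H W"
  shows "integrable (gauss_law p H) (\<lambda>x. (inner_sum p h x)\<^sup>2)" "integral\<^sup>L (gauss_law p H) (\<lambda>x. (inner_sum p h x)\<^sup>2) = quad_form p W h"
proof -
  interpret prob_space "gauss_law p H" by (rule prob_space_gauss_law[OF H])
  let ?u = "\<lambda>x. inner_sum p h x"
  let ?v = "quad_form p W h"
  have e: "integrable (gauss_law p H) (\<lambda>x. exp (s * ?u x))" "integral\<^sup>L (gauss_law p H) (\<lambda>x. exp (s * ?u x)) = exp (s\<^sup>2 * ?v / 2)" for s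
  proof -
    have "(\<integral>\<^sup>+ x. ennreal (exp (s * ?u x)) \<partial>gauss_law p H) = ennreal (exp (s\<^sup>2 * ?v / 2))"
      using gauss_law_linear_mgf[OF H W, of "\<lambda>i. s * h i"]
      by (simp add: inner_sum_def quad_form_def sum_distrib_left power2_eq_square algebra_simps)
    then have "has_bochner_integral (gauss_law p H) (\<lambda>x. exp (s * ?u x)) (exp (s\<^sup>2 * ?v / 2))"
      by (intro has_bochner_integral_nn_integral) auto
    then show "integrable (gauss_law p H) (\<lambda>x. exp (s * ?u x))" "integral\<^sup>L (gauss_law p H) (\<lambda>x. exp (s * ?u x)) = exp (s\<^sup>2 * ?v / 2)"
      by (auto simp: has_bochner_integral_iff)
  qed
  define s where "s k = 1 / real (Suc k)" for k
  have s: "0 < s k" "s k \<le> 1" for k by (auto simp: s_def)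
  define f where "f k x = (exp (s k * ?u x) + exp ((- s k) * ?u x) - 2) / (s k)\<^sup>2" for k x
  \<comment> \<open>Dominating function: the quotient is at most
    \<open>u^2 * exp \<bar>s * u\<bar>\<close>, and \<open>u^2 \<le> 2 * exp \<bar>u\<bar>\<close>
    together with \<open>s \<le> 1\<close> bounds this by
    \<open>2 * exp (2 * \<bar>u\<bar>)\<close>.\<close>
  define w where "w x = 2 * (exp (2 * ?u x) + exp ((- 2) * ?u x))" for x
  have wi: "integrable (gauss_law p H) w" unfolding w_def
    by (intro integrable_mult_right Bochner_Integration.integrable_add e)
  have lim: "(\<lambda>k. f k x) \<longlonglongrightarrow> (?u x)\<^sup>2" for x
  proof -
    have "((\<lambda>t. (exp (t * u) + exp ((- t) * u) - 2) / t\<^sup>2) \<longlongrightarrow> u\<^sup>2) (at_right 0)" for u :: real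
    proof -
      consider "u > 0" | "u = 0" | "u < 0" by linarith
      then show ?thesis
      proof cases
        case 1 then show ?thesis by (real_asymp simp: power2_eq_square)
      next
        case 2 then show ?thesis by simp
      next
        case 3 then show ?thesis by (real_asymp simp: power2_eq_square)
      qed
    qed
    moreover have "filterlim s (at_right 0) sequentially"
      unfolding s_def by real_asymp
    ultimately show ?thesis unfolding f_def by (rule filterlim_compose)
  qed
  have bound: "norm (f k x) \<le> w x" for k x
  proof -
    have "norm (f k x) = f k x" using exp_sym_nonneg[of "s k * ?u x"] by (simp add: f_def)
    also have "\<dots> \<le> (s k * ?u x)\<^sup>2 * exp \<bar>s k * ?u x\<bar> / (s k)\<^sup>2"
      unfolding f_def using exp_sym_bound[of "s k * ?u x"] by (intro divide_right_mono) auto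
    also have "\<dots> = (?u x)\<^sup>2 * exp \<bar>s k * ?u x\<bar>" using s(1)[of k] by (simp add: power_mult_distrib)
    also have "\<dots> \<le> (2 * exp \<bar>?u x\<bar>) * exp \<bar>?u x\<bar>"
      using s[of k] square_le_exp_abs[of "?u x"] by (intro mult_mono) (auto simp: abs_mult mult_left_le_one_le)
    also have "\<dots> = 2 * exp (2 * \<bar>?u x\<bar>)" by (simp add: exp_add[symmetric])
    also have "\<dots> \<le> w x" by (auto simp: w_def abs_if)
    finally show ?thesis .
  qed
  have intf: "integral\<^sup>L (gauss_law p H) (f k) = (2 * exp ((s k)\<^sup>2 * ?v / 2) - 2) / (s k)\<^sup>2" for k
    unfolding f_def using e[of "s k"] e[of "- s k"] prob_space by simp
  have fm: "f k \<in> borel_measurable (gauss_law p H)" for k unfolding f_def by measurable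
  have DCT: "integrable (gauss_law p H) (\<lambda>x. (?u x)\<^sup>2)" "(\<lambda>k. integral\<^sup>L (gauss_law p H) (f k)) \<longlonglongrightarrow> integral\<^sup>L (gauss_law p H) (\<lambda>x. (?u x)\<^sup>2)"
    by (rule integrable_dominated_convergence[where w=w and s=f] integral_dominated_convergence[where w=w];
        use wi lim bound fm in auto)+
  show "integrable (gauss_law p H) (\<lambda>x. (?u x)\<^sup>2)" by fact
  have "(\<lambda>k. (2 * exp ((s k)\<^sup>2 * ?v / 2) - 2) / (s k)\<^sup>2) \<longlonglongrightarrow> ?v"
  proof -
    have "(\<lambda>k. (2 * exp ((1 / real (Suc k))\<^sup>2 * v / 2) - 2) / (1 / real (Suc k))\<^sup>2) \<longlonglongrightarrow> v" for v :: real
    proof -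
      consider "v > 0" | "v = 0" | "v < 0" by linarith
      then show ?thesis
      proof cases
        case 1 then show ?thesis by real_asymp
      next
        case 2 then show ?thesis by simp
      next
        case 3 then show ?thesis by real_asymp
      qed
    qed
    then show ?thesis unfolding s_def by blast
  qed
  then show "integral\<^sup>L (gauss_law p H) (\<lambda>x. (?u x)\<^sup>2) = ?v"
    using DCT(2) unfolding intf by (rule LIMSEQ_unique[rotated])
qed

section \<open>Estimates in the Frobenius norm, whose square is \<open>kernel_sq\<close>\<close>

definition kernel_sq :: "nat \<Rightarrow> (nat \<Rightarrow> nat \<Rightarrow> real) \<Rightarrow> real" where
  "kernel_sq p A = (\<Sum>i<p. \<Sum>j<p. (A i j)\<^sup>2)"

lemma kernel_sq_nonneg [simp]: "0 \<le> kernel_sq p A"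
  by (simp add: kernel_sq_def sum_nonneg)

lemma norm_sq_nonneg [simp]: "0 \<le> norm_sq p x"
  by (simp add: norm_sq_def sum_nonneg)

lemma kernel_sq_rows: "kernel_sq p A = (\<Sum>i<p. norm_sq p (A i))"
  by (simp add: kernel_sq_def norm_sq_def)

lemma kernel_sq_cols: "kernel_sq p A = (\<Sum>j<p. norm_sq p (\<lambda>i. A i j))"
  unfolding kernel_sq_def norm_sq_def by (rule sum.swap)

lemma inner_sum_Cauchy: "\<bar>inner_sum p x y\<bar> \<le> sqrt (norm_sq p x) * sqrt (norm_sq p y)"
  using real_sqrt_le_mono[OF Cauchy_Schwarz_ineq_sum[of x y "{..<p}"]]
  by (simp add: inner_sum_def norm_sq_def real_sqrt_mult)

lemma kernel_inner_Cauchy: "\<bar>kernel_inner p A B\<bar> \<le> sqrt (kernel_sq p A) * sqrt (kernel_sq p B)"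
proof -
  have "kernel_inner p A B = (\<Sum>z\<in>{..<p}\<times>{..<p}. A (fst z) (snd z) * B (fst z) (snd z))"
    and "kernel_sq p A = (\<Sum>z\<in>{..<p}\<times>{..<p}. (A (fst z) (snd z))\<^sup>2)"
    and "kernel_sq p B = (\<Sum>z\<in>{..<p}\<times>{..<p}. (B (fst z) (snd z))\<^sup>2)"
    by (simp_all add: kernel_inner_def kernel_sq_def sum.cartesian_product case_prod_unfold)
  then show ?thesis
    using real_sqrt_le_mono[OF Cauchy_Schwarz_ineq_sum[of "\<lambda>z. A (fst z) (snd z)" "\<lambda>z. B (fst z) (snd z)" "{..<p}\<times>{..<p}"]]
    by (simp add: real_sqrt_mult)
qed

lemma norm_sq_kernel_app_le: "norm_sq p (kernel_app p A x) \<le> kernel_sq p A * norm_sq p x"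
proof -
  have "norm_sq p (kernel_app p A x) \<le> (\<Sum>i<p. norm_sq p (A i) * norm_sq p x)"
    unfolding norm_sq_def[of p "kernel_app p A x"]
    by (intro sum_mono) (auto simp: kernel_app_def norm_sq_def Cauchy_Schwarz_ineq_sum)
  then show ?thesis by (simp add: kernel_sq_rows sum_distrib_right)
qed

text \<open>The operator norm is dominated by the Frobenius norm. This is how small Frobenius
  perturbations control spectra below.\<close>

lemma quad_form_le_kernel_sq: "\<bar>quad_form p A x\<bar> \<le> sqrt (kernel_sq p A) * norm_sq p x"
proof -
  have "\<bar>quad_form p A x\<bar> \<le> sqrt (norm_sq p x) * sqrt (norm_sq p (kernel_app p A x))"
    unfolding quad_form_kernel_app by (rule inner_sum_Cauchy)
  also have "\<dots> \<le> sqrt (norm_sq p x) * sqrt (kernel_sq p A * norm_sq p x)"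
    by (intro mult_left_mono real_sqrt_le_mono norm_sq_kernel_app_le) auto
  also have "\<dots> = sqrt (kernel_sq p A) * (sqrt (norm_sq p x) * sqrt (norm_sq p x))"
    by (simp add: real_sqrt_mult)
  also have "\<dots> = sqrt (kernel_sq p A) * norm_sq p x" by simp
  finally show ?thesis .
qed

lemma quad_form_scale_diff: "quad_form p (\<lambda>i j. A i j - t * B i j) x = quad_form p A x - t * quad_form p B x"
  by (simp add: quad_form_def algebra_simps sum_subtractf sum_distrib_left)

lemma kernel_app_cong:
  "(\<And>j. j < p \<Longrightarrow> x j = y j) \<Longrightarrow> kernel_app p A x i = kernel_app p A y i"
  by (simp add: kernel_app_def)

text \<open>With \<open>w = W v\<close>, one has
  \<open>c |w|^2 \<le> w . H w = w . v \<le> |w| |v|\<close>. Squares are used on both sides to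
  match the hypotheses of \<open>inverse_difference_bound\<close>.\<close>

lemma coercive_inv_bound:
  assumes H: "coercive p c H" and W: "inverse_kernel p H W"
  shows "norm_sq p (kernel_app p W v) \<le> (1 / c)\<^sup>2 * norm_sq p v"
proof -
  let ?w = "kernel_app p W v"
  have c: "c > 0" using H by (auto simp: coercive_def)
  have "c * norm_sq p ?w \<le> quad_form p H ?w" using H by (auto simp: coercive_def)
  also have "\<dots> = inner_sum p ?w v"
    unfolding quad_form_kernel_app by (intro inner_sum_cong refl kernel_app_inv[OF W])
  also have "\<dots> \<le> sqrt (norm_sq p ?w) * sqrt (norm_sq p v)" using inner_sum_Cauchy[of p ?w v] by auto
  finally have *: "sqrt (norm_sq p ?w) * (c * sqrt (norm_sq p ?w)) \<le> sqrt (norm_sq p ?w) * sqrt (norm_sq p v)"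
    by (simp add: mult.left_commute mult.commute)
  have "c * sqrt (norm_sq p ?w) \<le> sqrt (norm_sq p v)"
  proof (cases "norm_sq p ?w = 0")
    case False
    then have "0 < norm_sq p ?w" using norm_sq_nonneg[of p ?w] by linarith
    then have "sqrt (norm_sq p ?w) > 0" by simp
    then show ?thesis using * by (simp only: mult_le_cancel_left_pos)
  qed simp
  then have "(c * sqrt (norm_sq p ?w))\<^sup>2 \<le> (sqrt (norm_sq p v))\<^sup>2"
    using c by (intro power_mono) auto
  then show ?thesis using c by (simp add: power_mult_distrib power_divide field_simps)
qed

text \<open>Ideal property of the Frobenius norm: multiplication by an operator acts on each row
  separately, and in the companion lemma on each column.\<close>

lemma kernel_sq_kernel_app_right:
  assumes B: "\<And>v. norm_sq p (kernel_app p B v) \<le> b * norm_sq p v"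
  shows "kernel_sq p (\<lambda>i. kernel_app p B (A i)) \<le> b * kernel_sq p A"
  unfolding kernel_sq_rows sum_distrib_left by (intro sum_mono B)

lemma kernel_sq_kernel_app_left:
  assumes B: "\<And>v. norm_sq p (kernel_app p B v) \<le> b * norm_sq p v"
  shows "kernel_sq p (\<lambda>i j. kernel_app p B (\<lambda>k. A k j) i) \<le> b * kernel_sq p A"
  unfolding kernel_sq_cols sum_distrib_left by (intro sum_mono B)

text \<open>Resolvent identity \<open>A' - B' = A' (B - A) B'\<close>, followed by the ideal
  property on both sides; \<open>?F\<close> is the product \<open>(B - A) B'\<close>.\<close>

lemma inverse_difference_bound:
  assumes A: "inverse_kernel p A A'" and B: "inverse_kernel p B B'"
    and a: "\<And>v. norm_sq p (kernel_app p A' v) \<le> a * norm_sq p v" "a \<ge> 0"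
    and b: "\<And>v. norm_sq p (kernel_app p B' v) \<le> b * norm_sq p v"
  shows "kernel_sq p (\<lambda>i j. A' i j - B' i j) \<le> a * (b * kernel_sq p (\<lambda>i j. A i j - B i j))"
proof -
  let ?E = "\<lambda>i j. B i j - A i j"
  let ?F = "\<lambda>i. kernel_app p B' (?E i)"
  note A' = inverse_kernel_sym[OF A] and B' = inverse_kernel_sym[OF B]
  have eq: "A' i j - B' i j = kernel_app p A' (\<lambda>k. ?F k j) i" if ij: "i < p" "j < p" for i j
  proof -
    have F: "?F k j = (if k = j then 1 else 0) - kernel_app p A (\<lambda>l. B' l j) k" if "k < p" for k
    proof -
      have "?F k j = (\<Sum>l<p. (B k l - A k l) * B' l j)"
        unfolding kernel_app_def by (intro sum.cong refl) (use B ij in \<open>auto simp: inverse_kernel_def sym_kernel_def\<close>)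
      also have "\<dots> = (\<Sum>l<p. B k l * B' l j) - kernel_app p A (\<lambda>l. B' l j) k"
        by (simp add: kernel_app_def algebra_simps sum_subtractf)
      finally show ?thesis using B that ij by (simp add: inverse_kernel_def)
    qed
    have "kernel_app p A' (\<lambda>k. ?F k j) i = kernel_app p A' (\<lambda>k. (if k = j then 1 else 0) - kernel_app p A (\<lambda>l. B' l j) k) i"
      by (intro kernel_app_cong F)
    also have "\<dots> = (\<Sum>k<p. A' i k * (if k = j then 1 else 0)) - kernel_app p A' (kernel_app p A (\<lambda>l. B' l j)) i"
      by (simp add: kernel_app_def algebra_simps sum_subtractf)
    also have "\<dots> = A' i j - B' i j"
      using kernel_app_inv[OF A' ij(1)] ij by (simp add: if_distrib[of "\<lambda>z. _ * z"] cong: if_cong)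
    finally show ?thesis ..
  qed
  have "kernel_sq p (\<lambda>i j. A' i j - B' i j) = kernel_sq p (\<lambda>i j. kernel_app p A' (\<lambda>k. ?F k j) i)"
    unfolding kernel_sq_def by (intro sum.cong refl) (simp add: eq)
  also have "\<dots> \<le> a * kernel_sq p ?F" by (rule kernel_sq_kernel_app_left[OF a(1)])
  also have "\<dots> \<le> a * (b * kernel_sq p ?E)" by (intro mult_left_mono kernel_sq_kernel_app_right b a)
  also have "kernel_sq p ?E = kernel_sq p (\<lambda>i j. A i j - B i j)" by (simp add: kernel_sq_def power2_commute)
  finally show ?thesis .
qed

section \<open>Moments of quadratic forms and ratios of normalising constants\<close>

lemma inner_sum_add_unit:
  assumes "i < p" "j < p"
  shows "inner_sum p (\<lambda>k. (if k = i then 1 else 0) + s * (if k = j then 1 else 0)) x = x i + s * x j"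
  using assms unfolding inner_sum_def
  by (simp add: algebra_simps sum.distrib if_distrib[of "\<lambda>z. _ * z"] if_distrib[of "\<lambda>z. z * _"] cong: if_cong)

lemma quad_form_add_unit:
  assumes "i < p" "j < p" "sym_kernel p W"
  shows "quad_form p W (\<lambda>k. (if k = i then 1 else 0) + s * (if k = j then 1 else 0)) = W i i + 2 * s * W i j + s\<^sup>2 * W j j"
proof -
  let ?h = "\<lambda>k. (if k = i then 1 else 0) + s * (if k = j then 1 else (0::real))"
  have "kernel_app p W ?h l = W l i + s * W l j" for l
    using assms unfolding kernel_app_def
    by (simp add: algebra_simps sum.distrib if_distrib[of "\<lambda>z. _ * z"] if_distrib[of "\<lambda>z. z * _"] cong: if_cong)
  then show ?thesis
    unfolding quad_form_kernel_app using assms symkD[OF assms(3), of i j]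
    by (simp add: inner_sum_add_unit algebra_simps power2_eq_square)
qed

text \<open>Polarisation: \<open>x i * x j\<close> is a quarter of the difference of the squares of
  \<open>x i + x j\<close> and \<open>x i - x j\<close>.\<close>

lemma gauss_law_second_moment:
  assumes H: "coercive p c H" and W: "inverse_kernel p H W" and ij: "i < p" "j < p"
  shows "integrable (gauss_law p H) (\<lambda>x. x i * x j)" "integral\<^sup>L (gauss_law p H) (\<lambda>x. x i * x j) = W i j"
proof -
  have S: "sym_kernel p W" using W by (auto simp: inverse_kernel_def)
  let ?f = "\<lambda>s x. x i + s * x j :: real"
  have m: "integrable (gauss_law p H) (\<lambda>x. (?f s x)\<^sup>2)"
    "integral\<^sup>L (gauss_law p H) (\<lambda>x. (?f s x)\<^sup>2) = W i i + 2 * s * W i j + s\<^sup>2 * W j j" for s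
    using gauss_law_second_moment_lin[OF H W, of "\<lambda>k. (if k = i then 1 else 0) + s * (if k = j then 1 else 0)"]
    unfolding inner_sum_add_unit[OF ij] quad_form_add_unit[OF ij S] by auto
  have eq: "(\<lambda>x. x i * x j) = (\<lambda>x. ((?f 1 x)\<^sup>2 - (?f (-1) x)\<^sup>2) / 4)"
    by (auto simp: fun_eq_iff power2_eq_square algebra_simps)
  show "integrable (gauss_law p H) (\<lambda>x. x i * x j)"
    unfolding eq by (intro integrable_divide_zero Bochner_Integration.integrable_diff m)
  show "integral\<^sup>L (gauss_law p H) (\<lambda>x. x i * x j) = W i j"
    unfolding eq using m[of 1] m[of "-1"] by simp
qed

lemma gauss_law_quad_form_moment:
  assumes H: "coercive p c H" and W: "inverse_kernel p H W"
  shows "integrable (gauss_law p H) (quad_form p D)" "integral\<^sup>L (gauss_law p H) (quad_form p D) = kernel_inner p D W"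
proof -
  have eq: "quad_form p D = (\<lambda>x. \<Sum>i<p. \<Sum>j<p. D i j * (x i * x j))"
    by (simp add: quad_form_def fun_eq_iff algebra_simps)
  have i: "integrable (gauss_law p H) (\<lambda>x. D i j * (x i * x j))" if "i < p" "j < p" for i j
    using gauss_law_second_moment(1)[OF H W that] by simp
  show "integrable (gauss_law p H) (quad_form p D)"
    unfolding eq by (intro Bochner_Integration.integrable_sum i) auto
  have "integral\<^sup>L (gauss_law p H) (quad_form p D) = (\<Sum>i<p. \<Sum>j<p. integral\<^sup>L (gauss_law p H) (\<lambda>x. D i j * (x i * x j)))"
    unfolding eq using i
    by (subst Bochner_Integration.integral_sum, (intro Bochner_Integration.integrable_sum; simp),
        intro sum.cong refl, subst Bochner_Integration.integral_sum) auto
  also have "\<dots> = kernel_inner p D W"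
    unfolding kernel_inner_def by (intro sum.cong refl) (simp add: gauss_law_second_moment[OF H W])
  finally show "integral\<^sup>L (gauss_law p H) (quad_form p D) = kernel_inner p D W" .
qed

text \<open>Supporting line of \<open>exp\<close> at the mean. With a nonnegative integral on the
  right, the inequality can be applied to exponentials of quadratic forms before their integrability
  is known.\<close>

lemma (in prob_space) nn_exp_Jensen:
  assumes "integrable M f"
  shows "ennreal (exp (expectation f)) \<le> (\<integral>\<^sup>+ x. ennreal (exp (f x)) \<partial>M)"
proof -
  let ?m = "expectation f"
  have le: "exp ?m * (1 + f x - ?m) \<le> exp (f x)" for x
  proof -
    have "exp ?m * (1 + (f x - ?m)) \<le> exp ?m * exp (f x - ?m)"
      by (intro mult_left_mono exp_ge_add_one_self) auto
    then show ?thesis by (simp add: exp_add[symmetric] algebra_simps)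
  qed
  show ?thesis
  proof (cases "(\<integral>\<^sup>+ x. ennreal (exp (f x)) \<partial>M) = \<infinity>")
    case False
    have [measurable]: "f \<in> borel_measurable M" using assms by auto
    have int: "integrable M (\<lambda>x. exp (f x))"
      using False by (intro integrableI_nonneg) (auto simp: top.not_eq_extremum)
    have "exp ?m = expectation (\<lambda>x. exp ?m * (1 + f x - ?m))"
      using assms by (simp add: prob_space)
    also have "\<dots> \<le> expectation (\<lambda>x. exp (f x))"
      by (intro integral_mono int le) (use assms in auto)
    finally show ?thesis
      by (subst nn_integral_eq_integral[OF int]) auto
  qed simp
qed

lemma gauss_law_exp_quad_form_ge:
  assumes H: "coercive p c H" and W: "inverse_kernel p H W"
  shows "ennreal (exp (kernel_inner p D W)) \<le> (\<integral>\<^sup>+ x. ennreal (exp (quad_form p D x)) \<partial>gauss_law p H)"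
  using prob_space.nn_exp_Jensen[OF prob_space_gauss_law[OF H] gauss_law_quad_form_moment(1)[OF H W]]
  by (simp add: gauss_law_quad_form_moment(2)[OF H W])

text \<open>Tilting by \<open>exp (quad_form p D x)\<close> replaces the precision \<open>Om\<close>
  by \<open>Om - 2 D\<close>, so the expectation is a ratio of normalising constants.\<close>

lemma gauss_law_exp_quad_form:
  assumes O: "coercive p c Om" and H: "coercive p c' (\<lambda>i j. Om i j - 2 * D i j)"
  shows "(\<integral>\<^sup>+ x. ennreal (exp (quad_form p D x)) \<partial>gauss_law p Om) = ennreal (gauss_const p (\<lambda>i j. Om i j - 2 * D i j) / gauss_const p Om)"
proof -
  let ?H = "\<lambda>i j. Om i j - 2 * D i j"
  have Z: "gauss_const p Om > 0" "gauss_const p ?H > 0" using gauss_const_pos[OF O] gauss_const_pos[OF H] by auto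
  have "(\<integral>\<^sup>+ x. ennreal (exp (quad_form p D x)) \<partial>gauss_law p Om) =
     (\<integral>\<^sup>+ x. ennreal (gauss_const p ?H / gauss_const p Om) * ennreal (gauss_density p ?H x) \<partial>leb p)"
    using Z by (subst nn_integral_gauss_law)
      (auto intro!: nn_integral_cong simp: gauss_density_def ennreal_mult[symmetric] exp_add[symmetric] quad_form_scale_diff
        diff_divide_distrib)
  then show ?thesis using nn_integral_gauss_density[OF H] by (simp add: nn_integral_cmult)
qed

lemma gauss_const_ratio_ge:
  assumes O: "coercive p c Om" and S: "inverse_kernel p Om S" and H: "coercive p c' (\<lambda>i j. Om i j - 2 * D i j)"
  shows "exp (kernel_inner p D S) \<le> gauss_const p (\<lambda>i j. Om i j - 2 * D i j) / gauss_const p Om"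
  using gauss_law_exp_quad_form_ge[OF O S, of D] gauss_const_pos[OF O] gauss_const_pos[OF H] unfolding gauss_law_exp_quad_form[OF O H] 
  by (subst (asm) ennreal_le_iff) auto

text \<open>The lower bound with the two Gaussians exchanged: going back from
  \<open>Om - 2 D\<close> to \<open>Om\<close> is the tilt by \<open>- D\<close>.\<close>

lemma gauss_const_ratio_le:
  assumes O: "coercive p c Om" and H: "coercive p c' (\<lambda>i j. Om i j - 2 * D i j)"
    and W: "inverse_kernel p (\<lambda>i j. Om i j - 2 * D i j) W"
  shows "gauss_const p (\<lambda>i j. Om i j - 2 * D i j) / gauss_const p Om \<le> exp (kernel_inner p D W)"
proof -
  let ?H = "\<lambda>i j. Om i j - 2 * D i j"
  have "exp (kernel_inner p (\<lambda>i j. - D i j) W) \<le> gauss_const p Om / gauss_const p ?H"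
    using gauss_const_ratio_ge[OF H W, of c "\<lambda>i j. - D i j"] O by simp
  moreover have "kernel_inner p (\<lambda>i j. - D i j) W = - kernel_inner p D W" by (simp add: kernel_inner_def sum_negf)
  ultimately show ?thesis using gauss_const_pos[OF O] gauss_const_pos[OF H] by (simp add: exp_minus field_simps)
qed

lemma coercive_perturb:
  assumes O: "coercive p c Om" and D: "sym_kernel p D" "4 * sqrt (kernel_sq p D) \<le> c"
  shows "coercive p (c / 2) (\<lambda>i j. Om i j - 2 * D i j)"
proof -
  have "c / 2 * norm_sq p x \<le> quad_form p (\<lambda>i j. Om i j - 2 * D i j) x" for x
  proof -
    have "2 * \<bar>quad_form p D x\<bar> \<le> 2 * (sqrt (kernel_sq p D) * norm_sq p x)"
      using quad_form_le_kernel_sq[of p D x] by simp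
    also have "\<dots> \<le> c / 2 * norm_sq p x"
      using mult_right_mono[OF D(2) norm_sq_nonneg[of p x]] by simp
    finally have "2 * quad_form p D x \<le> c / 2 * norm_sq p x" by linarith
    moreover have "c * norm_sq p x \<le> quad_form p Om x" using O by (auto simp: coercive_def)
    ultimately show ?thesis unfolding quad_form_scale_diff by (simp add: field_simps)
  qed
  then show ?thesis using O D by (auto simp: coercive_def sym_kernel_def)
qed

text \<open>The logarithm is at most \<open>tr (D W)\<close>, where \<open>W\<close> is the
  covariance of the tilted law. Since \<open>W - S\<close> is of order \<open>D\<close> by
  \<open>inverse_difference_bound\<close>, the excess over the mean \<open>tr (D S)\<close> is
  quadratic in \<open>D\<close>. The smallness condition preserves half of the modulus, so
  \<open>W\<close> has operator norm at most \<open>2 T\<close>.\<close>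

proposition gauss_law_exp_quad_form_le:
  assumes O: "coercive p (1 / T) Om" and S: "inverse_kernel p Om S"
    and D: "sym_kernel p D" "4 * T * sqrt (kernel_sq p D) \<le> 1"
  shows "(\<integral>\<^sup>+ x. ennreal (exp (quad_form p D x)) \<partial>gauss_law p Om) \<le> ennreal (exp (kernel_inner p D S + 4 * T\<^sup>2 * kernel_sq p D))"
proof -
  let ?H = "\<lambda>i j. Om i j - 2 * D i j"
  have T: "T > 0" using O by (auto simp: coercive_def)
  have H: "coercive p ((1 / T) / 2) ?H"
    using D T by (intro coercive_perturb[OF O]) (auto simp: field_simps)
  obtain W where W: "inverse_kernel p ?H W" using coercive_inv_exists[OF H] by blast
  \<comment> \<open>Squared operator norms \<open>(2 T)^2\<close> for \<open>W\<close> and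
    \<open>T^2\<close> for \<open>S\<close>, and a factor \<open>4\<close> from
    \<open>?H - Om = - 2 D\<close>, make up \<open>(4 T^2)^2\<close>.\<close>
  have "kernel_sq p (\<lambda>i j. W i j - S i j) \<le> (2 * T)\<^sup>2 * (T\<^sup>2 * kernel_sq p (\<lambda>i j. ?H i j - Om i j))"
    using coercive_inv_bound[OF H W] coercive_inv_bound[OF O S]
    by (intro inverse_difference_bound[OF W S]) (auto simp: mult.commute)
  also have "kernel_sq p (\<lambda>i j. ?H i j - Om i j) = 4 * kernel_sq p D"
    by (simp add: kernel_sq_def sum_distrib_left power_mult_distrib)
  finally have f: "kernel_sq p (\<lambda>i j. W i j - S i j) \<le> (4 * T\<^sup>2)\<^sup>2 * kernel_sq p D"
    by (simp add: power2_eq_square algebra_simps)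
  have "kernel_inner p D W - kernel_inner p D S = kernel_inner p D (\<lambda>i j. W i j - S i j)"
    by (simp add: kernel_inner_def algebra_simps sum_subtractf)
  also have "\<dots> \<le> sqrt (kernel_sq p D) * sqrt (kernel_sq p (\<lambda>i j. W i j - S i j))" using kernel_inner_Cauchy abs_le_D1 by blast
  also have "\<dots> \<le> sqrt (kernel_sq p D) * sqrt ((4 * T\<^sup>2)\<^sup>2 * kernel_sq p D)"
    using f by (intro mult_left_mono) auto
  also have "\<dots> = 4 * T\<^sup>2 * (sqrt (kernel_sq p D) * sqrt (kernel_sq p D))"
    by (simp only: real_sqrt_mult real_sqrt_abs) simp
  also have "\<dots> = 4 * T\<^sup>2 * kernel_sq p D" by simp
  finally have "kernel_inner p D W \<le> kernel_inner p D S + 4 * T\<^sup>2 * kernel_sq p D" by simp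
  then show ?thesis
    unfolding gauss_law_exp_quad_form[OF O H] using gauss_const_ratio_le[OF O H W]
    by (intro ennreal_leI) (meson exp_le_cancel_iff order_trans)
qed

text \<open>The left side is one plus a chi-square divergence. With
  \<open>D = (Om - Om0) / 2\<close> the density ratio is \<open>exp (quad_form p D x)\<close> times
  a ratio of constants. The two first-order terms combine to \<open>tr (D (S0 - S))\<close>, which
  is already quadratic in \<open>S - S0\<close> and gives \<open>T^2 / 2\<close>; the remainder
  \<open>4 T^2 |D|^2\<close> gives \<open>T^6\<close>.\<close>

proposition gauss_law_chi_square:
  assumes O: "coercive p (1 / T) Om" and S: "inverse_kernel p Om S" "coercive p (1 / T) S"
    and O0: "coercive p (1 / T) Om0" and S0: "inverse_kernel p Om0 S0" "coercive p (1 / T) S0"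
    and small: "2 * T ^ 3 * sqrt (kernel_sq p (\<lambda>i j. S i j - S0 i j)) \<le> 1"
  shows "(\<integral>\<^sup>+ x. ennreal (gauss_density p Om0 x / gauss_density p Om x) \<partial>gauss_law p Om0)
    \<le> ennreal (exp ((T\<^sup>2 / 2 + T ^ 6) * kernel_sq p (\<lambda>i j. S i j - S0 i j)))"
proof -
  let ?D = "\<lambda>i j. (Om i j - Om0 i j) / 2"
  let ?e = "kernel_sq p (\<lambda>i j. S i j - S0 i j)"
  have T: "T > 0" using O by (auto simp: coercive_def)
  have Z: "gauss_const p Om > 0" "gauss_const p Om0 > 0" using gauss_const_pos[OF O] gauss_const_pos[OF O0] by auto
  have eq0: "(\<lambda>i j. Om i j - 2 * ?D i j) = Om0" by (simp add: fun_eq_iff field_simps)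
  have H: "coercive p (1 / T) (\<lambda>i j. Om i j - 2 * ?D i j)" unfolding eq0 by (rule O0)
  have symD: "sym_kernel p ?D" using O O0 by (auto simp: coercive_def sym_kernel_def)
  have "kernel_sq p (\<lambda>i j. Om i j - Om0 i j) \<le> T\<^sup>2 * (T\<^sup>2 * ?e)"
    using coercive_inv_bound[OF S(2) inverse_kernel_sym[OF S(1)]] coercive_inv_bound[OF S0(2) inverse_kernel_sym[OF S0(1)]]
    by (intro inverse_difference_bound[OF inverse_kernel_sym[OF S(1)] inverse_kernel_sym[OF S0(1)]]) auto
  moreover have "kernel_sq p (\<lambda>i j. Om i j - Om0 i j) = 4 * kernel_sq p ?D"
    by (simp add: kernel_sq_def sum_distrib_left power_divide)
  ultimately have fD: "kernel_sq p ?D \<le> (T\<^sup>2 / 2)\<^sup>2 * ?e" by (simp add: power2_eq_square field_simps)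
  have sD: "sqrt (kernel_sq p ?D) \<le> T\<^sup>2 / 2 * sqrt ?e"
    using real_sqrt_le_mono[OF fD] by (simp add: real_sqrt_mult)
  have small': "4 * T * sqrt (kernel_sq p ?D) \<le> 1"
  proof -
    have "4 * T * sqrt (kernel_sq p ?D) \<le> 4 * T * (T\<^sup>2 / 2 * sqrt ?e)"
      using T sD by (intro mult_left_mono) auto
    also have "\<dots> = 2 * T ^ 3 * sqrt ?e" by (simp add: power2_eq_square power3_eq_cube)
    finally show ?thesis using small by linarith
  qed
  have "exp (kernel_inner p ?D S) \<le> gauss_const p Om0 / gauss_const p Om"
    using gauss_const_ratio_ge[OF O S(1), of _ ?D, OF H] unfolding eq0 .
  then have r: "gauss_const p Om / gauss_const p Om0 \<le> exp (- kernel_inner p ?D S)"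
    using Z by (simp add: exp_minus field_simps)
  have "(\<integral>\<^sup>+ x. ennreal (gauss_density p Om0 x / gauss_density p Om x) \<partial>gauss_law p Om0)
      = (\<integral>\<^sup>+ x. ennreal (gauss_const p Om / gauss_const p Om0) * ennreal (exp (quad_form p ?D x)) \<partial>gauss_law p Om0)"
  proof (intro nn_integral_cong)
    fix x
    have "quad_form p ?D x = (quad_form p Om x - quad_form p Om0 x) / 2"
      unfolding quad_form_def sum_subtractf[symmetric] sum_divide_distrib
      by (intro sum.cong refl) (simp add: field_simps)
    then have "exp (quad_form p ?D x) = exp (- quad_form p Om0 x / 2 - (- quad_form p Om x / 2))"
      by (simp add: diff_divide_distrib)
    then have "exp (quad_form p ?D x) = exp (- quad_form p Om0 x / 2) / exp (- quad_form p Om x / 2)"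
      by (simp only: exp_diff)
    then have "gauss_density p Om0 x / gauss_density p Om x = (gauss_const p Om / gauss_const p Om0) * exp (quad_form p ?D x)"
      by (simp add: gauss_density_def)
    then show "ennreal (gauss_density p Om0 x / gauss_density p Om x) = ennreal (gauss_const p Om / gauss_const p Om0) * ennreal (exp (quad_form p ?D x))"
      using Z by (simp add: ennreal_mult[symmetric])
  qed
  also have "\<dots> \<le> ennreal (exp (- kernel_inner p ?D S)) * ennreal (exp (kernel_inner p ?D S0 + 4 * T\<^sup>2 * kernel_sq p ?D))"
    using gauss_law_exp_quad_form_le[OF O0 S0(1) symD small'] r
    by (subst nn_integral_cmult) (auto intro!: mult_mono ennreal_leI)
  also have "\<dots> = ennreal (exp (kernel_inner p ?D (\<lambda>i j. S0 i j - S i j) + 4 * T\<^sup>2 * kernel_sq p ?D))"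
  proof -
    have "kernel_inner p ?D (\<lambda>i j. S0 i j - S i j) = kernel_inner p ?D S0 - kernel_inner p ?D S"
      by (simp only: kernel_inner_def right_diff_distrib sum_subtractf)
    then show ?thesis by (simp add: ennreal_mult[symmetric] exp_add[symmetric])
  qed
  also have "\<dots> \<le> ennreal (exp ((T\<^sup>2 / 2 + T ^ 6) * ?e))"
  proof (intro ennreal_leI, simp only: exp_le_cancel_iff)
    have "kernel_inner p ?D (\<lambda>i j. S0 i j - S i j) \<le> sqrt (kernel_sq p ?D) * sqrt (kernel_sq p (\<lambda>i j. S0 i j - S i j))"
      using kernel_inner_Cauchy abs_le_D1 by blast
    also have "kernel_sq p (\<lambda>i j. S0 i j - S i j) = ?e" by (simp add: kernel_sq_def power2_commute)
    also have "sqrt (kernel_sq p ?D) * sqrt ?e \<le> (T\<^sup>2 / 2 * sqrt ?e) * sqrt ?e"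
      by (intro mult_right_mono sD) auto
    also have "\<dots> = T\<^sup>2 / 2 * ?e" by simp
    finally have 1: "kernel_inner p ?D (\<lambda>i j. S0 i j - S i j) \<le> T\<^sup>2 / 2 * ?e" .
    have "4 * T\<^sup>2 * kernel_sq p ?D \<le> 4 * T\<^sup>2 * ((T\<^sup>2 / 2)\<^sup>2 * ?e)"
      by (intro mult_left_mono fD) auto
    also have "\<dots> = T ^ 6 * ?e" by (simp add: power2_eq_square eval_nat_numeral)
    finally show "kernel_inner p ?D (\<lambda>i j. S0 i j - S i j) + 4 * T\<^sup>2 * kernel_sq p ?D \<le> (T\<^sup>2 / 2 + T ^ 6) * ?e"
      using 1 by (simp add: algebra_simps)
  qed
  finally show ?thesis .
qed

section \<open>Spectral bounds\<close>

lemma quad_form_diff_scaled: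
  "quad_form p M (\<lambda>i. x i - s * y i) =
    quad_form p M x - s * inner_sum p x (kernel_app p M y) - s * inner_sum p y (kernel_app p M x) + s\<^sup>2 * quad_form p M y"
  unfolding quad_form_kernel_app inner_sum_def kernel_app_def
  by (simp add: algebra_simps sum_subtractf sum.distrib sum_distrib_left power2_eq_square)

text \<open>\<open>M\<close> lies between \<open>0\<close> and \<open>F\<close>, hence
  \<open>M^2 \<le> F M\<close>. Instead of a square root of \<open>M\<close>, positivity is tested
  at \<open>x - M x / F\<close>.\<close>

lemma psd_kernel_app_bound:
  assumes S: "sym_kernel p M" and psd: "\<And>x. 0 \<le> quad_form p M x" and F: "F > 0" "\<And>x. quad_form p M x \<le> F * norm_sq p x"
  shows "norm_sq p (kernel_app p M x) \<le> F * quad_form p M x"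
proof -
  let ?y = "kernel_app p M x" and ?s = "1 / F"
  have "0 \<le> quad_form p M (\<lambda>i. x i - ?s * ?y i)" by (rule psd)
  also have "\<dots> = quad_form p M x - ?s * inner_sum p x (kernel_app p M ?y) - ?s * inner_sum p ?y (kernel_app p M x) + ?s\<^sup>2 * quad_form p M ?y"
    by (rule quad_form_diff_scaled)
  also have "inner_sum p x (kernel_app p M ?y) = inner_sum p ?y (kernel_app p M x)" by (rule inner_sum_kernel_app_sym[OF S])
  also have "inner_sum p ?y (kernel_app p M x) = norm_sq p ?y" by (simp add: inner_sum_def norm_sq_def power2_eq_square)
  finally have "0 \<le> quad_form p M x - 2 * ?s * norm_sq p ?y + ?s\<^sup>2 * quad_form p M ?y" by simp
  also have "\<dots> \<le> quad_form p M x - 2 * ?s * norm_sq p ?y + ?s\<^sup>2 * (F * norm_sq p ?y)"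
    by (intro add_left_mono mult_left_mono F) auto
  also have "\<dots> = quad_form p M x - norm_sq p ?y / F" using F(1) by (simp add: power2_eq_square field_simps)
  finally show ?thesis using F(1) by (simp add: field_simps)
qed

text \<open>\<open>S \<le> T\<close> forces its inverse to be at least \<open>1 / T\<close>: apply
  \<open>psd_kernel_app_bound\<close> to \<open>u = Om v\<close>, for which
  \<open>S u = v\<close>.\<close>

lemma coercive_inverse:
  assumes S: "coercive p c S" "inverse_kernel p Om S" and T: "T > 0" "\<And>x. quad_form p S x \<le> T * norm_sq p x"
  shows "coercive p (1 / T) Om"
proof -
  have psd: "0 \<le> quad_form p S x" for x
  proof -
    have "c * norm_sq p x \<le> quad_form p S x" "0 \<le> c * norm_sq p x" using S(1) by (auto simp: coercive_def)
    then show ?thesis by linarith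
  qed
  have sym: "sym_kernel p S" "sym_kernel p Om" using S by (auto simp: coercive_def inverse_kernel_def)
  have "1 / T * norm_sq p v \<le> quad_form p Om v" for v
  proof -
    let ?u = "kernel_app p Om v"
    have e: "kernel_app p S ?u i = v i" if "i < p" for i
      using kernel_app_inv[OF inverse_kernel_sym[OF S(2)] that] .
    have "norm_sq p v = norm_sq p (kernel_app p S ?u)" by (intro norm_sq_cong) (simp add: e)
    also have "\<dots> \<le> T * quad_form p S ?u" by (rule psd_kernel_app_bound[OF sym(1) psd T])
    also have "quad_form p S ?u = inner_sum p ?u v" unfolding quad_form_kernel_app by (intro inner_sum_cong e refl)
    also have "\<dots> = quad_form p Om v" unfolding quad_form_kernel_app by (rule inner_sum_commute)
    finally show ?thesis using T(1) by (simp add: field_simps)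
  qed
  then show ?thesis using T sym by (auto simp: coercive_def)
qed

lemma quad_form_scaled: "quad_form p A (\<lambda>i. t * x i) = t\<^sup>2 * quad_form p A x"
  by (simp add: quad_form_def sum_distrib_left power2_eq_square algebra_simps)

lemma norm_sq_scaled: "norm_sq p (\<lambda>i. t * x i) = t\<^sup>2 * norm_sq p x"
  by (simp add: norm_sq_def sum_distrib_left power_mult_distrib)

lemma quad_form_norm_sq_0: "norm_sq p x = 0 \<Longrightarrow> quad_form p A x = 0"
  using quad_form_le_kernel_sq[of p A x] by simp

lemma eigenvalue_kernel_mat_iff:
  "eigenvalue (kernel_mat p A) k \<longleftrightarrow> (\<exists>x. norm_sq p x \<noteq> 0 \<and> (\<forall>i<p. kernel_app p A x i = k * x i))"
proof
  assume "eigenvalue (kernel_mat p A) k"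
  then obtain v where v: "v \<in> carrier_vec p" "v \<noteq> 0\<^sub>v p" "kernel_mat p A *\<^sub>v v = k \<cdot>\<^sub>v v"
    by (auto simp: eigenvalue_def eigenvector_def kernel_mat_def)
  have "kernel_app p A (\<lambda>i. v $ i) i = k * v $ i" if "i < p" for i
    using arg_cong[OF v(3), of "\<lambda>w. w $ i"] v(1) that
    by (simp add: kernel_mat_def kernel_app_def scalar_prod_def atLeast0LessThan)
  moreover have "norm_sq p (\<lambda>i. v $ i) \<noteq> 0"
  proof
    assume "norm_sq p (\<lambda>i. v $ i) = 0"
    then have "v = 0\<^sub>v p" using v(1) by (intro eq_vecI) (auto simp: norm_sq_def sum_nonneg_eq_0_iff)
    then show False using v(2) by simp
  qed
  ultimately show "\<exists>x. norm_sq p x \<noteq> 0 \<and> (\<forall>i<p. kernel_app p A x i = k * x i)" by blast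
next
  assume "\<exists>x. norm_sq p x \<noteq> 0 \<and> (\<forall>i<p. kernel_app p A x i = k * x i)"
  then obtain x where x: "norm_sq p x \<noteq> 0" "\<And>i. i < p \<Longrightarrow> kernel_app p A x i = k * x i" by blast
  let ?v = "vec p x"
  have "?v \<noteq> 0\<^sub>v p"
  proof
    assume e: "?v = 0\<^sub>v p"
    have "x i = 0" if "i < p" for i using arg_cong[OF e, of "\<lambda>w. w $ i"] that by simp
    then have "norm_sq p x = 0" by (simp add: norm_sq_def)
    then show False using x(1) by simp
  qed
  moreover have "kernel_mat p A *\<^sub>v ?v = k \<cdot>\<^sub>v ?v"
    using x(2) by (intro eq_vecI) (auto simp: kernel_mat_def kernel_app_def scalar_prod_def atLeast0LessThan)
  ultimately show "eigenvalue (kernel_mat p A) k"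
    by (auto simp: eigenvalue_def eigenvector_def kernel_mat_def intro!: exI[of _ ?v])
qed

text \<open>If \<open>\<mu>\<close> is the supremum of the Rayleigh quotient and \<open>\<mu> I - A\<close> were invertible, then
  \<open>\<mu> I - A\<close> would be coercive, contradicting the choice of \<open>\<mu>\<close>; this avoids compactness of the sphere.\<close>
lemma Rayleigh_eigenvalue:
  assumes S: "sym_kernel p A" and p: "p > 0"
  shows "\<exists>\<mu>. eigenvalue (kernel_mat p A) \<mu> \<and> (\<forall>x. quad_form p A x \<le> \<mu> * norm_sq p x)"
proof -
  let ?R = "{quad_form p A x | x. norm_sq p x = 1}"
  define \<mu> where "\<mu> = Sup ?R"
  have bdd: "bdd_above ?R"
  proof (rule bdd_aboveI)
    fix y assume "y \<in> ?R"
    then obtain x where "y = quad_form p A x" "norm_sq p x = 1" by blast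
    then show "y \<le> sqrt (kernel_sq p A)" using quad_form_le_kernel_sq[of p A x] by simp
  qed
  have "norm_sq p (\<lambda>i. if i = 0 then 1 else 0) = 1"
    using p by (simp add: norm_sq_def if_distrib[of "\<lambda>z. z\<^sup>2"] cong: if_cong)
  then have ne: "?R \<noteq> {}" by blast
  have le: "quad_form p A x \<le> \<mu> * norm_sq p x" for x
  proof (cases "norm_sq p x = 0")
    case True
    then show ?thesis by (simp add: quad_form_norm_sq_0)
  next
    case False
    then have n: "norm_sq p x > 0" using norm_sq_nonneg[of p x] by linarith
    have "norm_sq p (\<lambda>i. 1 / sqrt (norm_sq p x) * x i) = 1" using n by (simp only: norm_sq_scaled) (simp add: power_divide)
    then have "quad_form p A (\<lambda>i. 1 / sqrt (norm_sq p x) * x i) \<le> \<mu>"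
      unfolding \<mu>_def by (intro cSup_upper bdd) blast
    then show ?thesis unfolding quad_form_scaled using n by (simp add: power_divide field_simps)
  qed
  define M where "M i j = (if i = j then \<mu> else 0) - A i j" for i j
  have MS: "sym_kernel p M" using S by (auto simp: sym_kernel_def M_def)
  have kM: "kernel_app p M x i = \<mu> * x i - kernel_app p A x i" if "i < p" for x i
    using that by (simp add: kernel_app_def M_def algebra_simps sum_subtractf if_distrib[of "\<lambda>z. _ * z"] cong: if_cong)
  have qM: "quad_form p M x = \<mu> * norm_sq p x - quad_form p A x" for x
  proof -
    have "quad_form p M x = (\<Sum>i<p. x i * (\<mu> * x i - kernel_app p A x i))"
      unfolding quad_form_kernel_app inner_sum_def by (intro sum.cong refl) (simp add: kM)
    then show ?thesis
      by (simp add: quad_form_kernel_app inner_sum_def norm_sq_def algebra_simps sum_subtractf sum_distrib_left power2_eq_square)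
  qed
  have psd: "0 \<le> quad_form p M x" for x using le[of x] by (simp add: qM)
  have "Determinant.det (kernel_mat p M) = 0"
  proof (rule ccontr)
    assume d: "Determinant.det (kernel_mat p M) \<noteq> 0"
    obtain N where N: "inverse_kernel p M N" using inverse_kernel_adj_mat[OF MS d] by blast
    define F where "F = sqrt (kernel_sq p M) + 1"
    have F: "F > 0" by (simp add: F_def add_nonneg_pos)
    have FM: "quad_form p M x \<le> F * norm_sq p x" for x
    proof -
      have "quad_form p M x \<le> sqrt (kernel_sq p M) * norm_sq p x" using quad_form_le_kernel_sq[of p M x] by linarith
      also have "\<dots> \<le> F * norm_sq p x" by (intro mult_right_mono) (auto simp: F_def)
      finally show ?thesis .
    qed
    define K where "K = kernel_sq p N * F"
    have K: "K \<ge> 0" using F by (simp add: K_def)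
    \<comment> \<open>Invertibility made quantitative: \<open>x = N (M x)\<close>, and
      \<open>psd_kernel_app_bound\<close> replaces \<open>|M x|^2\<close> by the form of
      \<open>M\<close>. This leaves a gap between \<open>\<mu>\<close> and the Rayleigh
      quotients.\<close>
    have nK: "norm_sq p x \<le> K * quad_form p M x" for x
    proof -
      have "norm_sq p x = norm_sq p (kernel_app p N (kernel_app p M x))"
        by (intro norm_sq_cong) (simp add: kernel_app_inv[OF inverse_kernel_sym[OF N]])
      also have "\<dots> \<le> kernel_sq p N * norm_sq p (kernel_app p M x)" by (rule norm_sq_kernel_app_le)
      also have "\<dots> \<le> kernel_sq p N * (F * quad_form p M x)"
        by (intro mult_left_mono psd_kernel_app_bound[OF MS psd F FM]) auto
      finally show ?thesis by (simp add: K_def mult.assoc)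
    qed
    have "\<mu> - 1 / (K + 1) < Sup ?R" unfolding \<mu>_def[symmetric] using K by simp
    then obtain x where x: "norm_sq p x = 1" "\<mu> - 1 / (K + 1) < quad_form p A x"
      using less_cSup_iff[OF ne bdd] by auto
    have "1 \<le> K * quad_form p M x" using nK[of x] x(1) by simp
    also have "\<dots> \<le> K * (1 / (K + 1))" using x K by (intro mult_left_mono) (auto simp: qM)
    also have "\<dots> < 1" using K by simp
    finally show False by simp
  qed
  then have "eigenvalue (kernel_mat p M) 0"
  proof -
    have "char_matrix (kernel_mat p M) 0 = kernel_mat p M"
      by (rule eq_matI) (auto simp: char_matrix_def kernel_mat_def)
    moreover assume "Determinant.det (kernel_mat p M) = 0"
    ultimately show ?thesis
      using eigenvalue_det[of "kernel_mat p M" p 0] by (simp add: kernel_mat_def)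
  qed
  then have "eigenvalue (kernel_mat p A) \<mu>"
    unfolding eigenvalue_kernel_mat_iff by (auto simp: kM)
  then show ?thesis using le by blast
qed

lemma finite_eigenvalues: "finite {k. eigenvalue (kernel_mat p A) (k::real)}" if "p > 0"
proof -
  have c: "kernel_mat p A \<in> carrier_mat p p" by (simp add: kernel_mat_def)
  have "char_poly (kernel_mat p A) \<noteq> 0" using degree_monic_char_poly[OF c] that by auto
  then have "finite {k. poly (char_poly (kernel_mat p A)) k = 0}" by (rule poly_roots_finite)
  then show ?thesis using eigenvalue_root_char_poly[OF c] by simp
qed

lemma quad_form_eigenvector:
  assumes "\<And>i. i < p \<Longrightarrow> kernel_app p A x i = k * x i"
  shows "quad_form p A x = k * norm_sq p x"
  unfolding quad_form_kernel_app inner_sum_def norm_sq_def sum_distrib_left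
  by (intro sum.cong refl) (simp add: assms power2_eq_square)

text \<open>The constraint set without eigenvalues: closed inequalities for every \<open>x\<close>,
  easy to perturb, to relax, and to check on countably many vectors.\<close>

definition spectral_bounds :: "nat \<Rightarrow> real \<Rightarrow> (nat \<Rightarrow> nat \<Rightarrow> real) \<Rightarrow> bool" where
  "spectral_bounds p \<tau> A \<longleftrightarrow> sym_kernel p A \<and> (\<forall>x. norm_sq p x / \<tau> \<le> quad_form p A x \<and> quad_form p A x \<le> \<tau> * norm_sq p x)"

lemma pos_def_kernel_mat_iff:
  "pos_def p (kernel_mat p A) \<longleftrightarrow> sym_kernel p A \<and> (\<forall>x. norm_sq p x \<noteq> 0 \<longrightarrow> quad_form p A x > 0)"
proof -
  have 1: "(kernel_mat p A)\<^sup>T = kernel_mat p A \<longleftrightarrow> sym_kernel p A"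
    by (auto simp: mat_eq_iff kernel_mat_def sym_kernel_def)
  have q: "(v :: real Matrix.vec) \<bullet> (kernel_mat p A *\<^sub>v v) = quad_form p A (\<lambda>i. v $ i)" if "v \<in> carrier_vec p" for v
    using that by (auto simp: scalar_prod_def kernel_mat_def quad_form_def sum_distrib_left atLeast0LessThan mult.assoc intro!: sum.cong)
  have z: "v = 0\<^sub>v p \<longleftrightarrow> norm_sq p (\<lambda>i. v $ i) = 0" if "v \<in> carrier_vec p" for v
    using that by (auto simp: norm_sq_def sum_nonneg_eq_0_iff intro!: eq_vecI)
  have 2: "(\<forall>v\<in>carrier_vec p. v \<noteq> 0\<^sub>v p \<longrightarrow> v \<bullet> (kernel_mat p A *\<^sub>v v) > 0) \<longleftrightarrow> (\<forall>x. norm_sq p x \<noteq> 0 \<longrightarrow> quad_form p A x > 0)"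
  proof (intro iffI ballI allI impI)
    fix x assume a: "\<forall>v\<in>carrier_vec p. v \<noteq> 0\<^sub>v p \<longrightarrow> v \<bullet> (kernel_mat p A *\<^sub>v v) > 0" and x: "norm_sq p x \<noteq> 0"
    have "norm_sq p (\<lambda>i. vec p x $ i) = norm_sq p x" "quad_form p A (\<lambda>i. vec p x $ i) = quad_form p A x"
      by (auto intro: norm_sq_cong quad_form_cong)
    then show "quad_form p A x > 0"
      using a[rule_format, of "vec p x"] x q[of "vec p x"] z[of "vec p x"] by simp
  next
    fix v :: "real Matrix.vec" assume "\<forall>x. norm_sq p x \<noteq> 0 \<longrightarrow> quad_form p A x > 0" "v \<in> carrier_vec p" "v \<noteq> 0\<^sub>v p"
    then show "0 < v \<bullet> (kernel_mat p A *\<^sub>v v)" using q z by simp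
  qed
  show ?thesis unfolding pos_def_def 1 2 by (simp add: kernel_mat_def)
qed

text \<open>\<open>lam_min\<close> and \<open>lam_max\<close> are a \<open>Min\<close> and a
  \<open>Max\<close> over the eigenvalues, so finiteness and existence come first: one from the
  characteristic polynomial, the other from the Rayleigh argument, both using
  \<open>p > 0\<close>.\<close>

proposition U_set_kernel_mat_iff:
  assumes p: "p > 0" and t: "\<tau> > 0"
  shows "kernel_mat p A \<in> U_set p \<tau> \<longleftrightarrow> spectral_bounds p \<tau> A"
proof
  let ?E = "{k. eigenvalue (kernel_mat p A) k}"
  note fin = finite_eigenvalues[OF p, of A]
  {
    assume U: "kernel_mat p A \<in> U_set p \<tau>"
    then have S: "sym_kernel p A" by (auto simp: U_set_def pos_def_kernel_mat_iff)
    obtain \<mu> where \<mu>: "eigenvalue (kernel_mat p A) \<mu>" "\<And>x. quad_form p A x \<le> \<mu> * norm_sq p x"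
      using Rayleigh_eigenvalue[OF S p] by blast
    \<comment> \<open>The lower spectral edge of \<open>A\<close> is the negated upper edge of
      \<open>- A\<close>.\<close>
    have "sym_kernel p (\<lambda>i j. - A i j)" using S by (auto simp: sym_kernel_def)
    then obtain \<nu> where \<nu>: "eigenvalue (kernel_mat p (\<lambda>i j. - A i j)) \<nu>" "\<And>x. quad_form p (\<lambda>i j. - A i j) x \<le> \<nu> * norm_sq p x"
      using Rayleigh_eigenvalue[OF _ p] by blast
    have neg: "quad_form p (\<lambda>i j. - A i j) x = - quad_form p A x" "kernel_app p (\<lambda>i j. - A i j) x i = - kernel_app p A x i" for x i
      by (simp_all add: quad_form_def kernel_app_def sum_negf)
    have \<nu>': "eigenvalue (kernel_mat p A) (- \<nu>)" using \<nu>(1) unfolding eigenvalue_kernel_mat_iff neg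
      by (metis minus_mult_left neg_equal_iff_equal minus_minus)
    have "\<mu> \<le> lam_max (kernel_mat p A)" "lam_min (kernel_mat p A) \<le> - \<nu>"
      unfolding lam_max_def lam_min_def using \<mu>(1) \<nu>' fin by (auto intro: Max_ge Min_le)
    then have b: "\<mu> \<le> \<tau>" "1 / \<tau> \<le> - \<nu>" using U by (auto simp: U_set_def)
    have "norm_sq p x / \<tau> \<le> quad_form p A x" "quad_form p A x \<le> \<tau> * norm_sq p x" for x
    proof -
      have "norm_sq p x / \<tau> \<le> (- \<nu>) * norm_sq p x" using mult_right_mono[OF b(2) norm_sq_nonneg[of p x]] by simp
      also have "\<dots> \<le> quad_form p A x" using \<nu>(2)[of x] unfolding neg by simp
      finally show "norm_sq p x / \<tau> \<le> quad_form p A x" .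
      show "quad_form p A x \<le> \<tau> * norm_sq p x"
        using \<mu>(2)[of x] mult_right_mono[OF b(1) norm_sq_nonneg[of p x]] by linarith
    qed
    then show "spectral_bounds p \<tau> A" using S by (auto simp: spectral_bounds_def)
  next
    assume B: "spectral_bounds p \<tau> A"
    then have S: "sym_kernel p A" by (auto simp: spectral_bounds_def)
    have pd: "pos_def p (kernel_mat p A)"
      unfolding pos_def_kernel_mat_iff
    proof (intro conjI S allI impI)
      fix x assume "norm_sq p x \<noteq> 0"
      then have "0 < norm_sq p x / \<tau>" using norm_sq_nonneg[of p x] t by (simp add: less_le)
      also have "\<dots> \<le> quad_form p A x" using B by (auto simp: spectral_bounds_def)
      finally show "quad_form p A x > 0" .
    qed
    have evidence: "1 / \<tau> \<le> k \<and> k \<le> \<tau>" if "k \<in> ?E" for k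
    proof -
      obtain x where x: "norm_sq p x \<noteq> 0" "\<And>i. i < p \<Longrightarrow> kernel_app p A x i = k * x i"
        using \<open>k \<in> ?E\<close> by (auto simp: eigenvalue_kernel_mat_iff)
      have n: "norm_sq p x > 0" using x(1) norm_sq_nonneg[of p x] by linarith
      have "norm_sq p x / \<tau> \<le> k * norm_sq p x" "k * norm_sq p x \<le> \<tau> * norm_sq p x"
        using B quad_form_eigenvector[of p A x k, OF x(2)] unfolding spectral_bounds_def by metis+
      then have "(1 / \<tau>) * norm_sq p x \<le> k * norm_sq p x" "k * norm_sq p x \<le> \<tau> * norm_sq p x" by simp_all
      then show ?thesis using n by (simp only: mult_le_cancel_right_pos)
    qed
    have ne: "?E \<noteq> {}" using Rayleigh_eigenvalue[OF S p] by blast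
    have "lam_min (kernel_mat p A) \<in> ?E" "lam_max (kernel_mat p A) \<in> ?E"
      unfolding lam_min_def lam_max_def using Min_in[OF fin ne] Max_in[OF fin ne] by blast+
    moreover have "lam_min (kernel_mat p A) \<le> lam_max (kernel_mat p A)"
      unfolding lam_min_def lam_max_def by (rule Min_le[OF fin Max_in[OF fin ne]])
    ultimately show "kernel_mat p A \<in> U_set p \<tau>" using pd evidence by (auto simp: U_set_def)
  }
qed

section \<open>Precision matrices and the identification with \<open>mvn\<close>\<close>

definition precision :: "nat \<Rightarrow> (nat \<Rightarrow> nat \<Rightarrow> real) \<Rightarrow> nat \<Rightarrow> nat \<Rightarrow> real" where
  "precision p S i j = adj_mat (kernel_mat p S) $$ (i,j) / Determinant.det (kernel_mat p S)"

lemma kernel_mat_index: "A \<in> carrier_mat p p \<Longrightarrow> kernel_mat p (\<lambda>i j. A $$ (i,j)) = A"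
  by (rule eq_matI) (auto simp: kernel_mat_def)

lemma kernel_mat_inv:
  assumes "inverse_kernel p H W"
  shows "kernel_mat p H * kernel_mat p W = 1\<^sub>m p"
  using assms by (intro eq_matI) (auto simp: kernel_mat_def scalar_prod_def atLeast0LessThan inverse_kernel_def)

lemma coercive_precision:
  assumes "coercive p c S"
  shows "inverse_kernel p S (precision p S)"
  unfolding precision_def[abs_def]
  using gauss_integral[OF assms, of "\<lambda>_. 0"] assms by (intro inverse_kernel_adj_mat) (auto simp: coercive_def)

text \<open>\<open>mat_inverse\<close> is computed by Gauss-Jordan elimination; uniqueness of
  inverses identifies its result with the adjugate formula.\<close>

lemma mat_inv_kernel_mat:
  assumes S: "coercive p c S" and ij: "i < p" "j < p"
  shows "mat_inv (kernel_mat p S) $$ (i,j) = precision p S i j"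
proof -
  have C: "kernel_mat p S \<in> carrier_mat p p" by (simp add: kernel_mat_def)
  have d: "Determinant.det (kernel_mat p S) \<noteq> 0"
    using gauss_integral[OF S, of "\<lambda>_. 0"] by auto
  obtain B where B: "mat_inverse (kernel_mat p S) = Some B"
    using mat_inverse(1)[OF C, of "()"] det_non_zero_imp_unit[OF C d, of "()"]
    by (cases "mat_inverse (kernel_mat p S)") auto
  from mat_inverse(2)[OF C B] have B': "B * kernel_mat p S = 1\<^sub>m p" "B \<in> carrier_mat p p" by auto
  have P: "kernel_mat p (precision p S) \<in> carrier_mat p p" by (simp add: kernel_mat_def)
  have "B = B * (kernel_mat p S * kernel_mat p (precision p S))"
    using kernel_mat_inv[OF coercive_precision[OF S]] B' by simp
  also have "\<dots> = kernel_mat p (precision p S)"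
    using B' C P by (simp add: assoc_mult_mat[symmetric, of B p p _ p _ p])
  finally show ?thesis using B ij by (simp add: mat_inv_def kernel_mat_def)
qed

text \<open>Passage from the covariance to the precision parametrisation: the two determinants are
  reciprocal, so \<open>sqrt ((2 * pi) ^ p * det S)\<close> is the \<open>gauss_const\<close> of the
  precision.\<close>

proposition mvn_density_eq:
  assumes S: "coercive p c S"
  shows "mvn_density p (kernel_mat p S) = gauss_density p (precision p S)"
proof -
  have C: "kernel_mat p S \<in> carrier_mat p p" "kernel_mat p (precision p S) \<in> carrier_mat p p" by (simp_all add: kernel_mat_def)
  have "Determinant.det (kernel_mat p S) * Determinant.det (kernel_mat p (precision p S)) = 1"
    using det_mult[OF C] kernel_mat_inv[OF coercive_precision[OF S]] by simp
  then have "gauss_const p (precision p S) = sqrt ((2 * pi) ^ p * Determinant.det (kernel_mat p S))"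
    unfolding gauss_const_def by (metis divide_inverse inverse_unique mult.commute)
  moreover have "(\<Sum>i<p. \<Sum>j<p. y i * mat_inv (kernel_mat p S) $$ (i,j) * y j) = quad_form p (precision p S) y" for y
    unfolding quad_form_def by (intro sum.cong refl) (simp add: mat_inv_kernel_mat[OF S])
  ultimately show ?thesis by (simp add: fun_eq_iff mvn_density_def gauss_density_def)
qed

lemma mvn_eq_gauss_law: "coercive p c S \<Longrightarrow> mvn p (kernel_mat p S) = gauss_law p (precision p S)"
  by (simp add: mvn_def gauss_law_def mvn_density_eq)

lemma spectral_bounds_mono:
  assumes "spectral_bounds p \<tau> S" "0 < \<tau>" "\<tau> \<le> T"
  shows "spectral_bounds p T S"
proof -
  have "norm_sq p x / T \<le> quad_form p S x \<and> quad_form p S x \<le> T * norm_sq p x" for x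
  proof -
    have "norm_sq p x / T \<le> norm_sq p x / \<tau>" using assms by (intro divide_left_mono) auto
    moreover have "\<tau> * norm_sq p x \<le> T * norm_sq p x" using assms by (intro mult_right_mono) auto
    moreover have "norm_sq p x / \<tau> \<le> quad_form p S x \<and> quad_form p S x \<le> \<tau> * norm_sq p x" using assms(1) by (auto simp: spectral_bounds_def)
    ultimately show ?thesis by linarith
  qed
  then show ?thesis using assms(1) by (auto simp: spectral_bounds_def)
qed

lemma spectral_bounds_coercive: "spectral_bounds p T S \<Longrightarrow> T > 0 \<Longrightarrow> coercive p (1 / T) S"
  by (auto simp: spectral_bounds_def coercive_def)

lemma spectral_bounds_precision:
  assumes "spectral_bounds p T S" "T > 0"
  shows "coercive p (1 / T) (precision p S)" "inverse_kernel p (precision p S) S"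
proof -
  note S = spectral_bounds_coercive[OF assms]
  show I: "inverse_kernel p (precision p S) S" by (rule inverse_kernel_sym[OF coercive_precision[OF S]])
  show "coercive p (1 / T) (precision p S)"
    using assms by (intro coercive_inverse[OF S I]) (auto simp: spectral_bounds_def)
qed

section \<open>Measurability in the free coordinates\<close>

definition entry_kernel :: "(nat \<times> nat \<Rightarrow> real) \<Rightarrow> nat \<Rightarrow> nat \<Rightarrow> real" where
  "entry_kernel s i j = (if i \<le> j then s (i,j) else s (j,i))"

lemma symm_of_kernel_mat: "symm_of p s = kernel_mat p (entry_kernel s)"
  by (auto simp: symm_of_def kernel_mat_def entry_kernel_def)

lemma sym_kernel_entry_kernel [simp]: "sym_kernel p (entry_kernel s)"
  by (auto simp: sym_kernel_def entry_kernel_def)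

abbreviation entry_space :: "nat \<Rightarrow> (nat \<times> nat \<Rightarrow> real) measure" where
  "entry_space p \<equiv> PiM (tri p) (\<lambda>_. borel)"

lemma entry_kernel_measurable [measurable]:
  assumes "i < p" "j < p"
  shows "(\<lambda>s. entry_kernel s i j) \<in> borel_measurable (entry_space p)"
proof (cases "i \<le> j")
  case True
  then have "(i,j) \<in> tri p" using assms by (auto simp: tri_def)
  from measurable_component_singleton[OF this, of "\<lambda>_. borel"]
  show ?thesis using True by (simp add: entry_kernel_def)
next
  case False
  then have "(j,i) \<in> tri p" using assms by (auto simp: tri_def)
  from measurable_component_singleton[OF this, of "\<lambda>_. borel"]
  show ?thesis using False by (simp add: entry_kernel_def)
qed

lemma quad_form_entry_kernel_measurable: "(\<lambda>s. quad_form p (entry_kernel s) x) \<in> borel_measurable (entry_space p)"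
  unfolding quad_form_def by (intro borel_measurable_sum borel_measurable_times borel_measurable_const entry_kernel_measurable) auto

text \<open>The approximating vectors are extensional, so that they range over a countable
  set.\<close>

lemma rat_approx:
  "\<exists>y :: nat \<Rightarrow> nat \<Rightarrow> real. (\<forall>k. y k \<in> {..<p} \<rightarrow>\<^sub>E \<rat>) \<and> (\<forall>i<p. (\<lambda>k. y k i) \<longlonglongrightarrow> x i)"
proof -
  have "\<exists>f :: nat \<Rightarrow> real. (\<forall>k. f k \<in> \<rat>) \<and> f \<longlonglongrightarrow> a" for a :: real
  proof -
    have "\<exists>r\<in>\<rat>. a - 1 / real (Suc k) < r \<and> r < a" for k by (intro Rats_dense_in_real) simp
    then obtain f where f: "\<And>k. f k \<in> \<rat>" "\<And>k. a - 1 / real (Suc k) < f k" "\<And>k. f k < a" by metis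
    have "f \<longlonglongrightarrow> a"
    proof (rule tendsto_sandwich)
      show "(\<lambda>k. a - 1 / real (Suc k)) \<longlonglongrightarrow> a" by real_asymp
      show "(\<lambda>_. a) \<longlonglongrightarrow> a" by simp
    qed (use f in \<open>auto intro!: always_eventually less_imp_le\<close>)
    then show ?thesis using f(1) by blast
  qed
  then obtain f :: "real \<Rightarrow> nat \<Rightarrow> real" where f: "\<And>a k. f a k \<in> \<rat>" "\<And>a. f a \<longlonglongrightarrow> a" by metis
  show ?thesis
    by (intro exI[of _ "\<lambda>k. \<lambda>i\<in>{..<p}. f (x i) k"]) (auto simp: f)
qed

text \<open>Both inequalities are closed conditions on \<open>x\<close>, so rational vectors
  suffice. A countable intersection results, hence the measurability below.\<close>

lemma spectral_bounds_iff_rat: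
  "spectral_bounds p \<tau> S \<longleftrightarrow> sym_kernel p S \<and>
    (\<forall>x\<in>{..<p} \<rightarrow>\<^sub>E \<rat>. norm_sq p x / \<tau> \<le> quad_form p S x \<and> quad_form p S x \<le> \<tau> * norm_sq p x)"
proof (intro iffI conjI)
  assume a: "sym_kernel p S \<and> (\<forall>x\<in>{..<p} \<rightarrow>\<^sub>E \<rat>. norm_sq p x / \<tau> \<le> quad_form p S x \<and> quad_form p S x \<le> \<tau> * norm_sq p x)"
  have "norm_sq p x / \<tau> \<le> quad_form p S x \<and> quad_form p S x \<le> \<tau> * norm_sq p x" for x
  proof -
    obtain y where y: "\<And>k. y k \<in> {..<p} \<rightarrow>\<^sub>E \<rat>" "\<And>i. i < p \<Longrightarrow> (\<lambda>k. y k i) \<longlonglongrightarrow> x i"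
      using rat_approx[of p x] by blast
    have q: "(\<lambda>k. quad_form p S (y k)) \<longlonglongrightarrow> quad_form p S x" unfolding quad_form_def
      by (intro tendsto_sum tendsto_mult tendsto_const y) auto
    have n: "(\<lambda>k. norm_sq p (y k)) \<longlonglongrightarrow> norm_sq p x" unfolding norm_sq_def
      by (intro tendsto_sum tendsto_power y) auto
    have l: "(\<lambda>k. norm_sq p (y k) / \<tau>) \<longlonglongrightarrow> norm_sq p x / \<tau>" "(\<lambda>k. \<tau> * norm_sq p (y k)) \<longlonglongrightarrow> \<tau> * norm_sq p x"
      unfolding divide_inverse by (intro tendsto_intros n)+
    have le: "norm_sq p (y k) / \<tau> \<le> quad_form p S (y k)" "quad_form p S (y k) \<le> \<tau> * norm_sq p (y k)" for k
      using a y(1)[of k] by auto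
    show ?thesis
      using LIMSEQ_le[OF l(1) q] LIMSEQ_le[OF q l(2)] le by auto
  qed
  then show "spectral_bounds p \<tau> S" using a by (auto simp: spectral_bounds_def)
qed (auto simp: spectral_bounds_def)

lemma countable_rat_vec: "countable ({..<p::nat} \<rightarrow>\<^sub>E (\<rat> :: real set))"
  by (intro countable_PiE) (auto simp: countable_rat)

lemma spectral_bounds_measurable [measurable]: "Measurable.pred (entry_space p) (\<lambda>s. spectral_bounds p \<tau> (entry_kernel s))"
proof -
  have *: "Measurable.pred (entry_space p) (\<lambda>s. norm_sq p x / \<tau> \<le> quad_form p (entry_kernel s) x \<and> quad_form p (entry_kernel s) x \<le> \<tau> * norm_sq p x)" for x
    using quad_form_entry_kernel_measurable[of p x, measurable] by measurable
  then show ?thesis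
  proof -
    let ?X = "{..<p} \<rightarrow>\<^sub>E (\<rat> :: real set)"
    have ne: "?X \<noteq> {}" by (auto simp: PiE_eq_empty_iff)
    have "spectral_bounds p \<tau> (entry_kernel s) \<longleftrightarrow> (\<forall>k. norm_sq p (from_nat_into ?X k) / \<tau> \<le> quad_form p (entry_kernel s) (from_nat_into ?X k) \<and>
        quad_form p (entry_kernel s) (from_nat_into ?X k) \<le> \<tau> * norm_sq p (from_nat_into ?X k))" for s
      unfolding spectral_bounds_iff_rat
      by (subst range_from_nat_into[OF ne countable_rat_vec, symmetric]) auto
    then show ?thesis using * by simp
  qed
qed

text \<open>Leibniz formula: the determinant is a polynomial in the entries. Cofactors, and with
  them \<open>precision\<close>, follow.\<close>

lemma det_measurable:
  assumes "\<And>i j. i < q \<Longrightarrow> j < q \<Longrightarrow> (\<lambda>s. A s i j) \<in> borel_measurable M"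
  shows "(\<lambda>s. Determinant.det (mat q q (\<lambda>(i,j). A s i j)) :: real) \<in> borel_measurable M"
proof -
  have "Determinant.det (mat q q (\<lambda>(i,j). A s i j)) =
      (\<Sum>\<pi>\<in>{\<pi>. \<pi> permutes {0..<q}}. signof \<pi> * (\<Prod>i = 0..<q. A s i (\<pi> i)))" for s
  proof -
    have "(\<Prod>i = 0..<q. mat q q (\<lambda>(i,j). A s i j) $$ (i, \<pi> i)) = (\<Prod>i = 0..<q. A s i (\<pi> i))"
      if "\<pi> permutes {0..<q}" for \<pi>
      using permutes_in_image[OF that] by (intro prod.cong refl) simp
    then show ?thesis unfolding Determinant.det_def by simp
  qed
  moreover have "(\<lambda>s. \<Sum>\<pi>\<in>{\<pi>. \<pi> permutes {0..<q}}. signof \<pi> * (\<Prod>i = 0..<q. A s i (\<pi> i))) \<in> borel_measurable M"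
  proof (intro borel_measurable_sum borel_measurable_times borel_measurable_const borel_measurable_prod assms)
    fix \<pi> i assume "\<pi> \<in> {\<pi>. \<pi> permutes {0..<q}}" "i \<in> {0..<q}"
    then show "i < q" "\<pi> i < q" using permutes_in_image[of \<pi> "{0..<q}" i] by auto
  qed
  ultimately show ?thesis by simp
qed

lemma det_entry_kernel_measurable [measurable]: "(\<lambda>s. Determinant.det (kernel_mat p (entry_kernel s))) \<in> borel_measurable (entry_space p)"
  unfolding kernel_mat_def by (rule det_measurable) (rule entry_kernel_measurable)

lemma precision_measurable:
  assumes "i < p" "j < p"
  shows "(\<lambda>s. precision p (entry_kernel s) i j) \<in> borel_measurable (entry_space p)"
proof -
  have "adj_mat (kernel_mat p (entry_kernel s)) $$ (i,j) =
     (-1) ^ (j + i) * Determinant.det (mat (p - 1) (p - 1) (\<lambda>(a,b). entry_kernel s (if a < j then a else Suc a) (if b < i then b else Suc b)))" for s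
  proof -
    have "mat_delete (kernel_mat p (entry_kernel s)) j i =
        mat (p - 1) (p - 1) (\<lambda>(a,b). entry_kernel s (if a < j then a else Suc a) (if b < i then b else Suc b))"
      using assms by (intro eq_matI) (auto simp: mat_delete_def kernel_mat_def)
    moreover have "adj_mat (kernel_mat p (entry_kernel s)) $$ (i,j) = (-1) ^ (j + i) * Determinant.det (mat_delete (kernel_mat p (entry_kernel s)) j i)"
    proof -
      have "dim_row (kernel_mat p (entry_kernel s)) = p" "dim_col (kernel_mat p (entry_kernel s)) = p" by (simp_all add: kernel_mat_def)
      then show ?thesis using assms by (simp add: adj_mat_def cofactor_def)
    qed
    ultimately show ?thesis by (simp only:)
  qed
  moreover have "(\<lambda>s. Determinant.det (mat (p - 1) (p - 1) (\<lambda>(a,b). entry_kernel s (if a < j then a else Suc a) (if b < i then b else Suc b)))) \<in> borel_measurable (entry_space p)"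
    by (rule det_measurable, rule entry_kernel_measurable) (use assms in auto)
  ultimately show ?thesis unfolding precision_def
    by (simp only:) (intro borel_measurable_divide borel_measurable_times borel_measurable_const det_entry_kernel_measurable)
qed

text \<open>Joint measurability in parameter and observation, required to exchange the prior
  integral with the sampling integral.\<close>

lemma gauss_density_precision_measurable:
  "(\<lambda>z. gauss_density p (precision p (entry_kernel (fst z))) (snd z)) \<in> borel_measurable (entry_space p \<Otimes>\<^sub>M leb p)"
proof -
  have "(\<lambda>z. precision p (entry_kernel (fst z)) i j) \<in> borel_measurable (entry_space p \<Otimes>\<^sub>M leb p)" if "i < p" "j < p" for i j
    by (rule measurable_compose[OF measurable_fst precision_measurable[OF that]])
  moreover have "(\<lambda>z. snd z i) \<in> borel_measurable (entry_space p \<Otimes>\<^sub>M leb p)" if "i < p" for i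
  proof -
    have "(\<lambda>y. y i) \<in> borel_measurable (leb p)" using that by simp
    from measurable_compose[OF measurable_snd this] show ?thesis .
  qed
  ultimately have "(\<lambda>z. quad_form p (precision p (entry_kernel (fst z))) (snd z)) \<in> borel_measurable (entry_space p \<Otimes>\<^sub>M leb p)"
    unfolding quad_form_def by (intro borel_measurable_sum borel_measurable_times) auto
  moreover have "(\<lambda>z. gauss_const p (precision p (entry_kernel (fst z)))) \<in> borel_measurable (entry_space p \<Otimes>\<^sub>M leb p)"
  proof (rule measurable_compose[OF measurable_fst])
    have "(\<lambda>s. Determinant.det (kernel_mat p (precision p (entry_kernel s)))) \<in> borel_measurable (entry_space p)"
      unfolding kernel_mat_def[of p "precision p _"] by (rule det_measurable) (rule precision_measurable)
    then show "(\<lambda>s. gauss_const p (precision p (entry_kernel s))) \<in> borel_measurable (entry_space p)"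
      unfolding gauss_const_def by measurable
  qed
  ultimately show ?thesis unfolding gauss_density_def by measurable
qed

section \<open>The prior\<close>

definition density_const :: real where "density_const = 1 / (sqrt (2 * pi) * Beta (1/2) (1/2))"

lemma Beta_half_pos: "Beta (1/2) (1/2::real) > 0"
  by (simp add: Beta_def Gamma_real_pos)

lemma density_const_pos: "density_const > 0"
  using Beta_half_pos by (simp add: density_const_def)

definition mixture_integrand :: "real \<Rightarrow> real \<Rightarrow> real \<Rightarrow> real" where
  "mixture_integrand t x \<rho> = normal_density 0 (sqrt (\<rho>/(1-\<rho>)) * t) x * beta_density (1/2) (1/2) \<rho>"

lemma mixture_integrand_nonneg: "mixture_integrand t x \<rho> \<ge> 0"
  using Beta_half_pos by (simp add: mixture_integrand_def beta_density_def)

text \<open>For \<open>a = b = 1/2\<close> the factors \<open>sqrt (1 - \<rho>)\<close> of the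
  normal and the Beta density cancel, and the factors \<open>sqrt \<rho>\<close> multiply to
  \<open>\<rho>\<close> in the denominator. The result is close to the exact derivative of
  \<open>exp_ratio_deriv\<close>.\<close>

lemma mixture_integrand_eq:
  assumes \<rho>: "0 < \<rho>" "\<rho> < 1" and t: "t > 0"
  shows "mixture_integrand t x \<rho> = density_const / t * (1 / \<rho> * exp (- (x\<^sup>2 / (2 * t\<^sup>2)) * ((1 - \<rho>) / \<rho>)))"
proof -
  let ?s = "sqrt (\<rho>/(1-\<rho>)) * t"
  have s2: "?s\<^sup>2 = \<rho> / (1 - \<rho>) * t\<^sup>2" using \<rho> by (simp add: power_mult_distrib)
  have e: "(x - 0)\<^sup>2 / (2 * ?s\<^sup>2) = x\<^sup>2 / (2 * t\<^sup>2) * ((1 - \<rho>) / \<rho>)"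
    unfolding s2 by simp
  have r: "sqrt (2 * pi * ?s\<^sup>2) = sqrt (2 * pi) * (sqrt \<rho> / sqrt (1 - \<rho>) * t)"
    unfolding s2 using \<rho> t by (simp add: real_sqrt_mult real_sqrt_divide)
  have p: "\<rho> powr (- (1/2)) = 1 / sqrt \<rho>" "(1 - \<rho>) powr (- (1/2)) = 1 / sqrt (1 - \<rho>)"
    using \<rho> by (simp_all only: powr_minus_divide powr_half_sqrt less_imp_le diff_ge_0_iff_ge)
  have h: "1/2 - 1 = - (1/2 :: real)" by simp
  have n: "normal_density 0 ?s x =
      exp (- (x\<^sup>2 / (2 * t\<^sup>2)) * ((1 - \<rho>) / \<rho>)) / (sqrt (2 * pi) * (sqrt \<rho> / sqrt (1 - \<rho>) * t))"
    unfolding normal_density_def minus_divide_left[symmetric] r e by simp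
  have b: "beta_density (1/2) (1/2) \<rho> = 1 / sqrt \<rho> * (1 / sqrt (1 - \<rho>)) / Beta (1/2) (1/2)"
    using \<rho> unfolding beta_density_def h p by simp
  have sq: "sqrt \<rho> * sqrt \<rho> = \<rho>" using \<rho> by simp
  have alg: "E / (s * (a / b * t)) * (1 / a * (1 / b) / B) = 1 / (s * B) / t * (1 / (a * a) * E)"
    if "a \<noteq> 0" "b \<noteq> 0" for E s a b B :: real
    using that by simp
  have "sqrt (1 - \<rho>) \<noteq> 0" "sqrt \<rho> \<noteq> 0" using \<rho> by auto
  from alg[OF this(2,1)] show ?thesis
    unfolding mixture_integrand_def n b density_const_def sq by this
qed

lemma exp_ratio_deriv:
  fixes k \<rho> :: real
  assumes "\<rho> > 0"
  shows "((\<lambda>\<rho>. exp (- k * ((1 - \<rho>) / \<rho>))) has_real_derivative k / \<rho>\<^sup>2 * exp (- k * ((1 - \<rho>) / \<rho>))) (at \<rho>)"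
  using assms by (auto intro!: derivative_eq_intros simp: power2_eq_square field_simps)

text \<open>The antiderivative \<open>exp (- k * ((1 - \<rho>) / \<rho>))\<close> equals
  \<open>1\<close> at \<open>\<rho> = 1\<close>. The lower end \<open>a\<close> stays free:
  \<open>0\<close> serves the upper bound for the mixture density, \<open>1/2\<close> the lower
  one.\<close>

lemma exp_ratio_integral:
  fixes k a A :: real
  assumes k: "k > 0" and a: "0 \<le> a" "a < 1" and
    lim: "((\<lambda>\<rho>. exp (- k * ((1 - \<rho>) / \<rho>))) \<longlongrightarrow> A) (at_right a)"
  shows "set_integrable lborel {a<..<1} (\<lambda>\<rho>. k / \<rho>\<^sup>2 * exp (- k * ((1 - \<rho>) / \<rho>)))"
    "(LINT \<rho>:{a<..<1}|lborel. k / \<rho>\<^sup>2 * exp (- k * ((1 - \<rho>) / \<rho>))) = 1 - A"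
proof -
  let ?F = "\<lambda>\<rho>::real. exp (- k * ((1 - \<rho>) / \<rho>))" and ?f = "\<lambda>\<rho>::real. k / \<rho>\<^sup>2 * exp (- k * ((1 - \<rho>) / \<rho>))"
  have lim1: "(?F \<longlongrightarrow> 1) (at_left 1)"
  proof -
    have "isCont ?F 1" by (intro continuous_intros) auto
    then have "(?F \<longlongrightarrow> ?F 1) (at 1)" by (simp add: isCont_def)
    then show ?thesis by (simp add: filterlim_at_split)
  qed
  have c: "isCont ?f x" if "ereal a < ereal x" "ereal x < ereal 1" for x
    using that a by (intro continuous_intros) auto
  have d: "DERIV ?F x :> ?f x" if "ereal a < ereal x" "ereal x < ereal 1" for x
    using that a by (intro exp_ratio_deriv) auto
  have nn: "AE x in lborel. ereal a < ereal x \<longrightarrow> ereal x < ereal 1 \<longrightarrow> 0 \<le> ?f x"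
    using k by (intro AE_I2) auto
  have A: "((?F \<circ> real_of_ereal) \<longlongrightarrow> A) (at_right (ereal a))"
    using lim by (simp only: ereal_tendsto_simps)
  have B: "((?F \<circ> real_of_ereal) \<longlongrightarrow> 1) (at_left (ereal 1))"
    using lim1 by (simp only: ereal_tendsto_simps)
  have "ereal a < ereal 1" using a by simp
  note FTC = interval_integral_FTC_nonneg[OF this d c nn A B]
  have *: "set_integrable lborel (einterval (ereal a) (ereal 1)) ?f \<and> (LBINT x=ereal a..ereal 1. ?f x) = 1 - A"
    using FTC by blast
  then show "set_integrable lborel {a<..<1} ?f" by simp
  show "(LINT \<rho>:{a<..<1}|lborel. ?f \<rho>) = 1 - A"
    using * a by (simp add: interval_lebesgue_integral_def)
qed

text \<open>At \<open>x = 0\<close> the mixture is not integrable, so that the density has the junk value \<open>0\<close> there.\<close>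
lemma mixture_integrand_bounds:
  assumes t: "t > 0" and x: "x \<noteq> 0"
  shows "set_integrable lborel {0<..<1} (mixture_integrand t x)"
    "offdiag_density t (1/2) (1/2) x \<le> 2 * density_const * t / x\<^sup>2"
    "density_const * t / (2 * t\<^sup>2 + x\<^sup>2) \<le> offdiag_density t (1/2) (1/2) x"
proof -
  define k where "k = x\<^sup>2 / (2 * t\<^sup>2)"
  have k: "k > 0" using t x by (simp add: k_def)
  let ?f = "\<lambda>\<rho>. k / \<rho>\<^sup>2 * exp (- k * ((1 - \<rho>) / \<rho>))"
  have F0: "((\<lambda>\<rho>. exp (- k * ((1 - \<rho>) / \<rho>))) \<longlongrightarrow> 0) (at_right 0)"
    using k by real_asymp
  have F1: "((\<lambda>\<rho>. exp (- k * ((1 - \<rho>) / \<rho>))) \<longlongrightarrow> exp (- k)) (at_right (1/2))"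
  proof -
    have "isCont (\<lambda>\<rho>::real. exp (- k * ((1 - \<rho>) / \<rho>))) (1/2)" by (intro continuous_intros) auto
    then have "((\<lambda>\<rho>. exp (- k * ((1 - \<rho>) / \<rho>))) \<longlongrightarrow> exp (- k * ((1 - 1/2) / (1/2)))) (at (1/2))"
      by (simp only: isCont_def)
    then show ?thesis by (simp add: filterlim_at_split)
  qed
  have "(0::real) < 1" by simp
  note I0 = exp_ratio_integral[OF k order_refl this F0]
  have "(0::real) \<le> 1/2" "1/2 < (1::real)" by auto
  note I1 = exp_ratio_integral[OF k this F1]
  have m: "mixture_integrand t x \<rho> = density_const / t * (1 / \<rho> * exp (- k * ((1 - \<rho>) / \<rho>)))" if "0 < \<rho>" "\<rho> < 1" for \<rho>
    using mixture_integrand_eq[OF that t, of x] by (simp only: k_def)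
  \<comment> \<open>Trading \<open>1 / \<rho>\<close> for \<open>1 / \<rho>^2\<close> makes the
    integrand an exact derivative. The reverse bound \<open>1 / \<rho>^2 \<le> 2 / \<rho>\<close> is
    used on \<open>(1/2, 1)\<close>, so the lower bound integrates over that interval.\<close>
  have up: "mixture_integrand t x \<rho> \<le> density_const / (t * k) * ?f \<rho>" if r: "0 < \<rho>" "\<rho> < 1" for \<rho>
  proof -
    have "1 / \<rho> \<le> 1 / \<rho>\<^sup>2" using r by (simp add: field_simps power2_eq_square)
    then have "density_const / t * (1 / \<rho> * exp (- k * ((1 - \<rho>) / \<rho>))) \<le> density_const / t * (1 / \<rho>\<^sup>2 * exp (- k * ((1 - \<rho>) / \<rho>)))"
      using density_const_pos t by (intro mult_left_mono mult_right_mono) auto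
    then show ?thesis using m[OF r] k by simp
  qed
  have lo: "density_const / (2 * t * k) * ?f \<rho> \<le> mixture_integrand t x \<rho>" if r: "1/2 < \<rho>" "\<rho> < 1" for \<rho>
  proof -
    have "1 / \<rho>\<^sup>2 \<le> 2 * (1 / \<rho>)" using r by (simp add: field_simps power2_eq_square)
    then have "density_const / (2 * t) * (1 / \<rho>\<^sup>2 * exp (- k * ((1 - \<rho>) / \<rho>))) \<le> density_const / (2 * t) * ((2 * (1 / \<rho>)) * exp (- k * ((1 - \<rho>) / \<rho>)))"
      using density_const_pos t by (intro mult_left_mono mult_right_mono) auto
    then show ?thesis using m[of \<rho>] r k by simp
  qed
  have meas: "mixture_integrand t x \<in> borel_measurable borel"
    unfolding mixture_integrand_def beta_density_def normal_density_def by measurable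
  have bnd: "set_integrable lborel {0<..<1} (\<lambda>\<rho>. density_const / (t * k) * ?f \<rho>)"
    using I0(1) by (rule set_integrable_mult_right)
  show int: "set_integrable lborel {0<..<1} (mixture_integrand t x)"
  proof (rule set_integrable_bound[OF bnd])
    show "set_borel_measurable lborel {0<..<1} (mixture_integrand t x)"
      using meas by (simp add: set_borel_measurable_def)
    show "AE \<rho> in lborel. \<rho> \<in> {0<..<1} \<longrightarrow> norm (mixture_integrand t x \<rho>) \<le> norm (density_const / (t * k) * ?f \<rho>)"
      using up mixture_integrand_nonneg[of t x] by (intro AE_I2 impI) (smt (verit, best) greaterThanLessThan_iff real_norm_def)
  qed
  have eq: "offdiag_density t (1/2) (1/2) x = (LINT \<rho>:{0<..<1}|lborel. mixture_integrand t x \<rho>)"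
    by (simp add: offdiag_density_def mixture_integrand_def)
  have "offdiag_density t (1/2) (1/2) x \<le> (LINT \<rho>:{0<..<1}|lborel. density_const / (t * k) * ?f \<rho>)"
    unfolding eq by (rule set_integral_mono[OF int bnd]) (use up in auto)
  also have "\<dots> = density_const / (t * k)" using I0(2) by (simp only: set_integral_mult_right) simp
  also have "\<dots> = 2 * density_const * t / x\<^sup>2" using t x by (simp add: k_def field_simps power2_eq_square)
  finally show "offdiag_density t (1/2) (1/2) x \<le> 2 * density_const * t / x\<^sup>2" .
  have int1: "set_integrable lborel {1/2<..<1} (mixture_integrand t x)"
    by (rule set_integrable_subset[OF int]) auto
  \<comment> \<open>A rational minorant of \<open>1 - exp (- k)\<close>; with
    \<open>k = x^2 / (2 t^2)\<close> it produces the denominator \<open>2 t^2 + x^2\<close>.\<close>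
  have ek: "k / (1 + k) \<le> 1 - exp (- k)"
  proof -
    have "exp (- k) \<le> 1 / (1 + k)"
      using k exp_ge_add_one_self[of k] by (simp add: exp_minus field_simps)
    then show ?thesis using k by (simp add: field_simps)
  qed
  have "density_const * t / (2 * t\<^sup>2 + x\<^sup>2) = density_const / (2 * t * k) * (k / (1 + k))"
    using t x k by (simp add: k_def field_simps power2_eq_square)
  also have "\<dots> \<le> density_const / (2 * t * k) * (1 - exp (- k))"
    using density_const_pos t k ek by (intro mult_left_mono) auto
  also have "\<dots> = (LINT \<rho>:{1/2<..<1}|lborel. density_const / (2 * t * k) * ?f \<rho>)"
    by (simp only: set_integral_mult_right I1(2))
  also have "\<dots> \<le> (LINT \<rho>:{1/2<..<1}|lborel. mixture_integrand t x \<rho>)"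
    by (rule set_integral_mono[OF _ int1]) (use I1(1) lo in \<open>simp_all only: set_integrable_mult_right greaterThanLessThan_iff\<close>)
  also have "\<dots> \<le> (LINT \<rho>:{0<..<1}|lborel. mixture_integrand t x \<rho>)"
    unfolding set_lebesgue_integral_def
    by (rule integral_mono)
       (use int int1 mixture_integrand_nonneg[of t x] in \<open>auto simp: set_integrable_def split: split_indicator\<close>)
  finally show "density_const * t / (2 * t\<^sup>2 + x\<^sup>2) \<le> offdiag_density t (1/2) (1/2) x" unfolding eq .
qed

abbreviation offdiag_half :: "real \<Rightarrow> real \<Rightarrow> real" where
  "offdiag_half t \<equiv> offdiag_density t (1/2) (1/2)"

lemma mixture_integrand_measurable [measurable]: "(\<lambda>(x,\<rho>). mixture_integrand t x \<rho>) \<in> borel_measurable (borel \<Otimes>\<^sub>M borel)"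
  unfolding mixture_integrand_def beta_density_def normal_density_def by measurable

lemma offdiag_half_measurable [measurable]: "offdiag_half t \<in> borel_measurable borel"
proof -
  have "offdiag_half t = (\<lambda>x. LINT \<rho>|lborel. indicator {0<..<1} \<rho> * mixture_integrand t x \<rho>)"
    by (simp add: fun_eq_iff offdiag_density_def mixture_integrand_def set_lebesgue_integral_def)
  also have "\<dots> \<in> borel_measurable borel" by measurable
  finally show ?thesis .
qed

lemma offdiag_half_nn:
  assumes "t > 0" "x \<noteq> 0"
  shows "ennreal (offdiag_half t x) = (\<integral>\<^sup>+ \<rho>\<in>{0<..<1}. ennreal (mixture_integrand t x \<rho>) \<partial>lborel)"
proof -
  have "(\<integral>\<^sup>+ \<rho>. ennreal (indicator {0<..<1} \<rho> * mixture_integrand t x \<rho>) \<partial>lborel) = ennreal (offdiag_half t x)"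
    using mixture_integrand_bounds(1)[OF assms] mixture_integrand_nonneg[of t x]
    by (subst nn_integral_eq_integral)
       (auto simp: set_integrable_def offdiag_density_def mixture_integrand_def set_lebesgue_integral_def)
  moreover have "ennreal (indicator {0<..<1} \<rho> * mixture_integrand t x \<rho>) = ennreal (mixture_integrand t x \<rho>) * indicator {0<..<1} \<rho>" for \<rho>
    by (simp split: split_indicator)
  ultimately show ?thesis by simp
qed

lemma nn_integral_beta_half: "(\<integral>\<^sup>+ \<rho>. ennreal (beta_density (1/2) (1/2) \<rho>) \<partial>lborel) = 1"
proof -
  let ?g = "\<lambda>t::real. t powr (1/2 - 1) * (1 - t) powr (1/2 - 1)"
  have "(?g has_integral Beta (1/2) (1/2)) {0<..<1}"
    using has_integral_Beta_real[of "1/2" "1/2"] by (simp add: has_integral_Icc_iff_Ioo)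
  then have "(\<integral>\<^sup>+ x. ennreal (?g x) * indicator {0<..<1} x \<partial>lborel) = ennreal (Beta (1/2) (1/2))"
    by (intro nn_integral_has_integral_lebesgue') auto
  moreover have "ennreal (beta_density (1/2) (1/2) \<rho>) = ennreal (1 / Beta (1/2) (1/2)) * (ennreal (?g \<rho>) * indicator {0<..<1} \<rho>)" for \<rho>
    using Beta_half_pos by (auto simp: beta_density_def ennreal_mult[symmetric])
  ultimately show ?thesis
    using Beta_half_pos by (simp add: nn_integral_cmult ennreal_mult[symmetric])
qed

text \<open>Integrating over \<open>x\<close> first, each normal density has mass one and only the
  Beta density is left.\<close>

lemma nn_integral_offdiag_half:
  assumes t: "t > 0"
  shows "(\<integral>\<^sup>+ x. ennreal (offdiag_half t x) \<partial>lborel) = 1"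
proof -
  have "(\<integral>\<^sup>+ x. ennreal (offdiag_half t x) \<partial>lborel) =
      (\<integral>\<^sup>+ x. (\<integral>\<^sup>+ \<rho>\<in>{0<..<1}. ennreal (mixture_integrand t x \<rho>) \<partial>lborel) \<partial>lborel)"
    \<comment> \<open>The pointwise identity is available for \<open>x \<noteq> 0\<close>; the
      exceptional point is a null set.\<close>
    by (intro nn_integral_cong_AE AE_I[where N="{0}"]) (auto dest: offdiag_half_nn[OF t])
  also have "\<dots> = (\<integral>\<^sup>+ \<rho>. (\<integral>\<^sup>+ x. ennreal (mixture_integrand t x \<rho>) * indicator {0<..<1} \<rho> \<partial>lborel) \<partial>lborel)"
    by (rule lborel_pair.Fubini') measurable
  also have "\<dots> = (\<integral>\<^sup>+ \<rho>. ennreal (beta_density (1/2) (1/2) \<rho>) \<partial>lborel)"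
  proof (intro nn_integral_cong)
    fix \<rho> :: real
    show "(\<integral>\<^sup>+ x. ennreal (mixture_integrand t x \<rho>) * indicator {0<..<1} \<rho> \<partial>lborel) = ennreal (beta_density (1/2) (1/2) \<rho>)"
    proof (cases "0 < \<rho> \<and> \<rho> < 1")
      case True
      let ?s = "sqrt (\<rho>/(1-\<rho>)) * t"
      have "?s > 0" using True t by simp
      then interpret prob_space "density lborel (normal_density 0 ?s)" by (rule prob_space_normal_density)
      have "(\<integral>\<^sup>+ x. ennreal (normal_density 0 ?s x) \<partial>lborel) = 1"
        using emeasure_space_1 by (simp add: emeasure_density)
      moreover have "beta_density (1/2) (1/2) \<rho> \<ge> 0" using Beta_half_pos by (simp add: beta_density_def)
      ultimately show ?thesis using True
        by (simp add: mixture_integrand_def ennreal_mult nn_integral_multc)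
    qed (auto simp: beta_density_def)
  qed
  also have "\<dots> = 1" by (rule nn_integral_beta_half)
  finally show ?thesis .
qed

lemma nn_integral_inverse_square:
  assumes d: "d > 0"
  shows "(\<integral>\<^sup>+ x. ennreal (1 / x\<^sup>2) * indicator {d..} x \<partial>lborel) = ennreal (1 / d)"
proof -
  have "(\<integral>\<^sup>+ x. ennreal (1 / x\<^sup>2) * indicator {d..} x \<partial>lborel) = ennreal (0 - (- 1 / d))"
  proof (rule nn_integral_FTC_atLeast)
    show "((\<lambda>x::real. - 1 / x) \<longlongrightarrow> 0) at_top" by real_asymp
    show "DERIV (\<lambda>x. - 1 / x) x :> 1 / x\<^sup>2" if "d \<le> x" for x
      using that d by (auto intro!: derivative_eq_intros simp: power2_eq_square)
  qed auto
  then show ?thesis by simp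
qed

text \<open>The density is at most of order \<open>t / x^2\<close>, a Cauchy-type tail, and each
  half-line contributes \<open>2 * density_const * t / d\<close>.\<close>

lemma offdiag_half_tail:
  assumes t: "t > 0" and d: "d > 0"
  shows "(\<integral>\<^sup>+ x. ennreal (offdiag_half t x) * indicator {x. d < \<bar>x\<bar>} x \<partial>lborel) \<le> ennreal (4 * density_const * t / d)"
proof -
  let ?h = "\<lambda>x::real. ennreal (1 / x\<^sup>2) * indicator {d..} x"
  have "(\<integral>\<^sup>+ x. ennreal (offdiag_half t x) * indicator {x. d < \<bar>x\<bar>} x \<partial>lborel)
    \<le> (\<integral>\<^sup>+ x. ennreal (2 * density_const * t) * (?h x + ?h (- x)) \<partial>lborel)"
  proof (intro nn_integral_mono)
    fix x :: real
    show "ennreal (offdiag_half t x) * indicator {x. d < \<bar>x\<bar>} x \<le> ennreal (2 * density_const * t) * (?h x + ?h (- x))"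
    proof (cases "d < \<bar>x\<bar>")
      case True
      then have "x \<noteq> 0" using d by auto
      then have "ennreal (offdiag_half t x) \<le> ennreal (2 * density_const * t * (1 / x\<^sup>2))"
        using mixture_integrand_bounds(2)[OF t] by (intro ennreal_leI) simp
      also have "\<dots> = ennreal (2 * density_const * t) * ennreal (1 / x\<^sup>2)"
        using density_const_pos t by (intro ennreal_mult) auto
      also have "\<dots> \<le> ennreal (2 * density_const * t) * (?h x + ?h (- x))"
        using True d by (intro mult_left_mono) (auto simp: abs_if split: if_splits)
      finally show ?thesis using True by simp
    qed simp
  qed
  also have "\<dots> = ennreal (2 * density_const * t) * ((\<integral>\<^sup>+ x. ?h x \<partial>lborel) + (\<integral>\<^sup>+ x. ?h (- x) \<partial>lborel))"
    by (subst nn_integral_cmult, measurable) (subst nn_integral_add, auto)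
  also have "(\<integral>\<^sup>+ x. ?h (- x) \<partial>lborel) = (\<integral>\<^sup>+ x. ?h x \<partial>lborel)"
    using nn_integral_real_affine[of ?h "-1" 0] by simp
  also have "(\<integral>\<^sup>+ x. ?h x \<partial>lborel) = ennreal (1 / d)" by (rule nn_integral_inverse_square[OF d])
  also have "ennreal (2 * density_const * t) * (ennreal (1 / d) + ennreal (1 / d)) = ennreal (4 * density_const * t / d)"
    using density_const_pos t d by (simp add: ennreal_mult[symmetric] ennreal_plus[symmetric] del: ennreal_plus)
  finally show ?thesis .
qed

section \<open>Prior mass of boxes and of matrices with many large entries\<close>

definition entry_law :: "real \<Rightarrow> real \<Rightarrow> nat \<times> nat \<Rightarrow> real measure" where
  "entry_law t lam z = (if fst z = snd z
     then density lborel (\<lambda>x. ennreal (exponential_density (lam/2) x))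
     else density lborel (\<lambda>x. ennreal (offdiag_half t x)))"

lemma prior_u_eq: "prior_u p t (1/2) (1/2) lam = PiM (tri p) (entry_law t lam)"
  unfolding prior_u_def entry_law_def by (intro arg_cong2[of _ _ _ _ PiM]) auto

lemma sets_entry_law [measurable_cong, simp]: "sets (entry_law t lam z) = sets borel"
  by (simp add: entry_law_def)

lemma prob_entry_law:
  assumes "t > 0" "lam > 0"
  shows "prob_space (entry_law t lam z)"
proof (cases "fst z = snd z")
  case True
  then show ?thesis
    using prob_space_exponential_density[of "lam/2"] assms by (simp add: entry_law_def)
next
  case False
  then show ?thesis
    using nn_integral_offdiag_half[OF assms(1)]
    by (intro prob_spaceI) (simp add: entry_law_def emeasure_density)
qed

lemma finite_tri [simp]: "finite (tri p)"
  by (rule finite_subset[of _ "{..<p} \<times> {..<p}"]) (auto simp: tri_def)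

lemma sets_prior_u [measurable_cong, simp]: "sets (prior_u p t (1/2) (1/2) lam) = sets (entry_space p)"
  unfolding prior_u_eq by (intro sets_PiM_cong) auto

lemma space_prior_u [simp]: "space (prior_u p t (1/2) (1/2) lam) = space (entry_space p)"
  by (rule sets_eq_imp_space_eq) simp

lemma prob_prior_u:
  assumes "t > 0" "lam > 0"
  shows "prob_space (prior_u p t (1/2) (1/2) lam)"
  unfolding prior_u_eq by (intro prob_space_PiM prob_entry_law assms)

lemma nn_integral_prior_prod:
  assumes "t > 0" "lam > 0" and g: "\<And>z. g z \<in> borel_measurable borel"
  shows "(\<integral>\<^sup>+ s. (\<Prod>z\<in>tri p. g z (s z)) \<partial>prior_u p t (1/2) (1/2) lam)
    = (\<Prod>z\<in>tri p. \<integral>\<^sup>+ x. g z x \<partial>entry_law t lam z)"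
proof -
  interpret product_sigma_finite "entry_law t lam"
    by (intro product_sigma_finite.intro prob_space_imp_sigma_finite prob_entry_law assms(1,2))
  have "g z \<in> borel_measurable (entry_law t lam z)" for z
    using g[of z] by (simp cong: measurable_cong_sets)
  then show ?thesis unfolding prior_u_eq
    by (intro product_nn_integral_prod) auto
qed

lemma prod_mono_ennreal_nn:
  fixes f g :: "'a \<Rightarrow> ennreal"
  shows "(\<And>z. z \<in> A \<Longrightarrow> f z \<le> g z) \<Longrightarrow> prod f A \<le> prod g A"
  by (induction A rule: infinite_finite_induct) (auto intro: mult_mono)

lemma nn_integral_const_Icc:
  assumes "0 \<le> K" "a \<le> b"
  shows "(\<integral>\<^sup>+ x. ennreal K * indicator {a..b} x \<partial>lborel) = ennreal (K * (b - a))"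
  using assms by (simp add: nn_integral_cmult_indicator ennreal_mult)

text \<open>Only the exponential is bounded below, by its value at the largest rate and position;
  the factor \<open>lam / 2\<close> stays exact.\<close>

lemma diag_box_mass:
  assumes l: "lam > 0" "lam \<le> L" and r: "r > 0" and c: "0 \<le> c - r" "c + r \<le> T"
  shows "ennreal (lam / 2 * (2 * r * exp (- (L * T / 2)))) \<le>
    (\<integral>\<^sup>+ x. indicator {c - r..c + r} x \<partial>entry_law t lam (j,j))"
proof -
  have "ennreal (lam / 2 * (2 * r * exp (- (L * T / 2)))) =
     (\<integral>\<^sup>+ x. ennreal (lam / 2 * exp (- (L * T / 2))) * indicator {c - r..c + r} x \<partial>lborel)"
    using r l by (subst nn_integral_const_Icc) (auto simp: mult_ac)
  also have "\<dots> \<le> (\<integral>\<^sup>+ x. ennreal (exponential_density (lam/2) x) * indicator {c - r..c + r} x \<partial>lborel)"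
  proof (intro nn_integral_mono)
    fix x
    show "ennreal (lam / 2 * exp (- (L * T / 2))) * indicator {c - r..c + r} x
      \<le> ennreal (exponential_density (lam/2) x) * indicator {c - r..c + r} x"
    proof (cases "x \<in> {c - r..c + r}")
      case True
      then have x: "0 \<le> x" "x \<le> T" using c by auto
      then have "x * lam \<le> T * L" using l by (intro mult_mono) auto
      then have "ennreal (lam / 2 * exp (- (L * T / 2))) \<le> ennreal (exponential_density (lam/2) x)"
        using x l by (intro ennreal_leI) (simp add: exponential_density_def mult.commute)
      then show ?thesis using True by simp
    qed simp
  qed
  also have "\<dots> = (\<integral>\<^sup>+ x. indicator {c - r..c + r} x \<partial>entry_law t lam (j,j))"
    by (simp add: entry_law_def nn_integral_density emeasure_density)
  finally show ?thesis .
qed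

lemma offdiag_box_mass:
  assumes t: "t > 0" and r: "r > 0" and c: "\<bar>c\<bar> + r \<le> T" and z: "fst z \<noteq> snd z"
  shows "ennreal (2 * r * (density_const * t / (2 * t\<^sup>2 + T\<^sup>2))) \<le>
    (\<integral>\<^sup>+ x. indicator {c - r..c + r} x \<partial>entry_law t lam z)"
proof -
  have T: "T > 0" using c r abs_ge_zero[of c] by linarith
  have "ennreal (2 * r * (density_const * t / (2 * t\<^sup>2 + T\<^sup>2))) =
     (\<integral>\<^sup>+ x. ennreal (density_const * t / (2 * t\<^sup>2 + T\<^sup>2)) * indicator {c - r..c + r} x \<partial>lborel)"
    using r t density_const_pos by (subst nn_integral_const_Icc) (auto simp: mult_ac)
  also have "\<dots> \<le> (\<integral>\<^sup>+ x. ennreal (offdiag_half t x) * indicator {c - r..c + r} x \<partial>lborel)"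
  \<comment> \<open>The comparison is made off \<open>0\<close>, where the density has its default
    value and the lower bound would fail.\<close>
  proof (intro nn_integral_mono_AE AE_I[where N="{0}"] subsetI)
    fix x assume a: "x \<in> {x \<in> space lborel. \<not> ennreal (density_const * t / (2 * t\<^sup>2 + T\<^sup>2)) * indicator {c - r..c + r} x
        \<le> ennreal (offdiag_half t x) * indicator {c - r..c + r} x}"
    show "x \<in> {0}"
    proof (rule ccontr)
      assume "x \<notin> {0}"
      then have "density_const * t / (2 * t\<^sup>2 + x\<^sup>2) \<le> offdiag_half t x" using mixture_integrand_bounds(3)[OF t] by auto
      moreover have "x \<in> {c - r..c + r}" using a by (auto split: split_indicator_asm)
      then have "\<bar>x\<bar> \<le> T" using c by auto
      then have "x\<^sup>2 \<le> T\<^sup>2" using T by (simp add: abs_le_square_iff[symmetric])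
      then have "density_const * t / (2 * t\<^sup>2 + T\<^sup>2) \<le> density_const * t / (2 * t\<^sup>2 + x\<^sup>2)"
        using t density_const_pos by (intro divide_left_mono mult_pos_pos add_pos_nonneg) auto
      ultimately show False using a by (auto split: split_indicator_asm simp: ennreal_leI)
    qed
  qed auto
  also have "\<dots> = (\<integral>\<^sup>+ x. indicator {c - r..c + r} x \<partial>entry_law t lam z)"
    using z by (simp add: entry_law_def nn_integral_density emeasure_density)
  finally show ?thesis .
qed

text \<open>Turns a probability close to one into an exponential, so that a product over up to
  \<open>p^2\<close> entries becomes a sum of exponents.\<close>

lemma one_minus_ge_exp:
  assumes "0 \<le> x" "x \<le> (1/2::real)"
  shows "exp (- (2 * x)) \<le> 1 - x"
proof -
  have "1 + 2 * x \<le> exp (2 * x)" by (rule exp_ge_add_one_self)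
  then have "exp (- (2 * x)) \<le> 1 / (1 + 2 * x)"
    using assms by (simp add: exp_minus field_simps)
  also have "\<dots> \<le> 1 - x"
  proof -
    have "1 \<le> (1 - x) * (1 + 2 * x)" using mult_nonneg_nonneg[of x "1 - 2*x"] assms by (simp add: algebra_simps)
    then show ?thesis using assms by (simp add: field_simps)
  qed
  finally show ?thesis .
qed

text \<open>Complement of the tail bound. Entries with centre \<open>0\<close> are so numerous that
  each must keep mass close to one; the density bound of \<open>offdiag_box_mass\<close> would lose
  a small factor for each of them.\<close>

lemma offdiag_zero_box_mass:
  assumes t: "t > 0" and l: "lam > 0" and r: "r > 0" "8 * density_const * t / r \<le> 1" and z: "fst z \<noteq> snd z"
  shows "ennreal (exp (- (8 * density_const * t / r))) \<le> (\<integral>\<^sup>+ x. indicator {- r..r} x \<partial>entry_law t lam z)"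
proof -
  interpret prob_space "entry_law t lam z" by (rule prob_entry_law[OF t l])
  have sp: "space (entry_law t lam z) = UNIV" by (simp add: entry_law_def)
  have "emeasure (entry_law t lam z) {x. r < \<bar>x\<bar>} \<le> ennreal (4 * density_const * t / r)"
    using offdiag_half_tail[OF t r(1)] z by (simp add: entry_law_def emeasure_density)
  then have "prob {x. r < \<bar>x\<bar>} \<le> 4 * density_const * t / r"
    unfolding emeasure_eq_measure using density_const_pos t r by (subst (asm) ennreal_le_iff) auto
  moreover have "prob {- r..r} = 1 - prob {x. r < \<bar>x\<bar>}"
  proof -
    have "{- r..r} = space (entry_law t lam z) - {x. r < \<bar>x\<bar>}" unfolding sp by auto
    moreover have "{x. r < \<bar>x\<bar>} \<in> events" by simp
    ultimately show ?thesis by (simp only: prob_compl)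
  qed
  moreover have "exp (- (2 * (4 * density_const * t / r))) \<le> 1 - 4 * density_const * t / r"
    using density_const_pos t r by (intro one_minus_ge_exp) auto
  ultimately have "exp (- (2 * (4 * density_const * t / r))) \<le> prob {- r..r}" by linarith
  moreover have "2 * (4 * density_const * t / r) = 8 * density_const * t / r" by simp
  ultimately have "exp (- (8 * density_const * t / r)) \<le> prob {- r..r}" by (simp only:)
  then show ?thesis by (simp add: emeasure_eq_measure ennreal_leI)
qed

lemma card_diag_tri: "card {z\<in>tri p. fst z = snd z} = p"
proof -
  have "{z\<in>tri p. fst z = snd z} = (\<lambda>j. (j,j)) ` {..<p}" by (auto simp: tri_def)
  then show ?thesis by (simp add: card_image inj_on_def)
qed

lemma card_tri_le: "A \<subseteq> tri p \<Longrightarrow> card A \<le> p\<^sup>2"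
proof -
  assume "A \<subseteq> tri p"
  then have "A \<subseteq> {..<p} \<times> {..<p}" by (auto simp: tri_def)
  from card_mono[OF _ this] show ?thesis by (simp add: power2_eq_square)
qed

definition offsupp :: "nat \<Rightarrow> (nat \<times> nat \<Rightarrow> real) \<Rightarrow> (nat \<times> nat) set" where
  "offsupp p c = {z\<in>tri p. fst z \<noteq> snd z \<and> c z \<noteq> 0}"

text \<open>Independence, with three kinds of coordinates: diagonal, nonzero centre, zero centre.
  Since \<open>B \<le> 1\<close> and \<open>C \<le> 1\<close>, the exact counts may be replaced by
  \<open>m\<close> and \<open>p^2\<close>.\<close>

proposition prior_box_mass:
  assumes t: "t > 0" and l: "lam > 0" "lam \<le> L" and r: "r > 0" "8 * density_const * t / r \<le> 1"
    and cd: "\<And>j. j < p \<Longrightarrow> r \<le> c (j,j)" and cT: "\<And>z. z \<in> tri p \<Longrightarrow> \<bar>c z\<bar> + r \<le> T"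
    and m: "card (offsupp p c) \<le> m" and B1: "2 * r * (density_const * t / (2 * t\<^sup>2 + T\<^sup>2)) \<le> 1"
  shows "ennreal ((lam / 2) ^ p * ((2 * r * exp (- (L * T / 2))) ^ p * (2 * r * (density_const * t / (2 * t\<^sup>2 + T\<^sup>2))) ^ m
      * exp (- (8 * density_const * t / r) * real p ^ 2)))
    \<le> (\<integral>\<^sup>+ s. indicator {s. \<forall>z\<in>tri p. s z \<in> {c z - r..c z + r}} s \<partial>prior_u p t (1/2) (1/2) lam)"
proof -
  define A where "A = lam / 2 * (2 * r * exp (- (L * T / 2)))"
  define B where "B = 2 * r * (density_const * t / (2 * t\<^sup>2 + T\<^sup>2))"
  define C where "C = exp (- (8 * density_const * t / r))"
  have A: "0 \<le> A" using l r by (simp add: A_def)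
  have B: "0 \<le> B" "B \<le> 1" using B1 r t density_const_pos by (auto simp: B_def)
  have C: "0 \<le> C" "C \<le> 1" using r t density_const_pos by (auto simp: C_def)
  define D where "D = {z\<in>tri p. fst z = snd z}"
  define S where "S = offsupp p c"
  define N where "N = {z\<in>tri p. fst z \<noteq> snd z \<and> c z = 0}"
  have fin: "finite D" "finite S" "finite N" by (auto simp: D_def S_def N_def offsupp_def)
  have un: "tri p = D \<union> (S \<union> N)" by (auto simp: D_def S_def N_def offsupp_def)
  have dis: "D \<inter> (S \<union> N) = {}" "S \<inter> N = {}" by (auto simp: D_def S_def N_def offsupp_def)
  define g where "g z = (if z \<in> D then A else if z \<in> S then B else C)" for z
  have "A ^ p * (B ^ m * C ^ (p\<^sup>2)) \<le> A ^ card D * (B ^ card S * C ^ card N)"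
  proof -
    have "card D = p" unfolding D_def by (rule card_diag_tri)
    moreover have "B ^ m \<le> B ^ card S" using B m by (intro power_decreasing) (auto simp: S_def)
    moreover have "C ^ (p\<^sup>2) \<le> C ^ card N" using C card_tri_le[of N p] by (intro power_decreasing) (auto simp: N_def)
    ultimately show ?thesis using A B C by (simp only:) (intro mult_mono mult_nonneg_nonneg zero_le_power order_refl)
  qed
  also have "\<dots> = (\<Prod>z\<in>tri p. g z)"
  proof -
    have "(\<Prod>z\<in>D. g z) = A ^ card D" by (simp add: g_def)
    moreover have "(\<Prod>z\<in>S. g z) = (\<Prod>z\<in>S. B)" using dis by (intro prod.cong) (auto simp: g_def)
    moreover have "(\<Prod>z\<in>N. g z) = (\<Prod>z\<in>N. C)" using dis by (intro prod.cong) (auto simp: g_def)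
    ultimately show ?thesis unfolding un using fin dis by (simp add: prod.union_disjoint)
  qed
  finally have "ennreal (A ^ p * (B ^ m * C ^ (p\<^sup>2))) \<le> (\<Prod>z\<in>tri p. ennreal (g z))"
    using A B C by (subst prod_ennreal) (auto simp: g_def intro: ennreal_leI)
  also have "\<dots> \<le> (\<Prod>z\<in>tri p. \<integral>\<^sup>+ x. indicator {c z - r..c z + r} x \<partial>entry_law t lam z)"
  proof (rule prod_mono_ennreal_nn)
    fix z assume z: "z \<in> tri p"
    show "ennreal (g z) \<le> (\<integral>\<^sup>+ x. indicator {c z - r..c z + r} x \<partial>entry_law t lam z)"
    proof (cases "fst z = snd z")
      case True
      then obtain j where j: "z = (j,j)" "j < p" using z by (cases z) (auto simp: tri_def)
      then have "g z = A" using z by (simp add: g_def D_def)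
      moreover have "ennreal A \<le> (\<integral>\<^sup>+ x. indicator {c z - r..c z + r} x \<partial>entry_law t lam z)"
        unfolding A_def j(1) using l r cd[OF j(2)] cT[OF z] j by (intro diag_box_mass) auto
      ultimately show ?thesis by simp
    next
      case False
      show ?thesis
      proof (cases "c z = 0")
        case True
        then have "g z = C" using False by (simp add: g_def D_def S_def offsupp_def)
        then show ?thesis using offdiag_zero_box_mass[OF t l(1) r False] True by (simp add: C_def)
      next
        case nz: False
        then have "g z = B" using False z by (simp add: g_def D_def S_def offsupp_def)
        then show ?thesis using offdiag_box_mass[OF t r(1) cT[OF z] False] by (simp add: B_def)
      qed
    qed
  qed
  also have "\<dots> = (\<integral>\<^sup>+ s. (\<Prod>z\<in>tri p. indicator {c z - r..c z + r} (s z)) \<partial>prior_u p t (1/2) (1/2) lam)"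
    by (rule nn_integral_prior_prod[symmetric]) (use t l in auto)
  also have "\<dots> = (\<integral>\<^sup>+ s. indicator {s. \<forall>z\<in>tri p. s z \<in> {c z - r..c z + r}} s \<partial>prior_u p t (1/2) (1/2) lam)"
    by (intro nn_integral_cong) (auto split: split_indicator simp: prod_zero_iff)
  also have "A ^ p * (B ^ m * C ^ (p\<^sup>2)) = (lam / 2) ^ p * ((2 * r * exp (- (L * T / 2))) ^ p * B ^ m
      * exp (- (8 * density_const * t / r) * real p ^ 2))"
    unfolding A_def C_def power_mult_distrib[of "lam / 2"] exp_of_nat_mult[symmetric]
    by (simp add: mult_ac)
  finally show ?thesis unfolding B_def .
qed

definition num_large :: "nat \<Rightarrow> real \<Rightarrow> (nat \<times> nat \<Rightarrow> real) \<Rightarrow> nat" where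
  "num_large p d s = card {z\<in>tri p. fst z \<noteq> snd z \<and> d < \<bar>s z\<bar>}"

lemma spectral_bounds_diag:
  assumes "spectral_bounds p \<tau> A" "j < p"
  shows "A j j \<le> \<tau>" "A j j \<ge> 1 / \<tau>"
proof -
  have S: "sym_kernel p A" using assms by (auto simp: spectral_bounds_def)
  let ?h = "\<lambda>k. (if k = j then 1 else 0) + 0 * (if k = j then 1 else (0::real))"
  have "norm_sq p ?h = 1"
    using assms(2) by (simp add: norm_sq_def if_distrib[of "\<lambda>z. z\<^sup>2"] cong: if_cong)
  moreover have "quad_form p A ?h = A j j" using quad_form_add_unit[OF assms(2,2) S, of 0] by simp
  moreover have "norm_sq p ?h / \<tau> \<le> quad_form p A ?h" "quad_form p A ?h \<le> \<tau> * norm_sq p ?h"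
    using assms(1) unfolding spectral_bounds_def by blast+
  ultimately show "A j j \<le> \<tau>" "A j j \<ge> 1 / \<tau>" by simp_all
qed

text \<open>A Chernoff bound: each large off-diagonal entry gets weight \<open>w\<close>. Since \<open>lam\<close> may tend to \<open>0\<close>,
  the factor \<open>(lam / 2) ^ p\<close> must be kept; it cancels against the one in \<open>prior_box_mass\<close>.\<close>
proposition prior_tail_mass:
  assumes t: "t > 0" and l: "lam > 0" and d: "d > 0" and w: "w \<ge> 1" and tau: "\<tau> > 0"
  shows "(\<integral>\<^sup>+ s. ennreal (w ^ k) * indicator {s. spectral_bounds p \<tau> (entry_kernel s) \<and> k \<le> num_large p d s} s \<partial>prior_u p t (1/2) (1/2) lam)
    \<le> ennreal ((lam / 2) ^ p * (\<tau> ^ p * exp (w * (4 * density_const * t / d) * real p ^ 2)))"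
proof -
  \<comment> \<open>On the constraint set each diagonal entry is at most \<open>\<tau>\<close>;
    every large off-diagonal entry contributes a factor at least \<open>w\<close> and every other
    one at least \<open>1\<close>. So the product dominates \<open>w ^ k\<close> there.\<close>
  define g :: "nat \<times> nat \<Rightarrow> real \<Rightarrow> ennreal" where
    "g z x = (if fst z = snd z then indicator {..\<tau>} x else 1 + ennreal w * indicator {x. d < \<bar>x\<bar>} x)" for z x
  have gauss_law: "g z \<in> borel_measurable borel" for z unfolding g_def by measurable
  have "(\<integral>\<^sup>+ s. ennreal (w ^ k) * indicator {s. spectral_bounds p \<tau> (entry_kernel s) \<and> k \<le> num_large p d s} s \<partial>prior_u p t (1/2) (1/2) lam)
    \<le> (\<integral>\<^sup>+ s. (\<Prod>z\<in>tri p. g z (s z)) \<partial>prior_u p t (1/2) (1/2) lam)"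
  proof (intro nn_integral_mono)
    fix s :: "nat \<times> nat \<Rightarrow> real"
    show "ennreal (w ^ k) * indicator {s. spectral_bounds p \<tau> (entry_kernel s) \<and> k \<le> num_large p d s} s \<le> (\<Prod>z\<in>tri p. g z (s z))"
    proof (cases "spectral_bounds p \<tau> (entry_kernel s) \<and> k \<le> num_large p d s")
      case True
      let ?K = "{z\<in>tri p. fst z \<noteq> snd z \<and> d < \<bar>s z\<bar>}"
      have "ennreal (w ^ k) \<le> ennreal (w ^ card ?K)"
        using True w by (intro ennreal_leI power_increasing) (auto simp: num_large_def)
      also have "\<dots> = ennreal w ^ card ?K" using w by (simp add: ennreal_power)
      also have "\<dots> = (\<Prod>z\<in>tri p. if z \<in> ?K then ennreal w else 1)"
      proof -
        have "tri p \<inter> {z. z \<in> ?K} = ?K" by blast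
        then show ?thesis by (simp only: prod.If_cases[OF finite_tri] prod_constant power_one mult_1_right)
      qed
      also have "\<dots> \<le> (\<Prod>z\<in>tri p. g z (s z))"
      proof (rule prod_mono_ennreal_nn)
        fix z assume z: "z \<in> tri p"
        show "(if z \<in> ?K then ennreal w else 1) \<le> g z (s z)"
        proof (cases "fst z = snd z")
          case eq: True
          then obtain j where j: "z = (j,j)" "j < p" using z by (cases z) (auto simp: tri_def)
          have "s z \<le> \<tau>" using spectral_bounds_diag(1)[of p \<tau> "entry_kernel s" j] True j by (simp add: entry_kernel_def)
          then show ?thesis using eq by (simp add: g_def)
        qed (auto simp: g_def)
      qed
      finally show ?thesis using True by simp
    qed simp
  qed
  also have "\<dots> = (\<Prod>z\<in>tri p. \<integral>\<^sup>+ x. g z x \<partial>entry_law t lam z)"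
    by (rule nn_integral_prior_prod[OF t l gauss_law])
  also have "\<dots> \<le> (\<Prod>z\<in>tri p. if fst z = snd z then ennreal (lam / 2 * \<tau>) else ennreal (exp (w * (4 * density_const * t / d))))"
  proof (rule prod_mono_ennreal_nn)
    fix z
    show "(\<integral>\<^sup>+ x. g z x \<partial>entry_law t lam z) \<le>
       (if fst z = snd z then ennreal (lam / 2 * \<tau>) else ennreal (exp (w * (4 * density_const * t / d))))"
    proof (cases "fst z = snd z")
      case True
      have "(\<integral>\<^sup>+ x. g z x \<partial>entry_law t lam z) = (\<integral>\<^sup>+ x. ennreal (exponential_density (lam/2) x) * indicator {..\<tau>} x \<partial>lborel)"
        using True by (simp add: g_def entry_law_def nn_integral_density emeasure_density)
      also have "\<dots> \<le> (\<integral>\<^sup>+ x. ennreal (lam / 2) * indicator {0..\<tau>} x \<partial>lborel)"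
        using l by (intro nn_integral_mono) (auto split: split_indicator simp: exponential_density_def intro!: ennreal_leI mult_left_le)
      also have "\<dots> = ennreal (lam / 2 * \<tau>)" using l tau by (subst nn_integral_const_Icc) auto
      finally show ?thesis using True by simp
    next
      \<comment> \<open>The integral is one plus \<open>w\<close> times the tail probability, put
        into exponential form so that the entries multiply.\<close>
      case False
      interpret prob_space "entry_law t lam z" by (rule prob_entry_law[OF t l])
      have "(\<integral>\<^sup>+ x. g z x \<partial>entry_law t lam z) = 1 + ennreal w * emeasure (entry_law t lam z) {x. d < \<bar>x\<bar>}"
        using False emeasure_space_1 by (simp add: g_def nn_integral_add nn_integral_cmult)
      also have "emeasure (entry_law t lam z) {x. d < \<bar>x\<bar>} \<le> ennreal (4 * density_const * t / d)"
        using offdiag_half_tail[OF t d] False by (simp add: entry_law_def emeasure_density)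
      also have "1 + ennreal w * ennreal (4 * density_const * t / d) = ennreal (1 + w * (4 * density_const * t / d))"
        using w density_const_pos t d by (simp add: ennreal_mult[symmetric] ennreal_plus[symmetric] del: ennreal_plus flip: ennreal_1)
      also have "\<dots> \<le> ennreal (exp (w * (4 * density_const * t / d)))"
        by (intro ennreal_leI exp_ge_add_one_self)
      finally show ?thesis using False by (simp add: mult_left_mono add_left_mono)
    qed
  qed
  also have "\<dots> \<le> ennreal ((lam / 2 * \<tau>) ^ p) * ennreal (exp (w * (4 * density_const * t / d)) ^ (p\<^sup>2))"
  proof -
    let ?e = "exp (w * (4 * density_const * t / d))"
    have e: "1 \<le> ?e" using w density_const_pos t d by simp
    have "(\<Prod>z\<in>tri p. if fst z = snd z then ennreal (lam / 2 * \<tau>) else ennreal ?e) =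
      ennreal (lam / 2 * \<tau>) ^ card {z\<in>tri p. fst z = snd z} * ennreal ?e ^ card {z\<in>tri p. fst z \<noteq> snd z}"
      by (subst prod.If_cases) (auto simp: Int_def Collect_neg_eq)
    also have "\<dots> \<le> ennreal ((lam / 2 * \<tau>) ^ p) * ennreal (?e ^ (p\<^sup>2))"
      unfolding card_diag_tri using l tau e card_tri_le[of "{z\<in>tri p. fst z \<noteq> snd z}" p]
      by (intro mult_mono) (auto simp: ennreal_power intro!: ennreal_leI power_increasing)
    finally show ?thesis .
  qed
  also have "\<dots> = ennreal ((lam / 2) ^ p * (\<tau> ^ p * exp (w * (4 * density_const * t / d) * real p ^ 2)))"
    using l tau unfolding power_mult_distrib[of "lam / 2"] exp_of_nat_mult[symmetric]
    by (simp add: ennreal_mult[symmetric] mult_ac)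
  finally show ?thesis .
qed

section \<open>Likelihood ratios and the sample covariance\<close>

abbreviation data_space :: "nat \<Rightarrow> nat \<Rightarrow> (nat \<Rightarrow> nat \<Rightarrow> real) measure" where
  "data_space n p \<equiv> PiM {..<n} (\<lambda>_. leb p)"

definition gauss_sample :: "nat \<Rightarrow> nat \<Rightarrow> (nat \<Rightarrow> nat \<Rightarrow> real) \<Rightarrow> (nat \<Rightarrow> nat \<Rightarrow> real) measure" where
  "gauss_sample n p S = PiM {..<n} (\<lambda>_. gauss_law p (precision p S))"

definition lik_ratio :: "nat \<Rightarrow> nat \<Rightarrow> (nat \<Rightarrow> nat \<Rightarrow> real) \<Rightarrow> (nat \<Rightarrow> nat \<Rightarrow> real) \<Rightarrow> (nat \<Rightarrow> nat \<Rightarrow> real) \<Rightarrow> real" where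
  "lik_ratio n p S S0 x = (\<Prod>m<n. gauss_density p (precision p S) (x m) / gauss_density p (precision p S0) (x m))"

lemma sets_gauss_sample [measurable_cong, simp]: "sets (gauss_sample n p S) = sets (data_space n p)"
  unfolding gauss_sample_def by (intro sets_PiM_cong) auto

lemma space_gauss_sample [simp]: "space (gauss_sample n p S) = space (data_space n p)"
  by (rule sets_eq_imp_space_eq) simp

lemma gauss_density_precision_pos:
  assumes "spectral_bounds p T S" "T > 0"
  shows "gauss_density p (precision p S) x > 0"
  by (rule gauss_density_pos[OF spectral_bounds_precision(1)[OF assms]])

lemma prob_gauss_sample:
  assumes "spectral_bounds p T S" "T > 0"
  shows "prob_space (gauss_sample n p S)"
  unfolding gauss_sample_def by (intro prob_space_PiM prob_space_gauss_law[OF spectral_bounds_precision(1)[OF assms]])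

lemma nn_integral_gauss_sample_prod:
  assumes S: "spectral_bounds p T S" "T > 0" and h: "h \<in> borel_measurable (leb p)"
  shows "(\<integral>\<^sup>+ x. (\<Prod>m<n. h (x m)) \<partial>gauss_sample n p S) = (\<integral>\<^sup>+ y. h y \<partial>gauss_law p (precision p S)) ^ n"
proof -
  interpret product_sigma_finite "\<lambda>_::nat. gauss_law p (precision p S)"
    by (intro product_sigma_finite.intro prob_space_imp_sigma_finite prob_space_gauss_law[OF spectral_bounds_precision(1)[OF S]])
  have "(\<integral>\<^sup>+ x. (\<Prod>m<n. h (x m)) \<partial>gauss_sample n p S) = (\<Prod>m<n. \<integral>\<^sup>+ y. h y \<partial>gauss_law p (precision p S))"
    unfolding gauss_sample_def using h by (intro product_nn_integral_prod) (auto cong: measurable_cong_sets)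
  then show ?thesis by simp
qed

lemma gauss_law_change:
  assumes S: "spectral_bounds p T S" and S0: "spectral_bounds p T S0" and T: "T > 0" and h: "h \<in> borel_measurable (leb p)"
  shows "(\<integral>\<^sup>+ y. h y * ennreal (gauss_density p (precision p S) y / gauss_density p (precision p S0) y) \<partial>gauss_law p (precision p S0))
    = (\<integral>\<^sup>+ y. h y \<partial>gauss_law p (precision p S))"
proof -
  have "ennreal (gauss_density p (precision p S0) y) * (h y * ennreal (gauss_density p (precision p S) y / gauss_density p (precision p S0) y))
      = ennreal (gauss_density p (precision p S) y) * h y" for y
  proof -
    have "ennreal (gauss_density p (precision p S0) y) * ennreal (gauss_density p (precision p S) y / gauss_density p (precision p S0) y) = ennreal (gauss_density p (precision p S) y)"
      using gauss_density_precision_pos[OF S T, of y] gauss_density_precision_pos[OF S0 T, of y] by (simp add: ennreal_mult[symmetric])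
    then show ?thesis by (metis mult.assoc mult.commute)
  qed
  then show ?thesis using h by (simp add: nn_integral_gauss_law)
qed

lemma lik_ratio_pos:
  assumes "spectral_bounds p T S" "spectral_bounds p T S0" "T > 0"
  shows "lik_ratio n p S S0 x > 0"
  using gauss_density_precision_pos[OF assms(1,3)] gauss_density_precision_pos[OF assms(2,3)]
  by (auto simp: lik_ratio_def intro!: prod_pos)

lemma lik_ratio_refl:
  assumes "spectral_bounds p T S" "T > 0"
  shows "lik_ratio n p S S x = 1"
  unfolding lik_ratio_def using gauss_density_precision_pos[OF assms] by (intro prod.neutral) (simp add: less_imp_neq[THEN not_sym])

lemma component_measurable_data_space: "m < n \<Longrightarrow> (\<lambda>x. x m) \<in> data_space n p \<rightarrow>\<^sub>M leb p"
  by (rule measurable_component_singleton) simp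

lemma lik_ratio_measurable [measurable]: "lik_ratio n p S S0 \<in> borel_measurable (data_space n p)"
proof -
  have "(\<lambda>x. gauss_density p (precision p S') (x m)) \<in> borel_measurable (data_space n p)" if "m < n" for m S'
    by (rule measurable_compose[OF component_measurable_data_space[OF that] gauss_density_measurable])
  then show ?thesis unfolding lik_ratio_def[abs_def] by (intro borel_measurable_prod borel_measurable_divide) auto
qed

text \<open>The likelihood ratio changes the law to the one under \<open>S\<close>, where the sum of
  the forms has mean \<open>n * tr (D S)\<close>. What remains is Chernoff's bound with tilt
  \<open>D\<close>, at a cost \<open>4 T^2 |D|^2\<close> per observation. It is used with
  \<open>S = S0\<close> for concentration, with \<open>D = 0\<close> for the total mass, and with a
  thresholded difference for testing.\<close>

proposition lik_ratio_tilt_bound: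
  assumes S: "spectral_bounds p T S" and S0: "spectral_bounds p T S0" and T: "T > 0"
    and D: "sym_kernel p D" "4 * T * sqrt (kernel_sq p D) \<le> 1"
    and A: "\<And>x. x \<in> A \<Longrightarrow> real n * (kernel_inner p D S + b) \<le> (\<Sum>m<n. quad_form p D (x m))"
  shows "(\<integral>\<^sup>+ x. indicator A x * ennreal (lik_ratio n p S S0 x) \<partial>gauss_sample n p S0)
    \<le> ennreal (exp (- (real n * (b - 4 * T\<^sup>2 * kernel_sq p D))))"
proof -
  let ?r = "\<lambda>y. gauss_density p (precision p S) y / gauss_density p (precision p S0) y"
  have r: "?r y > 0" for y using gauss_density_precision_pos[OF S T, of y] gauss_density_precision_pos[OF S0 T, of y] by simp
  let ?c = "exp (- (real n * (kernel_inner p D S + b)))"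
  have "(\<integral>\<^sup>+ x. indicator A x * ennreal (lik_ratio n p S S0 x) \<partial>gauss_sample n p S0)
    \<le> (\<integral>\<^sup>+ x. ennreal ?c * (\<Prod>m<n. ennreal (exp (quad_form p D (x m))) * ennreal (?r (x m))) \<partial>gauss_sample n p S0)"
  proof (intro nn_integral_mono)
    fix x
    have e: "ennreal ?c * (\<Prod>m<n. ennreal (exp (quad_form p D (x m))) * ennreal (?r (x m)))
      = ennreal (exp ((\<Sum>m<n. quad_form p D (x m)) - real n * (kernel_inner p D S + b)) * lik_ratio n p S S0 x)"
    proof -
      have "(\<Prod>m<n. ennreal (exp (quad_form p D (x m))) * ennreal (?r (x m))) = (\<Prod>m<n. ennreal (exp (quad_form p D (x m)) * ?r (x m)))"
        using r by (intro prod.cong refl ennreal_mult[symmetric]) (auto simp: less_imp_le)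
      also have "\<dots> = ennreal (\<Prod>m<n. exp (quad_form p D (x m)) * ?r (x m))"
        by (rule prod_ennreal) (intro mult_nonneg_nonneg less_imp_le[OF r] exp_ge_zero)
      also have "(\<Prod>m<n. exp (quad_form p D (x m)) * ?r (x m)) = exp (\<Sum>m<n. quad_form p D (x m)) * lik_ratio n p S S0 x"
        by (simp only: prod.distrib exp_sum finite_lessThan lik_ratio_def)
      finally have 1: "(\<Prod>m<n. ennreal (exp (quad_form p D (x m))) * ennreal (?r (x m)))
        = ennreal (exp (\<Sum>m<n. quad_form p D (x m)) * lik_ratio n p S S0 x)" .
      have 2: "?c * (exp (\<Sum>m<n. quad_form p D (x m)) * lik_ratio n p S S0 x)
        = exp ((\<Sum>m<n. quad_form p D (x m)) - real n * (kernel_inner p D S + b)) * lik_ratio n p S S0 x"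
        unfolding mult.assoc[symmetric] exp_add[symmetric] by (simp add: algebra_simps)
      have "0 \<le> exp (\<Sum>m<n. quad_form p D (x m)) * lik_ratio n p S S0 x" using lik_ratio_pos[OF S S0 T, of n x] by simp
      then show ?thesis unfolding 1 2[symmetric] by (intro ennreal_mult[symmetric]) auto
    qed
    show "indicator A x * ennreal (lik_ratio n p S S0 x)
       \<le> ennreal ?c * (\<Prod>m<n. ennreal (exp (quad_form p D (x m))) * ennreal (?r (x m)))"
    proof (cases "x \<in> A")
      case True
      have "1 * lik_ratio n p S S0 x \<le> exp ((\<Sum>m<n. quad_form p D (x m)) - real n * (kernel_inner p D S + b)) * lik_ratio n p S S0 x"
        using A[OF True] lik_ratio_pos[OF S S0 T, of n x] by (intro mult_right_mono) auto
      then show ?thesis unfolding e using True by (simp add: ennreal_leI)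
    qed simp
  qed
  also have "\<dots> = ennreal ?c * (\<integral>\<^sup>+ x. (\<Prod>m<n. ennreal (exp (quad_form p D (x m))) * ennreal (?r (x m))) \<partial>gauss_sample n p S0)"
  proof (rule nn_integral_cmult)
    have "(\<lambda>x. ennreal (exp (quad_form p D (x m))) * ennreal (?r (x m))) \<in> borel_measurable (data_space n p)" if "m < n" for m
      by (rule measurable_compose[OF component_measurable_data_space[OF that]]) measurable
    then show "(\<lambda>x. \<Prod>m<n. ennreal (exp (quad_form p D (x m))) * ennreal (?r (x m))) \<in> borel_measurable (gauss_sample n p S0)"
      by (intro borel_measurable_prod_ennreal) (auto cong: measurable_cong_sets)
  qed
  also have "(\<integral>\<^sup>+ x. (\<Prod>m<n. ennreal (exp (quad_form p D (x m))) * ennreal (?r (x m))) \<partial>gauss_sample n p S0)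
     = (\<integral>\<^sup>+ y. ennreal (exp (quad_form p D y)) * ennreal (?r y) \<partial>gauss_law p (precision p S0)) ^ n"
    by (rule nn_integral_gauss_sample_prod[OF S0 T]) measurable
  also have "(\<integral>\<^sup>+ y. ennreal (exp (quad_form p D y)) * ennreal (?r y) \<partial>gauss_law p (precision p S0))
     = (\<integral>\<^sup>+ y. ennreal (exp (quad_form p D y)) \<partial>gauss_law p (precision p S))"
    by (rule gauss_law_change[OF S S0 T]) measurable
  also have "ennreal ?c * \<dots> ^ n \<le> ennreal ?c * ennreal (exp (kernel_inner p D S + 4 * T\<^sup>2 * kernel_sq p D)) ^ n"
    by (intro mult_left_mono power_mono gauss_law_exp_quad_form_le[OF spectral_bounds_precision[OF S T] D]) auto
  also have "\<dots> = ennreal (exp (- (real n * (b - 4 * T\<^sup>2 * kernel_sq p D))))"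
    by (simp add: ennreal_power ennreal_mult[symmetric] exp_of_nat_mult[symmetric] exp_add[symmetric] algebra_simps)
  finally show ?thesis .
qed

section \<open>Entrywise concentration of the sample covariance\<close>

definition scatter :: "nat \<Rightarrow> (nat \<Rightarrow> nat \<Rightarrow> real) \<Rightarrow> nat \<Rightarrow> nat \<Rightarrow> real" where
  "scatter n x i j = (\<Sum>m<n. x m i * x m j)"

definition good_samples :: "nat \<Rightarrow> nat \<Rightarrow> (nat \<Rightarrow> nat \<Rightarrow> real) \<Rightarrow> real \<Rightarrow> (nat \<Rightarrow> nat \<Rightarrow> real) set" where
  "good_samples n p S0 a = {x. \<forall>i<p. \<forall>j<p. \<bar>scatter n x i j - real n * S0 i j\<bar> \<le> real n * a}"

lemma sum_quad_form: "(\<Sum>m<n. quad_form p D (x m)) = kernel_inner p D (scatter n x)"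
proof -
  have "(\<Sum>m<n. quad_form p D (x m)) = (\<Sum>i<p. \<Sum>m<n. \<Sum>j<p. x m i * D i j * x m j)"
    unfolding quad_form_def by (rule sum.swap)
  also have "\<dots> = (\<Sum>i<p. \<Sum>j<p. \<Sum>m<n. x m i * D i j * x m j)"
    by (intro sum.cong refl sum.swap)
  finally show ?thesis by (simp add: kernel_inner_def scatter_def sum_distrib_left mult_ac)
qed

lemma scatter_measurable [measurable]:
  assumes "i < p" "j < p"
  shows "(\<lambda>x. scatter n x i j) \<in> borel_measurable (data_space n p)"
proof -
  have "(\<lambda>y. y k) \<in> borel_measurable (leb p)" if "k < p" for k
    using measurable_component_singleton[of k "{..<p}" "\<lambda>_. lborel :: real measure"] that by simp
  then have "(\<lambda>x. x m k) \<in> borel_measurable (data_space n p)" if "m < n" "k < p" for m k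
    by (rule measurable_compose[OF component_measurable_data_space[OF that(1)]]) (use that in auto)
  then show ?thesis unfolding scatter_def using assms by (intro borel_measurable_sum borel_measurable_times) auto
qed

text \<open>Symmetrised matrix unit: pairing it with a symmetric kernel reads off one entry. For
  \<open>i = j\<close> the two halves add up to \<open>1\<close>.\<close>

definition unit_kernel :: "nat \<Rightarrow> nat \<Rightarrow> nat \<Rightarrow> nat \<Rightarrow> real" where
  "unit_kernel i j k l = (if k = i \<and> l = j then 1/2 else 0) + (if k = j \<and> l = i then 1/2 else 0)"

lemma kernel_inner_unit_kernel:
  assumes "i < p" "j < p"
  shows "kernel_inner p (\<lambda>k l. t * unit_kernel i j k l) B = t * (B i j + B j i) / 2"
proof -
  have "kernel_inner p (\<lambda>k l. t * unit_kernel i j k l) B =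
     (\<Sum>k<p. \<Sum>l<p. (if k = i then (if l = j then t * B k l / 2 else 0) else 0)) +
     (\<Sum>k<p. \<Sum>l<p. (if k = j then (if l = i then t * B k l / 2 else 0) else 0))"
    unfolding kernel_inner_def sum.distrib[symmetric] by (intro sum.cong refl) (auto simp: unit_kernel_def)
  also have "\<dots> = t * B i j / 2 + t * B j i / 2"
    using assms by (simp add: if_distrib[of "\<lambda>f. sum f _"] sum.delta cong: if_cong)
      (simp add: sum.If_cases Int_def conj_commute cong: conj_cong)
  finally show ?thesis by (simp add: field_simps)
qed

lemma kernel_sq_unit_kernel:
  assumes "i < p" "j < p"
  shows "kernel_sq p (\<lambda>k l. t * unit_kernel i j k l) \<le> t\<^sup>2"
proof -
  have "kernel_sq p (\<lambda>k l. t * unit_kernel i j k l) = kernel_inner p (\<lambda>k l. t * unit_kernel i j k l) (\<lambda>k l. t * unit_kernel i j k l)"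
    by (simp add: kernel_sq_def kernel_inner_def power2_eq_square)
  also have "\<dots> = t * (t * unit_kernel i j i j + t * unit_kernel i j j i) / 2" by (rule kernel_inner_unit_kernel[OF assms])
  also have "\<dots> \<le> t\<^sup>2" by (cases "i = j") (simp_all add: unit_kernel_def power2_eq_square)
  finally show ?thesis .
qed

text \<open>Union bound over entries and signs, each event by the tilt \<open>\<sigma> * t\<close>
  times a symmetrised matrix unit. Of the margin \<open>a * t = (4 T^2 + 3) t^2\<close> the tilt
  consumes at most \<open>4 T^2 t^2\<close>. The remaining \<open>3 t^2\<close> is chosen so that
  \<open>t^2 = ln p / n\<close> beats the \<open>p^2\<close> entries by a factor of order
  \<open>1 / p\<close>.\<close>

proposition good_samples_prob:
  assumes S0: "spectral_bounds p T S0" and T: "T > 0" and t: "t > 0" "4 * T * t \<le> 1" and a: "a = (4 * T\<^sup>2 + 3) * t"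
  shows "emeasure (gauss_sample n p S0) {x \<in> space (data_space n p). x \<notin> good_samples n p S0 a}
    \<le> ennreal (real p ^ 2 * (2 * exp (- (3 * real n * t\<^sup>2))))"
proof -
  let ?P = "gauss_sample n p S0"
  interpret prob_space ?P by (rule prob_gauss_sample[OF S0 T])
  have sym: "S0 i j = S0 j i" if "i < p" "j < p" for i j using S0 that by (auto simp: spectral_bounds_def sym_kernel_def)
  define B where "B z \<sigma> = {x \<in> space (data_space n p). real n * (\<sigma> * t * S0 (fst z) (snd z) + a * t) \<le> \<sigma> * t * scatter n x (fst z) (snd z)}"
    for z \<sigma>
  have Bm: "B z \<sigma> \<in> sets ?P" if "z \<in> {..<p} \<times> {..<p}" for z \<sigma>
  proof -
    have [measurable]: "(\<lambda>x. scatter n x (fst z) (snd z)) \<in> borel_measurable (data_space n p)"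
      using that by (intro scatter_measurable) auto
    show ?thesis unfolding B_def sets_gauss_sample by measurable
  qed
  have bound: "emeasure ?P (B z \<sigma>) \<le> ennreal (exp (- (3 * real n * t\<^sup>2)))"
    if z: "z \<in> {..<p} \<times> {..<p}" and s: "\<sigma> = 1 \<or> \<sigma> = -1" for z \<sigma>
  proof -
    obtain i j where ij: "z = (i,j)" "i < p" "j < p" using z by auto
    define D where "D = (\<lambda>k l. \<sigma> * t * unit_kernel i j k l)"
    have f: "kernel_sq p D \<le> t\<^sup>2" using kernel_sq_unit_kernel[OF ij(2,3), of "\<sigma> * t"] s unfolding D_def by (auto simp: power_mult_distrib)
    have "sqrt (kernel_sq p D) \<le> t" using real_sqrt_le_mono[OF f] t by simp
    then have "4 * T * sqrt (kernel_sq p D) \<le> 4 * T * t" using T by (intro mult_left_mono) auto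
    then have small: "4 * T * sqrt (kernel_sq p D) \<le> 1" using t by linarith
    have "unit_kernel i j k l = unit_kernel i j l k" for k l
      by (simp only: unit_kernel_def conj_commute add.commute)
    then have symD: "sym_kernel p D" unfolding D_def sym_kernel_def by metis
    have ks: "kernel_inner p D (scatter n x) = \<sigma> * t * scatter n x i j" for x
      using kernel_inner_unit_kernel[OF ij(2,3), of "\<sigma> * t" "scatter n x"] by (simp add: D_def scatter_def mult.commute)
    have k0: "kernel_inner p D S0 = \<sigma> * t * S0 i j"
      using kernel_inner_unit_kernel[OF ij(2,3), of "\<sigma> * t" S0] sym[OF ij(2,3)] by (simp add: D_def)
    have "emeasure ?P (B z \<sigma>) = (\<integral>\<^sup>+ x. indicator (B z \<sigma>) x * ennreal (lik_ratio n p S0 S0 x) \<partial>?P)"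
      using Bm[OF z] by (simp add: lik_ratio_refl[OF S0 T])
    also have "\<dots> \<le> ennreal (exp (- (real n * (a * t - 4 * T\<^sup>2 * kernel_sq p D))))"
      by (rule lik_ratio_tilt_bound[OF S0 S0 T symD small]) (auto simp: B_def ij sum_quad_form ks k0)
    also have "\<dots> \<le> ennreal (exp (- (3 * real n * t\<^sup>2)))"
    proof -
      have "4 * T\<^sup>2 * kernel_sq p D \<le> 4 * T\<^sup>2 * t\<^sup>2" using f by (intro mult_left_mono) auto
      then have "3 * t\<^sup>2 \<le> a * t - 4 * T\<^sup>2 * kernel_sq p D" by (simp add: a power2_eq_square algebra_simps)
      then have "real n * (3 * t\<^sup>2) \<le> real n * (a * t - 4 * T\<^sup>2 * kernel_sq p D)" by (intro mult_left_mono) auto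
      then show ?thesis by (intro ennreal_leI) (simp add: mult_ac)
    qed
    finally show ?thesis .
  qed
  let ?I = "{..<p} \<times> {..<p}"
  have sub: "{x \<in> space (data_space n p). x \<notin> good_samples n p S0 a} \<subseteq> (\<Union>z\<in>?I. B z 1 \<union> B z (-1))"
  proof
    fix x assume "x \<in> {x \<in> space (data_space n p). x \<notin> good_samples n p S0 a}"
    then obtain i j where x: "x \<in> space (data_space n p)" and ij: "i < p" "j < p"
      and g: "real n * a < \<bar>scatter n x i j - real n * S0 i j\<bar>" by (auto simp: good_samples_def not_le)
    have "t * (real n * a) \<le> t * \<bar>scatter n x i j - real n * S0 i j\<bar>" using g t by (intro mult_left_mono) auto
    then have "x \<in> B (i,j) 1 \<or> x \<in> B (i,j) (-1)"
      using x by (auto simp: B_def abs_if algebra_simps split: if_splits)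
    then show "x \<in> (\<Union>z\<in>?I. B z 1 \<union> B z (-1))" using ij by (auto intro!: bexI[of _ "(i,j)"])
  qed
  have "emeasure ?P {x \<in> space (data_space n p). x \<notin> good_samples n p S0 a} \<le> emeasure ?P (\<Union>z\<in>?I. B z 1 \<union> B z (-1))"
    using Bm by (intro emeasure_mono[OF sub] sets.finite_UN) auto
  also have "\<dots> \<le> (\<Sum>z\<in>?I. emeasure ?P (B z 1 \<union> B z (-1)))"
    using Bm by (intro emeasure_subadditive_finite) auto
  also have "\<dots> \<le> (\<Sum>z\<in>?I. ennreal (2 * exp (- (3 * real n * t\<^sup>2))))"
  proof (intro sum_mono)
    fix z assume z: "z \<in> ?I"
    have "emeasure ?P (B z 1 \<union> B z (-1)) \<le> emeasure ?P (B z 1) + emeasure ?P (B z (-1))"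
      using Bm[OF z] by (intro emeasure_subadditive) auto
    also have "\<dots> \<le> ennreal (exp (- (3 * real n * t\<^sup>2))) + ennreal (exp (- (3 * real n * t\<^sup>2)))"
      using bound[OF z] by (intro add_mono) auto
    also have "\<dots> = ennreal (2 * exp (- (3 * real n * t\<^sup>2)))"
      by (simp add: ennreal_plus[symmetric] del: ennreal_plus)
    finally show "emeasure ?P (B z 1 \<union> B z (-1)) \<le> ennreal (2 * exp (- (3 * real n * t\<^sup>2)))" .
  qed
  also have "\<dots> = ennreal (real p ^ 2 * (2 * exp (- (3 * real n * t\<^sup>2))))"
    by (simp add: ennreal_mult ennreal_of_nat_eq_real_of_nat power2_eq_square card_cartesian_product mult_ac)
  finally show ?thesis .
qed

section \<open>Testing against thresholded differences\<close>

definition threshold :: "(nat \<times> nat) set \<Rightarrow> (nat \<Rightarrow> nat \<Rightarrow> real) \<Rightarrow> nat \<Rightarrow> nat \<Rightarrow> real" where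
  "threshold K A i j = (if (i,j) \<in> K then A i j else 0)"

text \<open>Cauchy-Schwarz against the indicator of \<open>K\<close>. This is where sparsity enters,
  as \<open>sqrt (card K)\<close> in place of \<open>p\<close>.\<close>

lemma sum_abs_threshold_le:
  assumes K: "K \<subseteq> {..<p} \<times> {..<p}"
  shows "(\<Sum>i<p. \<Sum>j<p. \<bar>threshold K A i j\<bar>) \<le> sqrt (real (card K)) * sqrt (kernel_sq p (threshold K A))"
proof -
  let ?I = "\<lambda>i j. if (i,j) \<in> K then 1 else (0::real)"
  have "(\<Sum>i<p. \<Sum>j<p. \<bar>threshold K A i j\<bar>) = kernel_inner p (\<lambda>i j. \<bar>threshold K A i j\<bar>) ?I"
    unfolding kernel_inner_def by (intro sum.cong refl) (auto simp: threshold_def)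
  also have "\<dots> \<le> sqrt (kernel_sq p (\<lambda>i j. \<bar>threshold K A i j\<bar>)) * sqrt (kernel_sq p ?I)"
    using kernel_inner_Cauchy abs_le_D1 by blast
  also have "kernel_sq p (\<lambda>i j. \<bar>threshold K A i j\<bar>) = kernel_sq p (threshold K A)" by (simp add: kernel_sq_def)
  also have "kernel_sq p ?I = real (card K)"
  proof -
    have "kernel_sq p ?I = (\<Sum>z\<in>{..<p}\<times>{..<p}. if z \<in> K then 1 else 0)"
      unfolding kernel_sq_def sum.cartesian_product by (intro sum.cong refl) auto
    also have "\<dots> = real (card (({..<p}\<times>{..<p}) \<inter> K))"
      by (simp add: sum.If_cases)
    also have "({..<p}\<times>{..<p}) \<inter> K = K" using K by blast
    finally show ?thesis .
  qed
  finally show ?thesis by (simp add: mult.commute)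
qed

lemma kernel_inner_diff_right: "kernel_inner p A (\<lambda>i j. B i j - t * C i j) = kernel_inner p A B - t * kernel_inner p A C"
  by (simp add: kernel_inner_def right_diff_distrib sum_subtractf sum_distrib_left mult_ac)

lemma kernel_inner_scale_left: "kernel_inner p (\<lambda>i j. t * A i j) B = t * kernel_inner p A B"
  by (simp add: kernel_inner_def sum_distrib_left mult_ac)

lemma kernel_sq_scale: "kernel_sq p (\<lambda>i j. t * A i j) = t\<^sup>2 * kernel_sq p A"
  by (simp add: kernel_sq_def sum_distrib_left power_mult_distrib)

text \<open>The deviation of the sample covariance is only controlled entrywise. It is tested against the
  difference \<open>S - S0\<close> thresholded to \<open>K\<close>, so that it costs a factor \<open>sqrt (card K)\<close> only.\<close>
proposition lik_ratio_on_good_samples: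
  assumes S: "spectral_bounds p T S" and S0: "spectral_bounds p T S0" and T: "T \<ge> 1"
    and K: "K \<subseteq> {..<p} \<times> {..<p}" "\<And>i j. (i,j) \<in> K \<Longrightarrow> (j,i) \<in> K"
    and v: "0 < v" "v \<le> 1" "v \<le> kernel_sq p (threshold K (\<lambda>i j. S i j - S0 i j))"
    and a: "0 \<le> a" "a * sqrt (real (card K)) \<le> sqrt v / 2"
  shows "(\<integral>\<^sup>+ x. indicator (good_samples n p S0 a) x * ennreal (lik_ratio n p S S0 x) \<partial>gauss_sample n p S0)
    \<le> ennreal (exp (- (real n * v / (64 * T\<^sup>2))))"
proof -
  have T0: "T > 0" using T by simp
  define D where "D = threshold K (\<lambda>i j. S i j - S0 i j)"
  define F where "F = sqrt (kernel_sq p D)"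
  have F2: "kernel_sq p D = F\<^sup>2" by (simp add: F_def)
  have vF: "sqrt v \<le> F" unfolding F_def D_def by (intro real_sqrt_le_mono v)
  have F0: "0 < F" using vF v(1) by (smt (verit) real_sqrt_gt_zero)
  \<comment> \<open>Size of the tilt: \<open>16 T^2 q \<le> 1\<close> keeps the quadratic cost below
    half of the linear gain, and dividing by \<open>F\<close> when \<open>F > 1\<close> keeps the
    tilt within the range of \<open>lik_ratio_tilt_bound\<close>.\<close>
  define q where "q = 1 / (16 * T\<^sup>2 * max 1 F)"
  have q0: "q > 0" using T0 by (simp add: q_def)
  have T2: "1 \<le> T\<^sup>2" using T by (simp add: one_le_power)
  have q1: "16 * T\<^sup>2 * q \<le> 1" and qF: "16 * T\<^sup>2 * (q * F) \<le> 1"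
    using T0 F0 unfolding q_def by (auto simp: field_simps max_def)
  \<comment> \<open>Negative sign: on good samples the pairing of \<open>D\<close> with the scatter
    stays near its value under \<open>S0\<close>, which is unusually small under
    \<open>S\<close>.\<close>
  define E where "E = (\<lambda>i j. (- q) * D i j)"
  have fE: "kernel_sq p E = q\<^sup>2 * F\<^sup>2" unfolding E_def kernel_sq_scale F2 by simp
  have "sym_kernel p D" using S S0 K(2) by (auto simp: D_def threshold_def spectral_bounds_def sym_kernel_def)
  then have symE: "sym_kernel p E" by (auto simp: E_def sym_kernel_def)
  have small: "4 * T * sqrt (kernel_sq p E) \<le> 1"
  proof -
    have "sqrt (kernel_sq p E) = q * F" unfolding fE using q0 F0 by (simp add: real_sqrt_mult)
    moreover have "4 * T * (q * F) \<le> 16 * T\<^sup>2 * (q * F)"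
      using T q0 F0 by (intro mult_right_mono) (auto simp: power2_eq_square)
    ultimately have "4 * T * sqrt (kernel_sq p E) \<le> 16 * T\<^sup>2 * (q * F)" by (simp only:)
    then show ?thesis using qF by linarith
  qed
  have DS: "kernel_inner p D S - kernel_inner p D S0 = F\<^sup>2"
  proof -
    have "kernel_inner p D S - kernel_inner p D S0 = kernel_inner p D (\<lambda>i j. S i j - S0 i j)" using kernel_inner_diff_right[of p D S 1 S0] by simp
    also have "\<dots> = kernel_sq p D" unfolding kernel_inner_def kernel_sq_def
      by (intro sum.cong refl) (simp add: D_def threshold_def power2_eq_square)
    finally show ?thesis by (simp add: F2)
  qed
  have A: "real n * (kernel_inner p E S + q * F\<^sup>2 / 2) \<le> (\<Sum>m<n. quad_form p E (x m))" if x: "x \<in> good_samples n p S0 a" for x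
  proof -
    have "kernel_inner p D (scatter n x) - real n * kernel_inner p D S0 = kernel_inner p D (\<lambda>i j. scatter n x i j - real n * S0 i j)"
      by (rule kernel_inner_diff_right[symmetric])
    also have "\<dots> \<le> (\<Sum>i<p. \<Sum>j<p. \<bar>D i j\<bar> * (real n * a))"
      unfolding kernel_inner_def
    proof (intro sum_mono)
      fix i j assume "i \<in> {..<p}" "j \<in> {..<p}"
      then have "\<bar>scatter n x i j - real n * S0 i j\<bar> \<le> real n * a" using x by (auto simp: good_samples_def)
      then have "\<bar>D i j * (scatter n x i j - real n * S0 i j)\<bar> \<le> \<bar>D i j\<bar> * (real n * a)"
        unfolding abs_mult by (rule mult_left_mono) simp
      then show "D i j * (scatter n x i j - real n * S0 i j) \<le> \<bar>D i j\<bar> * (real n * a)" by linarith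
    qed
    also have "\<dots> = (\<Sum>i<p. \<Sum>j<p. \<bar>D i j\<bar>) * (real n * a)" by (simp add: sum_distrib_right)
    also have "\<dots> \<le> (sqrt (real (card K)) * F) * (real n * a)"
      using a sum_abs_threshold_le[OF K(1)] unfolding D_def F_def by (intro mult_right_mono) auto
    also have "\<dots> = real n * F * (a * sqrt (real (card K)))" by (simp add: mult_ac)
    \<comment> \<open>The noise is at most half of the signal \<open>F^2\<close>, by the condition
      on \<open>a\<close> and \<open>sqrt v \<le> F\<close>.\<close>
    also have "\<dots> \<le> real n * F * (F / 2)"
      using a(2) vF F0 by (intro mult_left_mono) auto
    finally have *: "kernel_inner p D (scatter n x) - real n * kernel_inner p D S0 \<le> real n * F\<^sup>2 / 2" by (simp add: power2_eq_square)
    have "real n * (kernel_inner p D S) - kernel_inner p D (scatter n x) \<ge> real n * F\<^sup>2 / 2"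
      using * arg_cong[OF DS, of "\<lambda>z. real n * z"] by (simp add: algebra_simps)
    then have "q * (real n * F\<^sup>2 / 2) \<le> q * (real n * (kernel_inner p D S) - kernel_inner p D (scatter n x))"
      using q0 by (intro mult_left_mono) auto
    then show ?thesis
      unfolding sum_quad_form E_def kernel_inner_scale_left by (simp add: algebra_simps)
  qed
  have "(\<integral>\<^sup>+ x. indicator (good_samples n p S0 a) x * ennreal (lik_ratio n p S S0 x) \<partial>gauss_sample n p S0)
    \<le> ennreal (exp (- (real n * (q * F\<^sup>2 / 2 - 4 * T\<^sup>2 * kernel_sq p E))))"
    by (rule lik_ratio_tilt_bound[OF S S0 T0 symE small A])
  also have "\<dots> \<le> ennreal (exp (- (real n * v / (64 * T\<^sup>2))))"
  proof -
    have "4 * T\<^sup>2 * kernel_sq p E = (4 * T\<^sup>2 * q) * (q * F\<^sup>2)" by (simp add: fE power2_eq_square)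
    also have "\<dots> \<le> 1/4 * (q * F\<^sup>2)" using q1 q0 by (intro mult_right_mono) auto
    finally have "q * F\<^sup>2 / 4 \<le> q * F\<^sup>2 / 2 - 4 * T\<^sup>2 * kernel_sq p E" by simp
    moreover have "v / (64 * T\<^sup>2) \<le> q * F\<^sup>2 / 4"
    proof -
      \<comment> \<open>For \<open>F \<le> 1\<close> this is \<open>v \<le> F^2\<close>; for larger
        \<open>F\<close> it follows from the cap \<open>v \<le> 1\<close>.\<close>
      have "v * max 1 F \<le> F\<^sup>2"
      proof (cases "F \<le> 1")
        case True
        then have "max 1 F = 1" by (rule max.absorb1)
        then show ?thesis using v(3) F2 by (simp add: D_def)
      next
        case False
        then have "v * F \<le> F * F" using v F0 by (intro mult_right_mono) auto
        then show ?thesis using False by (simp add: power2_eq_square max_def)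
      qed
      moreover have "max 1 F > 0" by simp
      ultimately have "v \<le> F\<^sup>2 / max 1 F" by (simp only: pos_le_divide_eq)
      then have "v / (64 * T\<^sup>2) \<le> (F\<^sup>2 / max 1 F) / (64 * T\<^sup>2)" by (intro divide_right_mono) auto
      also have "\<dots> = q * F\<^sup>2 / 4" by (simp add: q_def)
      finally show ?thesis .
    qed
    ultimately have "v / (64 * T\<^sup>2) \<le> q * F\<^sup>2 / 2 - 4 * T\<^sup>2 * kernel_sq p E" by linarith
    then have "real n * (v / (64 * T\<^sup>2)) \<le> real n * (q * F\<^sup>2 / 2 - 4 * T\<^sup>2 * kernel_sq p E)" by (rule mult_left_mono) simp
    then show ?thesis by (intro ennreal_leI) simp
  qed
  finally show ?thesis .
qed

text \<open>The diagonal and the support of \<open>S0\<close> always belong to this set. Off it, the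
  difference \<open>S - S0\<close> is \<open>S\<close> itself and at most \<open>d\<close> in
  absolute value.\<close>

definition active_entries :: "nat \<Rightarrow> real \<Rightarrow> (nat \<Rightarrow> nat \<Rightarrow> real) \<Rightarrow> (nat \<Rightarrow> nat \<Rightarrow> real) \<Rightarrow> (nat \<times> nat) set" where
  "active_entries p d S S0 = {z \<in> {..<p} \<times> {..<p}. fst z = snd z \<or> S0 (fst z) (snd z) \<noteq> 0 \<or> d < \<bar>S (fst z) (snd z)\<bar>}"

definition num_offsupp :: "nat \<Rightarrow> (nat \<Rightarrow> nat \<Rightarrow> real) \<Rightarrow> nat" where
  "num_offsupp p S0 = card {z \<in> {..<p} \<times> {..<p}. fst z \<noteq> snd z \<and> S0 (fst z) (snd z) \<noteq> 0}"

text \<open>The factor \<open>2\<close> arises because \<open>num_large\<close> counts positions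
  above the diagonal, while the active set contains both mirror images.\<close>

lemma card_active_entries:
  "card (active_entries p d (entry_kernel s) S0) \<le> p + num_offsupp p S0 + 2 * num_large p d s"
proof -
  let ?D = "(\<lambda>j. (j,j)) ` {..<p}" and ?O = "{z \<in> {..<p} \<times> {..<p}. fst z \<noteq> snd z \<and> S0 (fst z) (snd z) \<noteq> 0}"
  let ?L = "{z\<in>tri p. fst z \<noteq> snd z \<and> d < \<bar>s z\<bar>}"
  have fin: "finite ?D" "finite ?O" "finite ?L" by auto
  have "active_entries p d (entry_kernel s) S0 \<subseteq> (?D \<union> ?O) \<union> (?L \<union> prod.swap ` ?L)"
  proof
    fix z assume z: "z \<in> active_entries p d (entry_kernel s) S0"
    obtain i j where ij: "z = (i,j)" by (cases z)
    have lt: "i < p" "j < p" using z ij by (auto simp: active_entries_def)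
    show "z \<in> (?D \<union> ?O) \<union> (?L \<union> prod.swap ` ?L)"
    proof (cases "i = j \<or> S0 i j \<noteq> 0")
      case True
      then show ?thesis using lt ij by auto
    next
      case False
      then have d: "d < \<bar>entry_kernel s i j\<bar>" "i \<noteq> j" using z ij by (auto simp: active_entries_def)
      show ?thesis
      proof (cases "i \<le> j")
        case True
        then have "z \<in> ?L" using d lt ij by (simp add: entry_kernel_def tri_def)
        then show ?thesis by blast
      next
        case False
        then have "(j,i) \<in> ?L" using d lt by (simp add: entry_kernel_def tri_def)
        then have "prod.swap (j,i) \<in> prod.swap ` ?L" by (rule imageI)
        then show ?thesis using ij by simp
      qed
    qed
  qed
  then have "card (active_entries p d (entry_kernel s) S0) \<le> card ((?D \<union> ?O) \<union> (?L \<union> prod.swap ` ?L))"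
    using fin by (intro card_mono) auto
  also have "\<dots> \<le> (card ?D + card ?O) + (card ?L + card (prod.swap ` ?L))"
    by (intro card_Un_le[THEN order_trans] add_mono card_Un_le)
  also have "card ?D \<le> p" using card_image_le[of "{..<p}" "\<lambda>j. (j,j)"] by simp
  also have "card (prod.swap ` ?L) \<le> card ?L" using fin by (intro card_image_le)
  finally show ?thesis unfolding num_offsupp_def num_large_def by simp
qed

lemma kernel_sq_active_entries:
  assumes "d \<ge> 0"
  shows "kernel_sq p (\<lambda>i j. S i j - S0 i j) \<le> kernel_sq p (threshold (active_entries p d S S0) (\<lambda>i j. S i j - S0 i j)) + (real p * d)\<^sup>2"
proof -
  have "kernel_sq p (\<lambda>i j. S i j - S0 i j) \<le>
    (\<Sum>i<p. \<Sum>j<p. (threshold (active_entries p d S S0) (\<lambda>i j. S i j - S0 i j) i j)\<^sup>2 + d\<^sup>2)"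
    unfolding kernel_sq_def
  proof (intro sum_mono)
    fix i j assume ij: "i \<in> {..<p}" "j \<in> {..<p}"
    show "(S i j - S0 i j)\<^sup>2 \<le> (threshold (active_entries p d S S0) (\<lambda>i j. S i j - S0 i j) i j)\<^sup>2 + d\<^sup>2"
    proof (cases "(i,j) \<in> active_entries p d S S0")
      case False
      then have "S0 i j = 0" "\<bar>S i j\<bar> \<le> \<bar>d\<bar>" using ij assms by (auto simp: active_entries_def)
      then show ?thesis by (simp add: abs_le_square_iff[symmetric] add_increasing)
    qed (simp add: threshold_def)
  qed
  also have "\<dots> = kernel_sq p (threshold (active_entries p d S S0) (\<lambda>i j. S i j - S0 i j)) + (real p * d)\<^sup>2"
    by (simp add: kernel_sq_def sum.distrib power2_eq_square algebra_simps)
  finally show ?thesis .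
qed

text \<open>Independence raises the single-observation chi-square bound to the power
  \<open>n\<close>.\<close>

lemma nn_integral_inverse_lik_ratio:
  assumes S: "spectral_bounds p T S" and S0: "spectral_bounds p T S0" and T: "T > 0"
    and e: "kernel_sq p (\<lambda>i j. S i j - S0 i j) \<le> e" "2 * T ^ 3 * sqrt e \<le> 1"
  shows "(\<integral>\<^sup>+ x. ennreal (1 / lik_ratio n p S S0 x) \<partial>gauss_sample n p S0) \<le> ennreal (exp (real n * ((T\<^sup>2 / 2 + T ^ 6) * e)))"
proof -
  let ?r = "\<lambda>y. gauss_density p (precision p S0) y / gauss_density p (precision p S) y"
  have r: "0 \<le> ?r y" for y using gauss_density_precision_pos[OF S T, of y] gauss_density_precision_pos[OF S0 T, of y] by simp
  have sm: "2 * T ^ 3 * sqrt (kernel_sq p (\<lambda>i j. S i j - S0 i j)) \<le> 1"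
    by (rule order_trans[OF mult_left_mono e(2)]) (use T e in auto)
  have "(\<integral>\<^sup>+ x. ennreal (1 / lik_ratio n p S S0 x) \<partial>gauss_sample n p S0) = (\<integral>\<^sup>+ x. (\<Prod>m<n. ennreal (?r (x m))) \<partial>gauss_sample n p S0)"
  proof (intro nn_integral_cong)
    fix x
    have "(\<Prod>m<n. ennreal (?r (x m))) = ennreal (\<Prod>m<n. ?r (x m))" by (rule prod_ennreal) (rule r)
    also have "(\<Prod>m<n. ?r (x m)) = 1 / lik_ratio n p S S0 x" by (simp add: lik_ratio_def prod_dividef)
    finally show "ennreal (1 / lik_ratio n p S S0 x) = (\<Prod>m<n. ennreal (?r (x m)))" by simp
  qed
  also have "\<dots> = (\<integral>\<^sup>+ y. ennreal (?r y) \<partial>gauss_law p (precision p S0)) ^ n"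
    by (rule nn_integral_gauss_sample_prod[OF S0 T]) measurable
  also have "\<dots> \<le> ennreal (exp ((T\<^sup>2 / 2 + T ^ 6) * kernel_sq p (\<lambda>i j. S i j - S0 i j))) ^ n"
    using gauss_law_chi_square[OF spectral_bounds_precision[OF S T] spectral_bounds_coercive[OF S T] spectral_bounds_precision[OF S0 T] spectral_bounds_coercive[OF S0 T] sm]
    by (intro power_mono) auto
  also have "\<dots> \<le> ennreal (exp ((T\<^sup>2 / 2 + T ^ 6) * e)) ^ n"
    using T e(1) by (intro power_mono ennreal_leI) (auto intro!: mult_left_mono)
  also have "\<dots> = ennreal (exp (real n * ((T\<^sup>2 / 2 + T ^ 6) * e)))"
    by (simp add: ennreal_power exp_of_nat_mult)
  finally show ?thesis .
qed

lemma lik_ratio_joint_measurable: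
  "(\<lambda>z. lik_ratio n p (entry_kernel (snd z)) S0 (fst z)) \<in> borel_measurable (data_space n p \<Otimes>\<^sub>M entry_space p)"
proof -
  have "(\<lambda>z. gauss_density p (precision p (entry_kernel (snd z))) (fst z m)) \<in> borel_measurable (data_space n p \<Otimes>\<^sub>M entry_space p)" if m: "m < n" for m
  proof -
    have "(\<lambda>z. (snd z, fst z m)) \<in> data_space n p \<Otimes>\<^sub>M entry_space p \<rightarrow>\<^sub>M entry_space p \<Otimes>\<^sub>M leb p"
      by (intro measurable_Pair measurable_snd measurable_compose[OF measurable_fst component_measurable_data_space[OF m]])
    from measurable_compose[OF this gauss_density_precision_measurable] show ?thesis by simp
  qed
  moreover have "(\<lambda>z. gauss_density p (precision p S0) (fst z m)) \<in> borel_measurable (data_space n p \<Otimes>\<^sub>M entry_space p)" if m: "m < n" for m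
    by (intro measurable_compose[OF measurable_compose[OF measurable_fst component_measurable_data_space[OF m]] gauss_density_measurable])
  ultimately show ?thesis unfolding lik_ratio_def by (intro borel_measurable_prod borel_measurable_divide) auto
qed

section \<open>Evidence as a prior integral of likelihood ratios\<close>

locale prior_setup =
  fixes n p :: nat and t lam T :: real and S0 :: "nat \<Rightarrow> nat \<Rightarrow> real"
  assumes t: "t > 0" and lam: "lam > 0" and T: "T \<ge> 1" and S0: "spectral_bounds p T S0"
begin

abbreviation "PU \<equiv> prior_u p t (1/2) (1/2) lam"
abbreviation "P0 \<equiv> gauss_sample n p S0"

lemma T_pos: "T > 0" using T by simp

sublocale PU: prob_space PU by (rule prob_prior_u[OF t lam])
sublocale P0: prob_space P0 by (rule prob_gauss_sample[OF S0 T_pos])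
sublocale PP: pair_sigma_finite P0 PU ..

lemma lik_ratio_joint [measurable]: "(\<lambda>z. lik_ratio n p (entry_kernel (snd z)) S0 (fst z)) \<in> borel_measurable (P0 \<Otimes>\<^sub>M PU)"
  using lik_ratio_joint_measurable by (simp cong: measurable_cong_sets sets_pair_measure_cong)

text \<open>Likelihood relative to the truth, integrated against the unconstrained prior. The
  truncation constant and the true likelihood are left out because they cancel in the
  posterior.\<close>

definition evidence :: "(nat \<times> nat \<Rightarrow> real) set \<Rightarrow> (nat \<Rightarrow> nat \<Rightarrow> real) \<Rightarrow> ennreal" where
  "evidence A x = (\<integral>\<^sup>+ s. indicator A s * ennreal (lik_ratio n p (entry_kernel s) S0 x) \<partial>PU)"

lemma indicator_PU_measurable:
  assumes "A \<inter> space (entry_space p) \<in> sets (entry_space p)"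
  shows "(indicator A :: _ \<Rightarrow> ennreal) \<in> borel_measurable PU"
  using assms by (simp add: borel_measurable_indicator_iff Int_commute cong: measurable_cong_sets)

lemma evidence_integrand_measurable:
  assumes "A \<inter> space (entry_space p) \<in> sets (entry_space p)"
  shows "(\<lambda>z. indicator A (snd z) * ennreal (lik_ratio n p (entry_kernel (snd z)) S0 (fst z))) \<in> borel_measurable (P0 \<Otimes>\<^sub>M PU)"
proof -
  from measurable_compose[OF measurable_snd indicator_PU_measurable[OF assms]]
  have "(\<lambda>z. indicator A (snd z) :: ennreal) \<in> borel_measurable (P0 \<Otimes>\<^sub>M PU)" .
  then show ?thesis by measurable
qed

lemma evidence_measurable:
  assumes "A \<inter> space (entry_space p) \<in> sets (entry_space p)"
  shows "evidence A \<in> borel_measurable P0"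
  using PU.borel_measurable_nn_integral_fst[OF evidence_integrand_measurable[OF assms]]
  unfolding evidence_def[abs_def] by simp

text \<open>After the exchange, the likelihood-ratio bound applies to each fixed \<open>s\<close>
  and is only then averaged over the prior; no supremum over parameters occurs.\<close>

lemma evidence_Fubini:
  assumes "A \<inter> space (entry_space p) \<in> sets (entry_space p)" and f: "f \<in> borel_measurable P0"
  shows "(\<integral>\<^sup>+ x. f x * evidence A x \<partial>P0) = (\<integral>\<^sup>+ s. indicator A s * (\<integral>\<^sup>+ x. f x * ennreal (lik_ratio n p (entry_kernel s) S0 x) \<partial>P0) \<partial>PU)"
proof -
  have lrm: "(\<lambda>x. lik_ratio n p S S0 x) \<in> borel_measurable P0" for S by (simp cong: measurable_cong_sets)
  have lrs: "(\<lambda>s. indicator A s * ennreal (lik_ratio n p (entry_kernel s) S0 x)) \<in> borel_measurable PU" if "x \<in> space P0" for x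
    using measurable_Pair2[OF evidence_integrand_measurable[OF assms(1)] that] by simp
  have "(\<integral>\<^sup>+ x. f x * evidence A x \<partial>P0) = (\<integral>\<^sup>+ x. (\<integral>\<^sup>+ s. f x * (indicator A s * ennreal (lik_ratio n p (entry_kernel s) S0 x)) \<partial>PU) \<partial>P0)"
    unfolding evidence_def using lrs by (intro nn_integral_cong nn_integral_cmult[symmetric])
  also have "\<dots> = (\<integral>\<^sup>+ s. (\<integral>\<^sup>+ x. f x * (indicator A s * ennreal (lik_ratio n p (entry_kernel s) S0 x)) \<partial>P0) \<partial>PU)"
  proof (rule PP.Fubini'[symmetric])
    have "(\<lambda>z. f (fst z) * (indicator A (snd z) * ennreal (lik_ratio n p (entry_kernel (snd z)) S0 (fst z)))) \<in> borel_measurable (P0 \<Otimes>\<^sub>M PU)"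
      by (intro borel_measurable_times_ennreal evidence_integrand_measurable assms measurable_compose[OF measurable_fst f])
    then show "(\<lambda>(x, s). f x * (indicator A s * ennreal (lik_ratio n p (entry_kernel s) S0 x))) \<in> borel_measurable (P0 \<Otimes>\<^sub>M PU)"
      by (simp add: case_prod_unfold)
  qed
  also have "\<dots> = (\<integral>\<^sup>+ s. indicator A s * (\<integral>\<^sup>+ x. f x * ennreal (lik_ratio n p (entry_kernel s) S0 x) \<partial>P0) \<partial>PU)"
    using f lrm by (intro nn_integral_cong)
      (subst nn_integral_cmult[symmetric], auto simp: mult_ac)
  finally show ?thesis .
qed

end

section \<open>Evidence and posterior\<close>

text \<open>Nonnegativity of \<open>(1 - exp k * y)^2 / y\<close>, that is, the tangent bound for
  \<open>1 / y\<close> at \<open>y = exp (- k)\<close>.\<close>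

lemma two_exp_le:
  assumes "y > (0::real)"
  shows "2 * exp k \<le> 1 / y + exp (2 * k) * y"
proof -
  have "0 \<le> (1 - exp k * y)\<^sup>2 / y" using assms by simp
  also have "(1 - exp k * y)\<^sup>2 / y = 1 / y + exp (2 * k) * y - 2 * exp k"
  proof -
    have "exp (2 * k) = exp k * exp k" by (simp add: exp_add[symmetric])
    then show ?thesis using assms by (simp add: power2_eq_square field_simps)
  qed
  finally show ?thesis by simp
qed

context prior_setup
begin

definition inv_evidence :: "(nat \<times> nat \<Rightarrow> real) set \<Rightarrow> (nat \<Rightarrow> nat \<Rightarrow> real) \<Rightarrow> ennreal" where
  "inv_evidence A x = (\<integral>\<^sup>+ s. indicator A s * ennreal (1 / lik_ratio n p (entry_kernel s) S0 x) \<partial>PU)"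

lemma inv_evidence_integrand_measurable:
  assumes "A \<inter> space (entry_space p) \<in> sets (entry_space p)"
  shows "(\<lambda>z. indicator A (snd z) * ennreal (1 / lik_ratio n p (entry_kernel (snd z)) S0 (fst z))) \<in> borel_measurable (P0 \<Otimes>\<^sub>M PU)"
proof -
  from measurable_compose[OF measurable_snd indicator_PU_measurable[OF assms]]
  have "(\<lambda>z. indicator A (snd z) :: ennreal) \<in> borel_measurable (P0 \<Otimes>\<^sub>M PU)" .
  then show ?thesis by measurable
qed

text \<open>Jensen's inequality for \<open>y \<mapsto> 1/y\<close>, in the form \<open>1/y \<ge> 2c - c\<^sup>2 y\<close>, reduces the lower bound on
  the evidence to the chi-square bound.\<close>
proposition evidence_lower:
  assumes A: "A \<inter> space (entry_space p) \<in> sets (entry_space p)"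
    and AS: "\<And>s. s \<in> A \<Longrightarrow> spectral_bounds p T (entry_kernel s) \<and> kernel_sq p (\<lambda>i j. entry_kernel s i j - S0 i j) \<le> e"
    and e: "2 * T ^ 3 * sqrt e \<le> 1"
    and mr: "mr > 0" "ennreal mr \<le> (\<integral>\<^sup>+ s. indicator A s \<partial>PU)"
  shows "emeasure P0 {x \<in> space P0. evidence A x < ennreal (mr * exp (- k))}
    \<le> ennreal (exp (real n * ((T\<^sup>2 / 2 + T ^ 6) * e) - k))"
proof -
  let ?C = "exp (real n * ((T\<^sup>2 / 2 + T ^ 6) * e))"
  have iA: "(indicator A :: _ \<Rightarrow> ennreal) \<in> borel_measurable PU" by (rule indicator_PU_measurable[OF A])
  define m where "m = enn2real (\<integral>\<^sup>+ s. indicator A s \<partial>PU)"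
  have "(\<integral>\<^sup>+ s. indicator A s \<partial>PU) \<le> (\<integral>\<^sup>+ s. 1 \<partial>PU)"
    by (intro nn_integral_mono) (auto split: split_indicator)
  also have "\<dots> = 1" using PU.emeasure_space_1 by simp
  finally have "(\<integral>\<^sup>+ s. indicator A s \<partial>PU) < \<top>" by (simp add: le_less_trans)
  then have m: "(\<integral>\<^sup>+ s. indicator A s \<partial>PU) = ennreal m" by (simp add: m_def)
  have "m \<ge> 0" by (simp add: m_def)
  then have mm: "mr \<le> m" "m > 0" using mr unfolding m by auto
  have ivm: "inv_evidence A \<in> borel_measurable P0"
    using PU.borel_measurable_nn_integral_fst[OF inv_evidence_integrand_measurable[OF A]]
    unfolding inv_evidence_def[abs_def] by simp
  have "(\<integral>\<^sup>+ x. inv_evidence A x \<partial>P0) = (\<integral>\<^sup>+ s. (\<integral>\<^sup>+ x. indicator A s * ennreal (1 / lik_ratio n p (entry_kernel s) S0 x) \<partial>P0) \<partial>PU)"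
    unfolding inv_evidence_def using inv_evidence_integrand_measurable[OF A]
    by (intro PP.Fubini'[symmetric]) (simp add: case_prod_unfold)
  also have "\<dots> \<le> (\<integral>\<^sup>+ s. ennreal ?C * indicator A s \<partial>PU)"
  proof (intro nn_integral_mono)
    fix s
    show "(\<integral>\<^sup>+ x. indicator A s * ennreal (1 / lik_ratio n p (entry_kernel s) S0 x) \<partial>P0) \<le> ennreal ?C * indicator A s"
      using nn_integral_inverse_lik_ratio[OF conjunct1[OF AS] S0 T_pos conjunct2[OF AS] e, of s]
      by (cases "s \<in> A") auto
  qed
  also have "\<dots> = ennreal (?C * m)" using iA m by (simp add: nn_integral_cmult ennreal_mult mm(2) less_imp_le)
  finally have int: "(\<integral>\<^sup>+ x. inv_evidence A x \<partial>P0) \<le> ennreal (?C * m)" .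
  \<comment> \<open>When the evidence is below \<open>m * exp (- k)\<close>,
    \<open>two_exp_le\<close> integrated over \<open>A\<close> forces
    \<open>inv_evidence A x\<close> to be at least \<open>m * exp k\<close>. Markov's inequality
    bounds that event.\<close>
  have "{x \<in> space P0. evidence A x < ennreal (mr * exp (- k))} \<subseteq> {x \<in> space P0. 1 \<le> ennreal (1 / (exp k * m)) * inv_evidence A x}"
  proof safe
    fix x assume x: "x \<in> space P0" and lt: "evidence A x < ennreal (mr * exp (- k))"
    have sl: "(\<lambda>s. indicator A s * ennreal (lik_ratio n p (entry_kernel s) S0 x)) \<in> borel_measurable PU"
      using measurable_Pair2[OF evidence_integrand_measurable[OF A] x] by simp
    have si: "(\<lambda>s. indicator A s * ennreal (1 / lik_ratio n p (entry_kernel s) S0 x)) \<in> borel_measurable PU"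
      using measurable_Pair2[OF inv_evidence_integrand_measurable[OF A] x] by simp
    have "ennreal (2 * exp k) * ennreal m = (\<integral>\<^sup>+ s. ennreal (2 * exp k) * indicator A s \<partial>PU)"
      using iA m by (simp add: nn_integral_cmult)
    also have "\<dots> \<le> (\<integral>\<^sup>+ s. indicator A s * ennreal (1 / lik_ratio n p (entry_kernel s) S0 x) +
        ennreal (exp (2 * k)) * (indicator A s * ennreal (lik_ratio n p (entry_kernel s) S0 x)) \<partial>PU)"
    proof (intro nn_integral_mono)
      fix s
      show "ennreal (2 * exp k) * indicator A s \<le> indicator A s * ennreal (1 / lik_ratio n p (entry_kernel s) S0 x) +
        ennreal (exp (2 * k)) * (indicator A s * ennreal (lik_ratio n p (entry_kernel s) S0 x))"
      proof (cases "s \<in> A")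
        case True
        have y: "lik_ratio n p (entry_kernel s) S0 x > 0" using lik_ratio_pos[OF _ S0 T_pos] AS[OF True] by blast
        have "ennreal (2 * exp k) \<le> ennreal (1 / lik_ratio n p (entry_kernel s) S0 x + exp (2 * k) * lik_ratio n p (entry_kernel s) S0 x)"
          by (intro ennreal_leI two_exp_le y)
        then show ?thesis using True y by (simp add: ennreal_mult)
      qed simp
    qed
    also have "\<dots> = inv_evidence A x + ennreal (exp (2 * k)) * evidence A x"
      unfolding inv_evidence_def evidence_def using sl si by (subst nn_integral_add) (auto simp: nn_integral_cmult)
    also have "\<dots> \<le> inv_evidence A x + ennreal (exp (2 * k)) * ennreal (m * exp (- k))"
    proof (intro add_left_mono mult_left_mono)
      have "ennreal (mr * exp (- k)) \<le> ennreal (m * exp (- k))" using mm by (intro ennreal_leI mult_right_mono) auto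
      then show "evidence A x \<le> ennreal (m * exp (- k))" using lt by simp
    qed simp
    also have "ennreal (exp (2 * k)) * ennreal (m * exp (- k)) = ennreal (exp k * m)"
    proof -
      have "exp (2 * k) * (m * exp (- k)) = exp k * m" by (simp add: exp_add[symmetric])
      then show ?thesis using mm by (simp add: ennreal_mult[symmetric])
    qed
    finally have "ennreal (exp k * m) + ennreal (exp k * m) \<le> inv_evidence A x + ennreal (exp k * m)"
    proof -
      have "ennreal (2 * exp k) * ennreal m = ennreal (exp k * m) + ennreal (exp k * m)"
        using mm by (simp add: ennreal_mult[symmetric] ennreal_plus[symmetric] mult_ac del: ennreal_plus)
      moreover assume "ennreal (2 * exp k) * ennreal m \<le> inv_evidence A x + ennreal (exp k * m)"
      ultimately show ?thesis by simp
    qed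
    then have "ennreal (exp k * m) \<le> inv_evidence A x" by (simp add: ennreal_add_left_cancel_le add.commute)
    then have "ennreal (1 / (exp k * m)) * ennreal (exp k * m) \<le> ennreal (1 / (exp k * m)) * inv_evidence A x"
      by (intro mult_left_mono) auto
    then show "1 \<le> ennreal (1 / (exp k * m)) * inv_evidence A x" using mm by (simp add: ennreal_mult[symmetric])
  qed
  then have "emeasure P0 {x \<in> space P0. evidence A x < ennreal (mr * exp (- k))}
    \<le> emeasure P0 {x \<in> space P0. 1 \<le> ennreal (1 / (exp k * m)) * inv_evidence A x}"
    using ivm by (intro emeasure_mono) auto
  also have "\<dots> \<le> ennreal (1 / (exp k * m)) * (\<integral>\<^sup>+ x. inv_evidence A x * indicator (space P0) x \<partial>P0)"
    using ivm by (intro nn_integral_Markov_inequality) auto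
  also have "(\<integral>\<^sup>+ x. inv_evidence A x * indicator (space P0) x \<partial>P0) = (\<integral>\<^sup>+ x. inv_evidence A x \<partial>P0)"
    by (intro nn_integral_cong) auto
  also have "ennreal (1 / (exp k * m)) * \<dots> \<le> ennreal (1 / (exp k * m)) * ennreal (?C * m)"
    by (intro mult_left_mono int) auto
  also have "\<dots> = ennreal (exp (real n * ((T\<^sup>2 / 2 + T ^ 6) * e) - k))"
    using mm by (simp add: ennreal_mult[symmetric] exp_diff)
  finally show ?thesis .
qed

lemma spectral_bounds_set: "{s. spectral_bounds p \<tau> (entry_kernel s)} \<inter> space (entry_space p) \<in> sets (entry_space p)"
  using spectral_bounds_measurable[of p \<tau>] by (simp add: pred_def Int_def conj_commute)

lemma kernel_sq_entry_kernel_measurable [measurable]: "(\<lambda>s. kernel_sq p (\<lambda>i j. entry_kernel s i j - S0 i j)) \<in> borel_measurable (entry_space p)"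
  unfolding kernel_sq_def by (intro borel_measurable_sum borel_measurable_power borel_measurable_diff entry_kernel_measurable) auto

definition far :: "real \<Rightarrow> real \<Rightarrow> (nat \<times> nat \<Rightarrow> real) set" where
  "far \<tau> v0 = {s. spectral_bounds p \<tau> (entry_kernel s) \<and> v0 \<le> kernel_sq p (\<lambda>i j. entry_kernel s i j - S0 i j)}"

lemma far_set: "far \<tau> v0 \<inter> space (entry_space p) \<in> sets (entry_space p)"
proof -
  have "{s \<in> space (entry_space p). spectral_bounds p \<tau> (entry_kernel s) \<and> v0 \<le> kernel_sq p (\<lambda>i j. entry_kernel s i j - S0 i j)} \<in> sets (entry_space p)"
    by measurable
  then show ?thesis by (simp add: far_def Int_def conj_commute)
qed

lemma frob_sq_eq: "frob_sq (symm_of p s - kernel_mat p S0) = kernel_sq p (\<lambda>i j. entry_kernel s i j - S0 i j)"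
  unfolding symm_of_kernel_mat frob_sq_def kernel_sq_def by (simp add: kernel_mat_def)

text \<open>The posterior is a ratio of two evidences: the true likelihood and the truncation
  constant form a common factor \<open>q\<close> of numerator and denominator.\<close>

proposition posterior_le:
  assumes p: "p > 0" and tau: "\<tau> > 0" "\<tau> \<le> T" and eps: "\<epsilon> > 0" and b: "b > 0"
    and x: "x \<in> space P0" and N: "evidence (far \<tau> v0) x \<le> ennreal (\<epsilon> * b)" and D: "ennreal b \<le> evidence {s. spectral_bounds p \<tau> (entry_kernel s)} x"
  shows "posterior (prior p t (1/2) (1/2) lam \<tau>) n p {S. frob_sq (S - kernel_mat p S0) \<ge> v0} x \<le> \<epsilon>"
proof -
  define UU where "UU = {s. spectral_bounds p \<tau> (entry_kernel s)}"
  have UUs: "{s. symm_of p s \<in> U_set p \<tau>} = UU"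
    unfolding UU_def symm_of_kernel_mat using U_set_kernel_mat_iff[OF p tau(1)] by simp
  define Z where "Z = emeasure PU {s \<in> space PU. symm_of p s \<in> U_set p \<tau>}"
  have pr: "prior p t (1/2) (1/2) lam \<tau> = density PU (\<lambda>s. indicator UU s / Z)"
    unfolding prior_def UUs Z_def by simp
  have UUm: "(indicator UU :: _ \<Rightarrow> ennreal) \<in> borel_measurable PU"
    unfolding UU_def by (rule indicator_PU_measurable[OF spectral_bounds_set])
  have dm: "(\<lambda>s. indicator UU s / Z :: ennreal) \<in> borel_measurable PU"
    using UUm by measurable
  define L0 where "L0 = (\<Prod>i<n. gauss_density p (precision p S0) (x i))"
  have L0: "L0 > 0" unfolding L0_def using gauss_density_precision_pos[OF S0 T_pos] by (intro prod_pos) auto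
  have Lk: "likelihood n p s x = L0 * lik_ratio n p (entry_kernel s) S0 x" if "s \<in> UU" for s
  proof -
    have S: "spectral_bounds p T (entry_kernel s)" using that tau spectral_bounds_mono unfolding UU_def by blast
    have "likelihood n p s x = (\<Prod>i<n. gauss_density p (precision p (entry_kernel s)) (x i))"
      unfolding likelihood_def symm_of_kernel_mat mvn_density_eq[OF spectral_bounds_coercive[OF S T_pos]] ..
    then show ?thesis
      unfolding L0_def lik_ratio_def prod.distrib[symmetric] using gauss_density_precision_pos[OF S0 T_pos]
      by (simp add: less_imp_neq[THEN not_sym])
  qed
  \<comment> \<open>Only positivity of \<open>q\<close> enters: the quotient is bounded by
    multiplying out rather than by cancelling, which in \<open>ennreal\<close> would also call for
    finiteness.\<close>
  define q where "q = ennreal L0 / Z"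
  have "Z \<le> 1" unfolding Z_def by (rule PU.emeasure_le_1)
  then have q: "q > 0" using L0 by (auto simp: q_def ennreal_zero_less_divide less_top[symmetric] top_unique)
  have I: "(\<integral>\<^sup>+ s. indicator BB s * ennreal (likelihood n p s x) \<partial>prior p t (1/2) (1/2) lam \<tau>) = q * evidence (UU \<inter> BB) x"
    if B: "UU \<inter> BB \<inter> space (entry_space p) \<in> sets (entry_space p)" for BB
  proof -
    have lm: "(\<lambda>s. indicator (UU \<inter> BB) s * ennreal (lik_ratio n p (entry_kernel s) S0 x)) \<in> borel_measurable PU"
      using measurable_Pair2[OF evidence_integrand_measurable[OF B] x] by simp
    have "(\<integral>\<^sup>+ s. indicator BB s * ennreal (likelihood n p s x) \<partial>prior p t (1/2) (1/2) lam \<tau>)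
      = (\<integral>\<^sup>+ s. ennreal L0 * (indicator (UU \<inter> BB) s * ennreal (lik_ratio n p (entry_kernel s) S0 x)) \<partial>density PU (\<lambda>s. indicator UU s / Z))"
      unfolding pr
    \<comment> \<open>The density of the prior restricts to \<open>UU\<close>, the set on which the
      likelihood has been rewritten.\<close>
    proof (rule nn_integral_cong_AE, subst AE_density[OF dm], intro AE_I2 impI)
      fix s assume "0 < indicator UU s / Z"
      then have s: "s \<in> UU" by (auto split: split_indicator_asm)
      then show "indicator BB s * ennreal (likelihood n p s x) = ennreal L0 * (indicator (UU \<inter> BB) s * ennreal (lik_ratio n p (entry_kernel s) S0 x))"
        using L0 by (auto simp: Lk[OF s] ennreal_mult' split: split_indicator)
    qed
    also have "\<dots> = (\<integral>\<^sup>+ s. (indicator UU s / Z) * (ennreal L0 * (indicator (UU \<inter> BB) s * ennreal (lik_ratio n p (entry_kernel s) S0 x))) \<partial>PU)"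
      using lm by (intro nn_integral_density dm) simp
    also have "\<dots> = (\<integral>\<^sup>+ s. q * (indicator (UU \<inter> BB) s * ennreal (lik_ratio n p (entry_kernel s) S0 x)) \<partial>PU)"
      by (intro nn_integral_cong) (auto simp: q_def divide_ennreal_def mult_ac split: split_indicator)
    also have "\<dots> = q * evidence (UU \<inter> BB) x" unfolding evidence_def by (rule nn_integral_cmult[OF lm])
    finally show ?thesis .
  qed
  define BB where "BB = {s. symm_of p s \<in> {S. frob_sq (S - kernel_mat p S0) \<ge> v0}}"
  have BBe: "UU \<inter> BB = far \<tau> v0" by (auto simp: UU_def BB_def far_def frob_sq_eq)
  have num: "(\<integral>\<^sup>+ s. indicator BB s * ennreal (likelihood n p s x) \<partial>prior p t (1/2) (1/2) lam \<tau>) = q * evidence (far \<tau> v0) x"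
    using I[of BB] far_set unfolding BBe by simp
  have den: "(\<integral>\<^sup>+ s. ennreal (likelihood n p s x) \<partial>prior p t (1/2) (1/2) lam \<tau>) = q * evidence UU x"
    using I[of UNIV] spectral_bounds_set[of \<tau>] unfolding UU_def by simp
  have "evidence (far \<tau> v0) x \<le> ennreal \<epsilon> * ennreal b" using N eps b by (simp add: ennreal_mult)
  also have "\<dots> \<le> ennreal \<epsilon> * evidence UU x" using D unfolding UU_def by (intro mult_left_mono) auto
  finally have "q * evidence (far \<tau> v0) x \<le> q * (ennreal \<epsilon> * evidence UU x)" by (intro mult_left_mono) auto
  then have le: "q * evidence (far \<tau> v0) x \<le> (q * evidence UU x) * ennreal \<epsilon>" by (simp add: mult_ac)
  have "0 < evidence UU x" using D b unfolding UU_def by (meson ennreal_less_zero_iff less_le_trans)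
  then have "0 < q * evidence UU x" using q by (simp add: ennreal_zero_less_mult_iff)
  then have "(q * evidence (far \<tau> v0) x) / (q * evidence UU x) \<le> ennreal \<epsilon>" using le by (rule divide_le_posI_ennreal)
  then show ?thesis unfolding posterior_def BB_def[symmetric] num den using eps by (intro enn2real_leI) auto
qed

end

section \<open>A box around the shrunk true covariance\<close>

lemma kernel_sq_add_le: "kernel_sq p (\<lambda>i j. A i j + B i j) \<le> 2 * kernel_sq p A + 2 * kernel_sq p B"
proof -
  have "(a + b)\<^sup>2 \<le> 2 * a\<^sup>2 + 2 * b\<^sup>2" for a b :: real
    using sum_squares_bound[of a b] by (simp add: power2_sum)
  then have "kernel_sq p (\<lambda>i j. A i j + B i j) \<le> (\<Sum>i<p. \<Sum>j<p. 2 * (A i j)\<^sup>2 + 2 * (B i j)\<^sup>2)"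
    unfolding kernel_sq_def by (intro sum_mono)
  then show ?thesis by (simp add: kernel_sq_def sum.distrib sum_distrib_left)
qed

lemma kernel_sq_le_entries:
  assumes "\<And>i j. i < p \<Longrightarrow> j < p \<Longrightarrow> \<bar>A i j\<bar> \<le> r" "r \<ge> 0"
  shows "kernel_sq p A \<le> (real p * r)\<^sup>2"
proof -
  have "kernel_sq p A \<le> (\<Sum>i<p. \<Sum>j<p. r\<^sup>2)"
    unfolding kernel_sq_def using assms by (intro sum_mono) (simp add: abs_le_square_iff[symmetric])
  then show ?thesis by (simp add: power2_eq_square mult_ac)
qed

lemma spectral_bounds_kernel_app:
  assumes S: "spectral_bounds p T S" and T: "T > 0"
  shows "norm_sq p (kernel_app p S v) \<le> T\<^sup>2 * norm_sq p v"
proof -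
  have psd: "0 \<le> quad_form p S x" for x
  proof -
    have "0 \<le> norm_sq p x / T" using T by simp
    also have "\<dots> \<le> quad_form p S x" using S by (auto simp: spectral_bounds_def)
    finally show ?thesis .
  qed
  have "norm_sq p (kernel_app p S v) \<le> T * quad_form p S v"
    using S by (intro psd_kernel_app_bound psd T) (auto simp: spectral_bounds_def)
  also have "\<dots> \<le> T * (T * norm_sq p v)" using S T by (intro mult_left_mono) (auto simp: spectral_bounds_def)
  finally show ?thesis by (simp add: power2_eq_square)
qed

definition id_kernel :: "nat \<Rightarrow> nat \<Rightarrow> real" where
  "id_kernel i j = (if i = j then 1 else 0)"

lemma norm_sq_id_kernel: "i < p \<Longrightarrow> norm_sq p (id_kernel i) = 1"
  by (simp add: norm_sq_def id_kernel_def if_distrib[of "\<lambda>z. z\<^sup>2"] cong: if_cong)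

lemma kernel_sq_id_kernel: "kernel_sq p id_kernel = real p"
  by (simp add: kernel_sq_rows norm_sq_id_kernel)

lemma quad_form_id_kernel: "quad_form p id_kernel x = norm_sq p x"
  by (simp add: quad_form_def norm_sq_def id_kernel_def power2_eq_square if_distrib[of "\<lambda>z. _ * z"] if_distrib[of "\<lambda>z. z * _"] cong: if_cong)

lemma kernel_app_id_kernel: "i < p \<Longrightarrow> kernel_app p S (id_kernel i) j = S j i"
  by (simp add: kernel_app_def id_kernel_def if_distrib[of "\<lambda>z. _ * z"] cong: if_cong)

text \<open>The columns of \<open>S\<close> are the images of the unit vectors, and the identity has
  squared Frobenius norm \<open>p\<close>.\<close>

lemma spectral_bounds_kernel_sq:
  assumes S: "spectral_bounds p T S" and T: "T > 0"
  shows "kernel_sq p S \<le> T\<^sup>2 * real p"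
proof -
  have "kernel_sq p S = kernel_sq p (\<lambda>i. kernel_app p S (id_kernel i))"
  proof -
    have "kernel_sq p (\<lambda>i. kernel_app p S (id_kernel i)) = (\<Sum>i<p. norm_sq p (\<lambda>k. S k i))"
      unfolding kernel_sq_rows norm_sq_def by (intro sum.cong refl) (simp add: kernel_app_id_kernel)
    then show ?thesis by (simp add: kernel_sq_cols)
  qed
  also have "\<dots> \<le> T\<^sup>2 * kernel_sq p id_kernel" by (rule kernel_sq_kernel_app_right) (rule spectral_bounds_kernel_app[OF S T])
  finally show ?thesis by (simp add: kernel_sq_id_kernel)
qed

lemma spectral_bounds_entry:
  assumes S: "spectral_bounds p T S" and T: "T > 0" and ij: "i < p" "j < p"
  shows "\<bar>S i j\<bar> \<le> T"
proof -
  have "(S i j)\<^sup>2 \<le> norm_sq p (kernel_app p S (id_kernel j))"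
    unfolding norm_sq_def kernel_app_id_kernel[OF ij(2)] using ij(1) by (intro member_le_sum) auto
  also have "\<dots> \<le> T\<^sup>2" using spectral_bounds_kernel_app[OF S T, of "id_kernel j"] by (simp add: norm_sq_id_kernel[OF ij(2)])
  finally show ?thesis using T by (simp add: abs_le_square_iff[symmetric])
qed

text \<open>\<open>S0\<close> may have \<open>\<tau>\<close> or \<open>1/\<tau>\<close> as an eigenvalue; shrinking it slightly towards the identity makes room
  for a box inside the constraint set.\<close>
definition shrunk_center :: "real \<Rightarrow> (nat \<Rightarrow> nat \<Rightarrow> real) \<Rightarrow> nat \<times> nat \<Rightarrow> real" where
  "shrunk_center h S0 z = (1 - h) * S0 (fst z) (snd z) + h * id_kernel (fst z) (snd z)"

definition coord_box :: "nat \<Rightarrow> (nat \<times> nat \<Rightarrow> real) \<Rightarrow> real \<Rightarrow> (nat \<times> nat \<Rightarrow> real) set" where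
  "coord_box p c r = {s. \<forall>z\<in>tri p. s z \<in> {c z - r..c z + r}}"

text \<open>Since \<open>\<tau> \<ge> 3\<close>, mixing in a fraction \<open>h\<close> of the
  identity moves the form inwards by at least \<open>h / 2\<close> at both ends, which covers the
  box error \<open>E\<close> of Frobenius norm at most \<open>h / 2\<close>. In
  \<open>5 + 4 * \<tau>^2\<close>, the error \<open>E\<close> accounts for \<open>1\<close> and the
  shift \<open>h * (1 - S0)\<close> for \<open>4 + 4 * \<tau>^2\<close>.\<close>

lemma coord_box_spectral_bounds:
  assumes S0: "spectral_bounds p \<tau> S0" and tau: "\<tau> \<ge> 3" and h: "0 < h" "h \<le> 1"
    and p: "p > 0" and s: "s \<in> coord_box p (shrunk_center h S0) (h / (2 * real p))"
  shows "spectral_bounds p \<tau> (entry_kernel s)" "kernel_sq p (\<lambda>i j. entry_kernel s i j - S0 i j) \<le> h\<^sup>2 * (real p * (5 + 4 * \<tau>\<^sup>2))"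
proof -
  let ?r = "h / (2 * real p)"
  define E where "E i j = entry_kernel s i j - shrunk_center h S0 (i,j)" for i j
  have sym: "S0 i j = S0 j i" if "i < p" "j < p" for i j using S0 that by (auto simp: spectral_bounds_def sym_kernel_def)
  have E: "\<bar>E i j\<bar> \<le> ?r" if ij: "i < p" "j < p" for i j
  proof (cases "i \<le> j")
    case True
    then have "(i,j) \<in> tri p" using ij by (simp add: tri_def)
    then have "s (i,j) \<in> {shrunk_center h S0 (i,j) - ?r..shrunk_center h S0 (i,j) + ?r}" using s unfolding coord_box_def by blast
    then show ?thesis using True by (auto simp: E_def entry_kernel_def)
  next
    case False
    then have "(j,i) \<in> tri p" using ij by (simp add: tri_def)
    then have "s (j,i) \<in> {shrunk_center h S0 (j,i) - ?r..shrunk_center h S0 (j,i) + ?r}" using s unfolding coord_box_def by blast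
    moreover have "shrunk_center h S0 (j,i) = shrunk_center h S0 (i,j)" using sym[OF ij] by (simp add: shrunk_center_def id_kernel_def)
    ultimately show ?thesis using False by (auto simp: E_def entry_kernel_def)
  qed
  have r: "0 \<le> ?r" using h p by simp
  have pr: "real p * ?r = h / 2" using p by simp
  have "kernel_sq p E \<le> (real p * ?r)\<^sup>2" by (rule kernel_sq_le_entries) (use E r in auto)
  then have fE: "kernel_sq p E \<le> (h / 2)\<^sup>2" by (simp only: pr)
  have qE: "\<bar>quad_form p E x\<bar> \<le> h / 2 * norm_sq p x" for x
  proof -
    have "sqrt (kernel_sq p E) \<le> h / 2" using real_sqrt_le_mono[OF fE] h by simp
    then show ?thesis using quad_form_le_kernel_sq[of p E x] mult_right_mono[of "sqrt (kernel_sq p E)" "h / 2" "norm_sq p x"] by simp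
  qed
  have q: "quad_form p (entry_kernel s) x = (1 - h) * quad_form p S0 x + h * norm_sq p x + quad_form p E x" for x
  proof -
    have "(1 - h) * quad_form p S0 x + h * norm_sq p x + quad_form p E x
        = (\<Sum>i<p. \<Sum>j<p. (1 - h) * (x i * S0 i j * x j) + h * (x i * id_kernel i j * x j) + x i * E i j * x j)"
      unfolding quad_form_id_kernel[symmetric] quad_form_def by (simp add: sum.distrib sum_distrib_left)
    also have "\<dots> = quad_form p (entry_kernel s) x" unfolding quad_form_def
      by (intro sum.cong refl) (simp add: E_def shrunk_center_def algebra_simps)
    finally show ?thesis ..
  qed
  have "norm_sq p x / \<tau> \<le> quad_form p (entry_kernel s) x \<and> quad_form p (entry_kernel s) x \<le> \<tau> * norm_sq p x" for x
  proof
    let ?n = "norm_sq p x"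
    have b: "?n / \<tau> \<le> quad_form p S0 x" "quad_form p S0 x \<le> \<tau> * ?n" using S0 by (auto simp: spectral_bounds_def)
    have "(1 - h) * (?n / \<tau>) \<le> (1 - h) * quad_form p S0 x" using h b by (intro mult_left_mono) auto
    moreover have "h * (?n / \<tau>) \<le> h * (?n / 2)"
      using h tau by (intro mult_left_mono divide_left_mono) auto
    moreover have "(1 - h) * (?n / \<tau>) = ?n / \<tau> - h * (?n / \<tau>)" by (simp only: left_diff_distrib mult_1)
    moreover have "h * (?n / 2) = h * ?n - h / 2 * ?n" by simp
    moreover have "- (h / 2 * ?n) \<le> quad_form p E x" using qE[of x] by linarith
    ultimately show "?n / \<tau> \<le> quad_form p (entry_kernel s) x"
      unfolding q by linarith
    have "(1 - h) * quad_form p S0 x \<le> (1 - h) * (\<tau> * ?n)" using h b by (intro mult_left_mono) auto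
    moreover have "h * (3 * ?n) \<le> h * (\<tau> * ?n)"
      using h tau by (intro mult_left_mono mult_right_mono) auto
    moreover have "0 \<le> h * ?n" using h by simp
    ultimately show "quad_form p (entry_kernel s) x \<le> \<tau> * ?n"
      using qE[of x] unfolding q by (simp add: algebra_simps abs_le_iff)
  qed
  then show "spectral_bounds p \<tau> (entry_kernel s)" by (simp add: spectral_bounds_def)
  have "kernel_sq p (\<lambda>i j. entry_kernel s i j - S0 i j) = kernel_sq p (\<lambda>i j. E i j + h * (id_kernel i j + (-1) * S0 i j))"
    unfolding kernel_sq_def by (intro sum.cong refl) (simp add: E_def shrunk_center_def algebra_simps)
  also have "\<dots> \<le> 2 * kernel_sq p E + 2 * kernel_sq p (\<lambda>i j. h * (id_kernel i j + (-1) * S0 i j))" by (rule kernel_sq_add_le)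
  finally have total: "kernel_sq p (\<lambda>i j. entry_kernel s i j - S0 i j) \<le> 2 * kernel_sq p E + 2 * kernel_sq p (\<lambda>i j. h * (id_kernel i j + (-1) * S0 i j))" .
  have "kernel_sq p (\<lambda>i j. id_kernel i j + (-1) * S0 i j) \<le> 2 * real p + 2 * (\<tau>\<^sup>2 * real p)"
    using kernel_sq_add_le[of p id_kernel "\<lambda>i j. (-1) * S0 i j"] spectral_bounds_kernel_sq[OF S0] tau unfolding kernel_sq_scale kernel_sq_id_kernel by simp
  then have "h\<^sup>2 * kernel_sq p (\<lambda>i j. id_kernel i j + (-1) * S0 i j) \<le> h\<^sup>2 * (2 * real p + 2 * (\<tau>\<^sup>2 * real p))"
    by (intro mult_left_mono) auto
  then have "kernel_sq p (\<lambda>i j. h * (id_kernel i j + (-1) * S0 i j)) \<le> h\<^sup>2 * (2 * real p + 2 * (\<tau>\<^sup>2 * real p))"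
    unfolding kernel_sq_scale .
  moreover have "2 * kernel_sq p E \<le> h\<^sup>2 * real p"
  proof -
    have "2 * kernel_sq p E \<le> h\<^sup>2 / 2" using fE by (simp add: power_divide)
    also have "\<dots> \<le> h\<^sup>2 * 1" by simp
    also have "\<dots> \<le> h\<^sup>2 * real p" using p by (intro mult_left_mono) auto
    finally show ?thesis .
  qed
  ultimately show "kernel_sq p (\<lambda>i j. entry_kernel s i j - S0 i j) \<le> h\<^sup>2 * (real p * (5 + 4 * \<tau>\<^sup>2))"
    using total by (simp add: algebra_simps)
qed

lemma coord_box_set: "coord_box p c r \<inter> space (entry_space p) \<in> sets (entry_space p)"
proof -
  have "{s \<in> space (entry_space p). \<forall>z\<in>tri p. s z \<in> {c z - r..c z + r}} \<in> sets (entry_space p)"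
    by (rule sets.sets_Collect_finite_All) auto
  then show ?thesis by (simp add: coord_box_def Int_def conj_commute)
qed

lemma good_samples_set: "{x \<in> space (data_space n p). x \<in> good_samples n p S0 a} \<in> sets (data_space n p)"
proof -
  have eq: "{x \<in> space (data_space n p). x \<in> good_samples n p S0 a} =
     {x \<in> space (data_space n p). \<forall>i\<in>{..<p}. \<forall>j\<in>{..<p}. \<bar>scatter n x i j - real n * S0 i j\<bar> \<le> real n * a}"
    by (auto simp: good_samples_def)
  show ?thesis unfolding eq
  proof (intro sets.sets_Collect_finite_All finite_lessThan)
    fix i j assume "i \<in> {..<p}" "j \<in> {..<p}"
    then have [measurable]: "(\<lambda>x. scatter n x i j) \<in> borel_measurable (data_space n p)" by (intro scatter_measurable) auto
    show "{x \<in> space (data_space n p). \<bar>scatter n x i j - real n * S0 i j\<bar> \<le> real n * a} \<in> sets (data_space n p)" by measurable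
  qed
qed

section \<open>The numerator of the posterior\<close>

context prior_setup
begin

text \<open>The trivial tilt \<open>D = 0\<close> with margin \<open>b = 0\<close>.\<close>

lemma lik_ratio_total:
  assumes "spectral_bounds p T S"
  shows "(\<integral>\<^sup>+ x. ennreal (lik_ratio n p S S0 x) \<partial>P0) \<le> 1"
proof -
  have "(\<integral>\<^sup>+ x. indicator UNIV x * ennreal (lik_ratio n p S S0 x) \<partial>P0)
    \<le> ennreal (exp (- (real n * (0 - 4 * T\<^sup>2 * kernel_sq p (\<lambda>_ _. 0)))))"
    by (rule lik_ratio_tilt_bound[OF assms S0 T_pos]) (auto simp: sym_kernel_def kernel_sq_def kernel_inner_def quad_form_def)
  then show ?thesis by (simp add: kernel_sq_def)
qed

text \<open>Far matrices are split by their number of large entries. With fewer than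
  \<open>k\<close>, the active set is small enough for testing at level \<open>v\<close>, the
  neglected entries accounting for \<open>(p * d)^2\<close>. With at least \<open>k\<close>, the
  likelihood ratio integrates to at most one and the prior supplies the factor
  \<open>1 / w ^ k\<close>.\<close>

proposition numerator_bound:
  assumes tau: "\<tau> > 0" "\<tau> \<le> T" and d: "d > 0" and w: "w \<ge> 1"
    and a: "0 \<le> a" "a * sqrt (real (p + num_offsupp p S0 + 2 * k)) \<le> sqrt v / 2"
    and v: "0 < v" "v \<le> 1" "v + (real p * d)\<^sup>2 \<le> v0"
  shows "(\<integral>\<^sup>+ x. indicator (good_samples n p S0 a) x * evidence (far \<tau> v0) x \<partial>P0)
    \<le> ennreal ((lam / 2) ^ p * (\<tau> ^ p * exp (w * (4 * density_const * t / d) * real p ^ 2)) *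
        (exp (- (real n * v / (64 * T\<^sup>2))) + 1 / w ^ k))"
proof -
  let ?e1 = "exp (- (real n * v / (64 * T\<^sup>2)))"
  define W where "W = (lam / 2) ^ p * (\<tau> ^ p * exp (w * (4 * density_const * t / d) * real p ^ 2))"
  have W: "W \<ge> 0" using lam tau by (simp add: W_def)
  \<comment> \<open>\<open>?A 0\<close> is the whole constraint set. Its mass is also bounded by
    \<open>W\<close>, so that both parts carry the factor \<open>(lam / 2) ^ p\<close>.\<close>
  let ?A = "\<lambda>j. {s. spectral_bounds p \<tau> (entry_kernel s) \<and> j \<le> num_large p d s}"
  have nlm: "Measurable.pred (entry_space p) (\<lambda>s. j \<le> num_large p d s)" for j
  proof -
    have "real (num_large p d s) = (\<Sum>z\<in>tri p. if fst z \<noteq> snd z \<and> d < \<bar>s z\<bar> then 1 else 0)" for s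
      unfolding num_large_def by (simp add: sum.If_cases Int_def)
    moreover have "(\<lambda>s. \<Sum>z\<in>tri p. if fst z \<noteq> snd z \<and> d < \<bar>s z\<bar> then 1 else (0::real)) \<in> borel_measurable (entry_space p)"
      by measurable
    ultimately have [measurable]: "(\<lambda>s. real (num_large p d s)) \<in> borel_measurable (entry_space p)" by simp
    have "Measurable.pred (entry_space p) (\<lambda>s. real j \<le> real (num_large p d s))" by measurable
    then show ?thesis by simp
  qed
  have Am: "(indicator (?A j) :: _ \<Rightarrow> ennreal) \<in> borel_measurable PU" for j
  proof (rule indicator_PU_measurable)
    have "Measurable.pred (entry_space p) (\<lambda>s. spectral_bounds p \<tau> (entry_kernel s) \<and> j \<le> num_large p d s)"
      using spectral_bounds_measurable nlm by (intro pred_intros_logic)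
    then show "?A j \<inter> space (entry_space p) \<in> sets (entry_space p)" by (simp add: pred_def Int_def conj_commute)
  qed
  have Gm: "(indicator (good_samples n p S0 a) :: _ \<Rightarrow> ennreal) \<in> borel_measurable P0"
    using good_samples_set[of n p S0 a] by (simp add: borel_measurable_indicator_iff Int_def conj_commute cong: measurable_cong_sets)
  have "(\<integral>\<^sup>+ x. indicator (good_samples n p S0 a) x * evidence (far \<tau> v0) x \<partial>P0)
    = (\<integral>\<^sup>+ s. indicator (far \<tau> v0) s * (\<integral>\<^sup>+ x. indicator (good_samples n p S0 a) x * ennreal (lik_ratio n p (entry_kernel s) S0 x) \<partial>P0) \<partial>PU)"
    by (rule evidence_Fubini[OF far_set Gm])
  also have "\<dots> \<le> (\<integral>\<^sup>+ s. ennreal ?e1 * indicator (?A 0) s + indicator (?A k) s \<partial>PU)"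
  proof (intro nn_integral_mono)
    fix s
    let ?I = "\<integral>\<^sup>+ x. indicator (good_samples n p S0 a) x * ennreal (lik_ratio n p (entry_kernel s) S0 x) \<partial>P0"
    show "indicator (far \<tau> v0) s * ?I \<le> ennreal ?e1 * indicator (?A 0) s + indicator (?A k) s"
    proof (cases "s \<in> far \<tau> v0")
      case True
      then have s: "spectral_bounds p \<tau> (entry_kernel s)" "v0 \<le> kernel_sq p (\<lambda>i j. entry_kernel s i j - S0 i j)" by (auto simp: far_def)
      have sT: "spectral_bounds p T (entry_kernel s)" by (rule spectral_bounds_mono[OF s(1) tau])
      show ?thesis
      proof (cases "k \<le> num_large p d s")
        case k: True
        have "?I \<le> (\<integral>\<^sup>+ x. ennreal (lik_ratio n p (entry_kernel s) S0 x) \<partial>P0)"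
          by (intro nn_integral_mono) (auto split: split_indicator)
        also have "\<dots> \<le> 1" by (rule lik_ratio_total[OF sT])
        finally show ?thesis using True k s by (simp add: add_increasing)
      next
        case False
        let ?K = "active_entries p d (entry_kernel s) S0"
        have K: "?K \<subseteq> {..<p} \<times> {..<p}" by (auto simp: active_entries_def)
        have Ks: "(j,i) \<in> ?K" if "(i,j) \<in> ?K" for i j
          using that S0 by (auto simp: active_entries_def spectral_bounds_def sym_kernel_def entry_kernel_def split: if_splits)
        have "card ?K \<le> p + num_offsupp p S0 + 2 * k" using card_active_entries[of p d s S0] False by linarith
        then have "a * sqrt (real (card ?K)) \<le> a * sqrt (real (p + num_offsupp p S0 + 2 * k))"
          using a by (intro mult_left_mono real_sqrt_le_mono) (auto simp only: of_nat_le_iff)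
        then have aK: "a * sqrt (real (card ?K)) \<le> sqrt v / 2" using a by linarith
        have "v \<le> kernel_sq p (threshold ?K (\<lambda>i j. entry_kernel s i j - S0 i j))"
          using kernel_sq_active_entries[of d p "entry_kernel s" S0] d v s by linarith
        then have "?I \<le> ennreal ?e1"
          by (intro lik_ratio_on_good_samples[OF sT S0 T K Ks v(1,2) _ a(1) aK])
        then show ?thesis using True s by (simp add: add_increasing2)
      qed
    qed simp
  qed
  also have "\<dots> = ennreal ?e1 * (\<integral>\<^sup>+ s. indicator (?A 0) s \<partial>PU) + (\<integral>\<^sup>+ s. indicator (?A k) s \<partial>PU)"
    using Am by (subst nn_integral_add) (auto simp: nn_integral_cmult)
  also have "\<dots> \<le> ennreal ?e1 * ennreal W + ennreal (W / w ^ k)"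
  proof (intro add_mono mult_left_mono)
    show "(\<integral>\<^sup>+ s. indicator (?A 0) s \<partial>PU) \<le> ennreal W"
      using prior_tail_mass[OF t lam d w tau(1), where k=0 and p=p] by (simp add: W_def)
    have wk: "w ^ k > 0" using w by simp
    have "ennreal (w ^ k) * (\<integral>\<^sup>+ s. indicator (?A k) s \<partial>PU) \<le> ennreal W"
      using prior_tail_mass[OF t lam d w tau(1), where k=k and p=p] Am
      by (simp add: W_def nn_integral_cmult)
    then have "ennreal (1 / w ^ k) * (ennreal (w ^ k) * (\<integral>\<^sup>+ s. indicator (?A k) s \<partial>PU)) \<le> ennreal (1 / w ^ k) * ennreal W"
      by (rule mult_left_mono) simp
    moreover have "ennreal (1 / w ^ k) * (ennreal (w ^ k) * (\<integral>\<^sup>+ s. indicator (?A k) s \<partial>PU)) = (\<integral>\<^sup>+ s. indicator (?A k) s \<partial>PU)"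
    proof -
      have "ennreal (1 / w ^ k) * ennreal (w ^ k) = 1" using wk w by (simp add: ennreal_mult[symmetric])
      then show ?thesis by (simp only: mult.assoc[symmetric] mult_1)
    qed
    moreover have "ennreal (1 / w ^ k) * ennreal W = ennreal (W / w ^ k)"
      using wk W by (simp add: ennreal_mult[symmetric])
    ultimately show "(\<integral>\<^sup>+ s. indicator (?A k) s \<partial>PU) \<le> ennreal (W / w ^ k)" by simp
  qed simp
  also have "\<dots> = ennreal (W * (?e1 + 1 / w ^ k))"
    using W w by (simp add: ennreal_mult[symmetric] ennreal_plus[symmetric] algebra_simps del: ennreal_plus)
  finally show ?thesis unfolding W_def .
qed

end

section \<open>Posterior bound at one sample size\<close>

definition evidence_const :: "real \<Rightarrow> real" where
  "evidence_const T = (T\<^sup>2 / 2 + T ^ 6) * (5 + 4 * T\<^sup>2)"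

lemma evidence_const_nonneg: "T > 0 \<Longrightarrow> evidence_const T \<ge> 0"
  by (simp add: evidence_const_def)

context prior_setup
begin

lemma evidence_mono: "A \<subseteq> B \<Longrightarrow> evidence A x \<le> evidence B x"
  unfolding evidence_def by (intro nn_integral_mono mult_right_mono) (auto split: split_indicator)

text \<open>Shrinking towards the identity creates no new nonzero entry off the diagonal.\<close>

lemma offsupp_shrunk_center: "card (offsupp p (shrunk_center h S0)) \<le> num_offsupp p S0"
proof -
  have "offsupp p (shrunk_center h S0) \<subseteq> {z \<in> {..<p} \<times> {..<p}. fst z \<noteq> snd z \<and> S0 (fst z) (snd z) \<noteq> 0}"
    by (auto simp: offsupp_def tri_def shrunk_center_def id_kernel_def)
  then show ?thesis unfolding num_offsupp_def by (intro card_mono) auto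
qed

text \<open>Apart from \<open>lam / 2\<close>, diagonal and nonzero entries cost at most a factor
  \<open>p powr (- C)\<close> each, and all zero entries together \<open>exp (- C * p)\<close>. As
  \<open>p \<le> (p + s0) * ln p\<close>, the exponents add up to at most
  \<open>2 * C * (p + s0) * ln p\<close>.\<close>

lemma box_mass:
  assumes p: "1 \<le> ln (real p)" and h: "0 < h" "h \<le> 1" and r: "r = h / (2 * real p)"
    and off: "num_offsupp p S0 \<le> s0" and L: "lam \<le> L" and C: "C \<ge> 0"
    and c1: "exp (- (C * ln (real p))) \<le> 2 * r * exp (- (L * (T + 1) / 2))"
    and c2: "exp (- (C * ln (real p))) \<le> 2 * r * (density_const * t / (2 * t\<^sup>2 + (T + 1)\<^sup>2))"
      "2 * r * (density_const * t / (2 * t\<^sup>2 + (T + 1)\<^sup>2)) \<le> 1"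
    and c3: "8 * density_const * t / r \<le> 1" "8 * density_const * t / r * real p ^ 2 \<le> C * real p"
  shows "ennreal ((lam / 2) ^ p * exp (- (2 * C * (real (p + s0) * ln (real p)))))
    \<le> (\<integral>\<^sup>+ s. indicator (coord_box p (shrunk_center h S0) r) s \<partial>PU)"
proof -
  have p0: "p > 0" using p by (cases "p = 0") auto
  have p1: "1 \<le> real p" using p0 by simp
  have "h * 1 \<le> h * (2 * real p)" using h p1 by (intro mult_left_mono) auto
  then have r0: "r > 0" "r \<le> h" using h p0 unfolding r by (auto simp: field_simps)
  then have r1: "r \<le> 1" using h by linarith
  let ?q = "exp (- (C * ln (real p)))"
  let ?X = "2 * r * exp (- (L * (T + 1) / 2))" and ?Y = "2 * r * (density_const * t / (2 * t\<^sup>2 + (T + 1)\<^sup>2))"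
  have "exp (- (2 * C * (real (p + s0) * ln (real p)))) \<le> ?q ^ p * ?q ^ s0 * exp (- (C * real p))"
  proof -
    have "?q ^ p * ?q ^ s0 = exp (real (p + s0) * - (C * ln (real p)))"
      by (simp only: exp_of_nat_mult power_add)
    then have "?q ^ p * ?q ^ s0 * exp (- (C * real p)) = exp (real (p + s0) * - (C * ln (real p)) + - (C * real p))"
      by (simp only: exp_add)
    also have "real (p + s0) * - (C * ln (real p)) + - (C * real p) = - (C * (real (p + s0) * ln (real p))) - C * real p"
      by (simp only: mult_minus_right mult.left_commute diff_conv_add_uminus)
    finally have "?q ^ p * ?q ^ s0 * exp (- (C * real p)) = exp (- (C * (real (p + s0) * ln (real p))) - C * real p)" .
    moreover have "C * real p \<le> C * (real (p + s0) * ln (real p))"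
    proof (intro mult_left_mono C)
      have "real p * 1 \<le> real (p + s0) * ln (real p)" using p by (intro mult_mono) auto
      then show "real p \<le> real (p + s0) * ln (real p)" by simp
    qed
    moreover have "2 * C * (real (p + s0) * ln (real p)) = C * (real (p + s0) * ln (real p)) + C * (real (p + s0) * ln (real p))"
      by (simp only: mult_2 distrib_right)
    ultimately have "- (2 * C * (real (p + s0) * ln (real p))) \<le> - (C * (real (p + s0) * ln (real p))) - C * real p" by linarith
    then show ?thesis
      using \<open>?q ^ p * ?q ^ s0 * exp (- (C * real p)) = exp (- (C * (real (p + s0) * ln (real p))) - C * real p)\<close>
      by (simp only: exp_le_cancel_iff)
  qed
  also have "\<dots> \<le> ?X ^ p * ?Y ^ s0 * exp (- (8 * density_const * t / r) * real p ^ 2)"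
  proof -
    have XY: "0 \<le> ?X" "0 \<le> ?Y" using r0 t density_const_pos by auto
    have e: "exp (- (C * real p)) \<le> exp (- (8 * density_const * t / r) * real p ^ 2)" using c3(2) by simp
    have "?q ^ p * ?q ^ s0 \<le> ?X ^ p * ?Y ^ s0"
      by (rule mult_mono[OF power_mono[OF c1] power_mono[OF c2(1)]]) (use XY in \<open>simp_all only: zero_le_power exp_ge_zero\<close>)
    then show ?thesis
      by (rule mult_mono[OF _ e]) (simp_all only: mult_nonneg_nonneg zero_le_power XY exp_ge_zero)
  qed
  finally have "ennreal ((lam / 2) ^ p * exp (- (2 * C * (real (p + s0) * ln (real p)))))
     \<le> ennreal ((lam / 2) ^ p * (?X ^ p * ?Y ^ s0 * exp (- (8 * density_const * t / r) * real p ^ 2)))"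
    using lam by (intro ennreal_leI mult_left_mono) auto
  also have "\<dots> \<le> (\<integral>\<^sup>+ s. indicator {s. \<forall>z\<in>tri p. s z \<in> {shrunk_center h S0 z - r..shrunk_center h S0 z + r}} s \<partial>PU)"
  proof (rule prior_box_mass[OF t lam L r0(1) c3(1) _ _ order_trans[OF offsupp_shrunk_center off] c2(2)])
    fix j assume j: "j < p"
    have "0 \<le> (1 - h) * S0 j j" using h spectral_bounds_diag(2)[OF S0 j] T_pos
      by (intro mult_nonneg_nonneg) (auto intro: order_trans[of _ "1 / T"])
    then show "r \<le> shrunk_center h S0 (j,j)" using r0 by (simp add: shrunk_center_def id_kernel_def)
  next
    fix z assume z: "z \<in> tri p"
    then have ij: "fst z < p" "snd z < p" by (auto simp: tri_def)
    have "\<bar>shrunk_center h S0 z\<bar> \<le> \<bar>(1 - h) * S0 (fst z) (snd z)\<bar> + \<bar>h * id_kernel (fst z) (snd z)\<bar>"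
      unfolding shrunk_center_def by (rule abs_triangle_ineq)
    also have "\<dots> \<le> (1 - h) * T + h * 1"
      using h spectral_bounds_entry[OF S0 T_pos ij] by (intro add_mono) (auto simp: abs_mult id_kernel_def intro!: mult_left_mono)
    also have "\<dots> \<le> (1 - h) * T + h * T" using h T by (intro add_left_mono mult_left_mono) auto
    finally show "\<bar>shrunk_center h S0 z\<bar> + r \<le> T + 1" using r1 by (simp add: algebra_simps)
  qed
  finally show ?thesis by (simp add: coord_box_def)
qed

text \<open>The posterior exceeds \<open>\<epsilon>\<close> only if the sample covariance deviates,
  the evidence of the box falls below \<open>b\<close>, or the numerator exceeds
  \<open>\<epsilon> * b\<close> on a good sample. The hypotheses isolate what the scales must
  satisfy; \<open>calibration\<close> and the rate condition supply them.\<close>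

proposition posterior_bound:
  fixes s0 K :: nat
  assumes p: "1 \<le> ln (real p)" and n: "n > 0"
    and tau: "3 \<le> \<tau>" "\<tau> \<le> T" and S0': "spectral_bounds p \<tau> S0"
    and off: "num_offsupp p S0 \<le> s0" and L: "lam \<le> L" and C: "C \<ge> 0"
    and R: "R = real (p + s0) * ln (real p)" and h: "h = 1 / sqrt (real n)" and r: "r = h / (2 * real p)"
    and c1: "exp (- (C * ln (real p))) \<le> 2 * r * exp (- (L * (T + 1) / 2))"
    and c2: "exp (- (C * ln (real p))) \<le> 2 * r * (density_const * t / (2 * t\<^sup>2 + (T + 1)\<^sup>2))"
      "2 * r * (density_const * t / (2 * t\<^sup>2 + (T + 1)\<^sup>2)) \<le> 1"
    and c3: "8 * density_const * t / r \<le> 1" "8 * density_const * t / r * real p ^ 2 \<le> C * real p"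
    and d: "d = sqrt (R / real n) / real p" and c4: "sqrt (real p) * (4 * density_const * t / d) * real p ^ 2 \<le> C * real p"
    and c5: "2 * T ^ 3 * sqrt (h\<^sup>2 * (real p * (5 + 4 * T\<^sup>2))) \<le> 1"
    and c6: "4 * T * sqrt (ln (real p) / real n) \<le> 1"
    and K: "2 * (ln T + 3 * C + evidence_const T + 2) \<le> real K"
    and M: "64 * T\<^sup>2 * (ln T + 3 * C + evidence_const T + 2) \<le> M - 1"
      "4 * (4 * T\<^sup>2 + 3)\<^sup>2 * (2 * real K + 1) \<le> M - 1" "(M - 1) * R / real n \<le> 1"
    and eps: "\<epsilon> > 0"
  shows "\<exists>E\<in>sets P0. {x \<in> space P0. posterior (prior p t (1/2) (1/2) lam \<tau>) n p
       {S. frob_sq (S - kernel_mat p S0) \<ge> M * R / real n} x > \<epsilon>} \<subseteq> E \<and>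
     emeasure P0 E \<le> ennreal (2 / real p + exp (- R) + 2 / \<epsilon> * exp (- R))"
proof -
  have p0: "p > 0" using p by (cases "p = 0") auto
  have p1: "1 \<le> real p" using p0 by simp
  have Rp: "real p \<le> R"
  proof -
    have "real p * 1 \<le> real (p + s0) * ln (real p)" using p by (intro mult_mono) auto
    then show ?thesis by (simp add: R)
  qed
  then have R0: "R > 0" using p1 by linarith
  have h2: "h\<^sup>2 = 1 / real n" using n by (simp add: h power_divide)
  have h0: "0 < h" "h \<le> 1" using n by (auto simp: h)
  \<comment> \<open>Chosen so that \<open>3 * n * tt^2 = 3 * ln p\<close>; the union bound over
    \<open>p^2\<close> entries then leaves \<open>2 / p\<close>.\<close>
  define tt where "tt = sqrt (ln (real p) / real n)"
  have tt0: "tt > 0" using p n by (simp add: tt_def)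
  have tt2: "tt\<^sup>2 = ln (real p) / real n" using p by (simp add: tt_def)
  define a where "a = (4 * T\<^sup>2 + 3) * tt"
  have a0: "a > 0" using tt0 by (simp add: a_def add_nonneg_pos)
  \<comment> \<open>One unit of \<open>M\<close> is reserved for the entries below \<open>d\<close>,
    since \<open>(p * d)^2 = R / n\<close>.\<close>
  define v where "v = (M - 1) * R / real n"
  \<comment> \<open>With Chernoff weight \<open>sqrt p\<close>, this many large entries give the
    factor \<open>exp (- K / 2 * R)\<close>.\<close>
  define k where "k = K * (p + s0)"
  \<comment> \<open>Budget in units of \<open>R\<close>: \<open>ln T\<close> for
    \<open>\<tau> ^ p\<close>, \<open>C\<close> for the Chernoff cost, \<open>2 * C\<close> for the
    box mass and \<open>evidence_const T + 1\<close> for \<open>\<kappa>\<close>. Decay at rate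
    \<open>Q + 1\<close> then beats \<open>b\<close> by \<open>exp (- R)\<close>.\<close>
  define Q where "Q = ln T + 3 * C + evidence_const T + 1"
  have lnT: "ln T \<ge> 0" using T by simp
  have Q0: "Q \<ge> 0" using lnT C evidence_const_nonneg[OF T_pos] by (simp add: Q_def)
  have M1: "M - 1 > 0"
  proof -
    have "0 < 4 * (4 * T\<^sup>2 + 3)\<^sup>2 * (2 * real K + 1)" by (intro mult_pos_pos zero_less_power add_nonneg_pos) auto
    then show ?thesis using M(2) by linarith
  qed
  have v0: "0 < v" "v \<le> 1" using M1 R0 n M(3) by (auto simp: v_def)
  have d0: "d > 0" unfolding d using R0 n p0 by simp
  have pd: "(real p * d)\<^sup>2 = R / real n" unfolding d using p0 R0 by simp
  \<comment> \<open>The chi-square cost on the box is \<open>evidence_const T * p\<close>, hence at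
    most \<open>evidence_const T * R\<close>; the extra \<open>R\<close> gives \<open>E2\<close>
    probability at most \<open>exp (- R)\<close>.\<close>
  define \<kappa> where "\<kappa> = (evidence_const T + 1) * R"
  define mr where "mr = (lam / 2) ^ p * exp (- (2 * C * R))"
  have mr0: "mr > 0" using lam by (simp add: mr_def)
  define b where "b = mr * exp (- \<kappa>)"
  have b0: "b > 0" using mr0 by (simp add: b_def)
  let ?A = "coord_box p (shrunk_center h S0) r"
  let ?U = "{s. spectral_bounds p \<tau> (entry_kernel s)}"
  let ?G = "good_samples n p S0 a"
  let ?e = "h\<^sup>2 * (real p * (5 + 4 * T\<^sup>2))"
  have AU: "?A \<subseteq> ?U" using coord_box_spectral_bounds(1)[OF S0' tau(1) h0 p0] unfolding r by auto
  have tauT: "\<tau>\<^sup>2 \<le> T\<^sup>2" using tau by (intro power_mono) auto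
  have AS: "spectral_bounds p T (entry_kernel s) \<and> kernel_sq p (\<lambda>i j. entry_kernel s i j - S0 i j) \<le> ?e" if s: "s \<in> ?A" for s
  proof
    show "spectral_bounds p T (entry_kernel s)" using AU s tau by (auto intro: spectral_bounds_mono[of p \<tau>])
    have "kernel_sq p (\<lambda>i j. entry_kernel s i j - S0 i j) \<le> h\<^sup>2 * (real p * (5 + 4 * \<tau>\<^sup>2))"
      using coord_box_spectral_bounds(2)[OF S0' tau(1) h0 p0] s unfolding r by auto
    also have "\<dots> \<le> ?e" using tauT by (intro mult_left_mono) auto
    finally show "kernel_sq p (\<lambda>i j. entry_kernel s i j - S0 i j) \<le> ?e" .
  qed
  define E1 where "E1 = {x \<in> space P0. x \<notin> ?G}"
  define E2 where "E2 = {x \<in> space P0. evidence ?A x < ennreal b}"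
  define E3 where "E3 = {x \<in> space P0. x \<in> ?G \<and> ennreal (\<epsilon> * b) < evidence (far \<tau> (M * R / real n)) x}"
  have evA: "evidence ?A \<in> borel_measurable P0" by (rule evidence_measurable[OF coord_box_set])
  have evF: "evidence (far \<tau> (M * R / real n)) \<in> borel_measurable P0" by (rule evidence_measurable[OF far_set])
  have Gs: "{x \<in> space P0. x \<in> ?G} \<in> sets P0" using good_samples_set[of n p S0 a] by simp
  have E1s: "E1 \<in> sets P0" unfolding E1_def using sets.sets_Collect_neg[OF Gs] by simp
  have E2s: "E2 \<in> sets P0" unfolding E2_def using evA by measurable
  have E3s: "E3 \<in> sets P0"
  proof -
    have "E3 = {x \<in> space P0. x \<in> ?G} \<inter> {x \<in> space P0. ennreal (\<epsilon> * b) < evidence (far \<tau> (M * R / real n)) x}"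
      by (auto simp: E3_def)
    moreover have "{x \<in> space P0. ennreal (\<epsilon> * b) < evidence (far \<tau> (M * R / real n)) x} \<in> sets P0" using evF by measurable
    ultimately show ?thesis using Gs by auto
  qed
  have sub: "{x \<in> space P0. posterior (prior p t (1/2) (1/2) lam \<tau>) n p
       {S. frob_sq (S - kernel_mat p S0) \<ge> M * R / real n} x > \<epsilon>} \<subseteq> E1 \<union> E2 \<union> E3"
  proof (rule subsetI, rule ccontr)
    fix x assume x: "x \<in> {x \<in> space P0. posterior (prior p t (1/2) (1/2) lam \<tau>) n p
       {S. frob_sq (S - kernel_mat p S0) \<ge> M * R / real n} x > \<epsilon>}" and nE: "x \<notin> E1 \<union> E2 \<union> E3"
    then have N: "evidence (far \<tau> (M * R / real n)) x \<le> ennreal (\<epsilon> * b)" and D: "ennreal b \<le> evidence ?A x"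
      by (auto simp: E1_def E2_def E3_def not_less)
    \<comment> \<open>The denominator runs over the whole constraint set, which contains the
      box.\<close>
    have "ennreal b \<le> evidence ?U x" using D evidence_mono[OF AU] order_trans by blast
    moreover have "x \<in> space P0" using x by simp
    ultimately have "posterior (prior p t (1/2) (1/2) lam \<tau>) n p {S. frob_sq (S - kernel_mat p S0) \<ge> M * R / real n} x \<le> \<epsilon>"
      using N tau by (intro posterior_le[OF p0 _ _ eps b0]) auto
    then show False using x by simp
  qed
  have e1: "emeasure P0 E1 \<le> ennreal (2 / real p)"
  proof -
    have "emeasure P0 E1 \<le> ennreal (real p ^ 2 * (2 * exp (- (3 * real n * tt\<^sup>2))))"
      unfolding E1_def space_gauss_sample by (rule good_samples_prob[OF S0 T_pos tt0 _ a_def]) (use c6 in \<open>simp add: tt_def\<close>)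
    also have "3 * real n * tt\<^sup>2 = real 3 * ln (real p)" using n by (simp add: tt2)
    also have "exp (- (real 3 * ln (real p))) = 1 / real p ^ 3"
      using p0 by (simp only: exp_minus exp_of_nat_mult exp_ln of_nat_0_less_iff inverse_eq_divide)
    also have "real p ^ 2 * (2 * (1 / real p ^ 3)) = 2 / real p" using p0 by (simp add: field_simps eval_nat_numeral)
    finally show ?thesis .
  qed
  have e2: "emeasure P0 E2 \<le> ennreal (exp (- R))"
  proof -
    have "emeasure P0 E2 \<le> ennreal (exp (real n * ((T\<^sup>2 / 2 + T ^ 6) * ?e) - \<kappa>))"
      unfolding E2_def b_def
    proof (rule evidence_lower[OF coord_box_set AS c5 mr0])
      show "ennreal mr \<le> (\<integral>\<^sup>+ s. indicator ?A s \<partial>PU)"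
        unfolding mr_def R by (rule box_mass[OF p h0 r off L C c1 c2 c3])
    qed
    also have "real n * ((T\<^sup>2 / 2 + T ^ 6) * ?e) = evidence_const T * real p"
      using n by (simp add: h2 evidence_const_def)
    also have "evidence_const T * real p - \<kappa> \<le> - R"
      using mult_left_mono[OF Rp evidence_const_nonneg[OF T_pos]] by (simp add: \<kappa>_def algebra_simps)
    finally show ?thesis by (simp add: ennreal_leI order_trans)
  qed
  have e3: "emeasure P0 E3 \<le> ennreal (2 / \<epsilon> * exp (- R))"
  proof -
    let ?w = "sqrt (real p)"
    let ?I = "\<integral>\<^sup>+ x. indicator ?G x * evidence (far \<tau> (M * R / real n)) x \<partial>P0"
    have Gm: "(indicator ?G :: _ \<Rightarrow> ennreal) \<in> borel_measurable P0"
      using Gs by (simp add: borel_measurable_indicator_iff Int_def conj_commute)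
    have um: "(\<lambda>x. indicator ?G x * evidence (far \<tau> (M * R / real n)) x) \<in> borel_measurable P0"
      using Gm evF by (rule borel_measurable_times_ennreal)
    have eb: "\<epsilon> * b > 0" using eps b0 by simp
    have "E3 \<subseteq> {x \<in> space P0. 1 \<le> ennreal (1 / (\<epsilon> * b)) * (indicator ?G x * evidence (far \<tau> (M * R / real n)) x)}"
    proof
      fix x assume "x \<in> E3"
      then have x: "x \<in> space P0" "x \<in> ?G" "ennreal (\<epsilon> * b) \<le> evidence (far \<tau> (M * R / real n)) x" by (auto simp: E3_def)
      have "1 = ennreal (1 / (\<epsilon> * b)) * ennreal (\<epsilon> * b)" using eps b0 by (simp add: ennreal_mult[symmetric])
      also have "\<dots> \<le> ennreal (1 / (\<epsilon> * b)) * evidence (far \<tau> (M * R / real n)) x" by (intro mult_left_mono x) simp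
      finally show "x \<in> {x \<in> space P0. 1 \<le> ennreal (1 / (\<epsilon> * b)) * (indicator ?G x * evidence (far \<tau> (M * R / real n)) x)}"
        using x by simp
    qed
    then have "emeasure P0 E3 \<le> emeasure P0 {x \<in> space P0. 1 \<le> ennreal (1 / (\<epsilon> * b)) * (indicator ?G x * evidence (far \<tau> (M * R / real n)) x)}"
      using um by (intro emeasure_mono) auto
    also have "\<dots> \<le> ennreal (1 / (\<epsilon> * b)) * (\<integral>\<^sup>+ x. (indicator ?G x * evidence (far \<tau> (M * R / real n)) x) * indicator (space P0) x \<partial>P0)"
      using um by (intro nn_integral_Markov_inequality) auto
    also have "(\<integral>\<^sup>+ x. (indicator ?G x * evidence (far \<tau> (M * R / real n)) x) * indicator (space P0) x \<partial>P0) = ?I"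
      by (intro nn_integral_cong) auto
    also have "?I \<le> ennreal ((lam / 2) ^ p * (\<tau> ^ p * exp (?w * (4 * density_const * t / d) * real p ^ 2)) *
        (exp (- (real n * v / (64 * T\<^sup>2))) + 1 / ?w ^ k))"
    proof (rule numerator_bound)
      show "v + (real p * d)\<^sup>2 \<le> M * R / real n" unfolding pd v_def using n by (simp add: field_simps)
      show "a * sqrt (real (p + num_offsupp p S0 + 2 * k)) \<le> sqrt v / 2"
      proof -
        \<comment> \<open>The active set has size of order \<open>p + s0\<close>, so the entrywise
          noise costs \<open>a^2 * (p + s0)\<close>, of order \<open>R / n\<close>. This dictates
          the second lower bound on \<open>M\<close>.\<close>
        have "real (p + num_offsupp p S0 + 2 * k) \<le> (2 * real K + 1) * real (p + s0)"
          using off by (simp add: k_def algebra_simps)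
        then have "a\<^sup>2 * real (p + num_offsupp p S0 + 2 * k) \<le> a\<^sup>2 * ((2 * real K + 1) * real (p + s0))"
          by (rule mult_left_mono) simp
        also have "\<dots> = (4 * (4 * T\<^sup>2 + 3)\<^sup>2 * (2 * real K + 1)) * R / real n / 4"
          by (simp add: a_def power_mult_distrib tt2 R)
        also have "\<dots> \<le> (M - 1) * R / real n / 4"
          using M(2) R0 by (intro divide_right_mono mult_right_mono) auto
        finally have "sqrt (a\<^sup>2 * real (p + num_offsupp p S0 + 2 * k)) \<le> sqrt (v / 4)"
          unfolding v_def by (rule real_sqrt_le_mono)
        then show ?thesis using a0 by (simp add: real_sqrt_mult real_sqrt_divide)
      qed
    qed (use tau d0 p1 a0 v0 in auto)
    also have "ennreal (1 / (\<epsilon> * b)) * ennreal ((lam / 2) ^ p * (\<tau> ^ p * exp (?w * (4 * density_const * t / d) * real p ^ 2)) *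
        (exp (- (real n * v / (64 * T\<^sup>2))) + 1 / ?w ^ k)) \<le> ennreal (2 / \<epsilon> * exp (- R))"
    proof -
      have Tp: "\<tau> ^ p \<le> exp (ln T * R)"
      proof -
        have "\<tau> ^ p \<le> T ^ p" using tau by (intro power_mono) auto
        also have "\<dots> = exp (real p * ln T)" using T_pos by (simp add: exp_of_nat_mult)
        also have "\<dots> \<le> exp (ln T * R)" using mult_left_mono[OF Rp lnT] by (simp add: mult.commute)
        finally show ?thesis .
      qed
      have Cp: "exp (?w * (4 * density_const * t / d) * real p ^ 2) \<le> exp (C * R)"
        using c4 mult_left_mono[OF Rp C] by (simp add: order_trans)
      have first: "exp (- (real n * v / (64 * T\<^sup>2))) \<le> exp (- ((Q + 1) * R))"
      proof -
        have "(Q + 1) * R \<le> (M - 1) / (64 * T\<^sup>2) * R"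
          using M(1) R0 T_pos by (intro mult_right_mono) (auto simp: Q_def field_simps)
        also have "\<dots> = real n * v / (64 * T\<^sup>2)" using n by (simp add: v_def)
        finally show ?thesis by simp
      qed
      have second: "1 / ?w ^ k \<le> exp (- ((Q + 1) * R))"
      proof -
        have "?w = exp (ln (real p) / 2)" using p0 by (simp add: ln_sqrt[symmetric])
        then have "?w ^ k = exp (real k * (ln (real p) / 2))" by (simp only: exp_of_nat_mult)
        also have "real k * (ln (real p) / 2) = real K / 2 * R" by (simp add: k_def R)
        finally have "1 / ?w ^ k = exp (- (real K / 2 * R))" by (simp add: exp_minus inverse_eq_divide)
        moreover have "(Q + 1) * R \<le> real K / 2 * R" using K R0 by (intro mult_right_mono) (auto simp: Q_def)
        ultimately show ?thesis by simp
      qed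
      let ?X = "(lam / 2) ^ p"
      have X: "?X > 0" using lam by simp
      have "?X * (\<tau> ^ p * exp (?w * (4 * density_const * t / d) * real p ^ 2)) *
        (exp (- (real n * v / (64 * T\<^sup>2))) + 1 / ?w ^ k)
        \<le> ?X * (exp (ln T * R) * exp (C * R)) * (exp (- ((Q + 1) * R)) + exp (- ((Q + 1) * R)))"
        using X tau p1 by (intro mult_mono add_mono Tp Cp first second mult_nonneg_nonneg add_nonneg_nonneg order_refl) auto
      also have "\<dots> = 2 * ?X * exp (ln T * R + C * R - (Q + 1) * R)"
        by (simp add: exp_add exp_diff exp_minus field_simps)
      also have "\<dots> = (2 / \<epsilon> * exp (- R)) * (\<epsilon> * b)"
      proof -
        \<comment> \<open>The budget \<open>Q\<close> balances exactly here, and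
          \<open>(lam / 2) ^ p\<close> is absorbed into \<open>b\<close>.\<close>
        have "exp (ln T * R + C * R - (Q + 1) * R) = exp (- R + (- (2 * C * R) + - \<kappa>))"
          by (simp add: Q_def \<kappa>_def algebra_simps)
        then show ?thesis using eps unfolding b_def mr_def by (simp only: exp_add) simp
      qed
      finally have le: "?X * (\<tau> ^ p * exp (?w * (4 * density_const * t / d) * real p ^ 2)) *
        (exp (- (real n * v / (64 * T\<^sup>2))) + 1 / ?w ^ k) \<le> (2 / \<epsilon> * exp (- R)) * (\<epsilon> * b)" .
      have "ennreal (1 / (\<epsilon> * b)) * ennreal (?X * (\<tau> ^ p * exp (?w * (4 * density_const * t / d) * real p ^ 2)) *
        (exp (- (real n * v / (64 * T\<^sup>2))) + 1 / ?w ^ k)) \<le> ennreal (1 / (\<epsilon> * b)) * ennreal ((2 / \<epsilon> * exp (- R)) * (\<epsilon> * b))"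
        by (intro mult_left_mono ennreal_leI le) simp
      also have "\<dots> = ennreal (2 / \<epsilon> * exp (- R))" using eb eps b0 by (simp add: ennreal_mult[symmetric])
      finally show ?thesis .
    qed
    finally show ?thesis by (simp add: mult_left_mono)
  qed
  have "emeasure P0 (E1 \<union> E2 \<union> E3) \<le> emeasure P0 E1 + emeasure P0 E2 + emeasure P0 E3"
    using E1s E2s E3s by (intro emeasure_subadditive[THEN order_trans] add_right_mono emeasure_subadditive sets.Un)
  also have "\<dots> \<le> ennreal (2 / real p) + ennreal (exp (- R)) + ennreal (2 / \<epsilon> * exp (- R))"
    by (intro add_mono e1 e2 e3)
  also have "\<dots> = ennreal (2 / real p + exp (- R) + 2 / \<epsilon> * exp (- R))"
    using eps by (simp add: ennreal_plus[symmetric] del: ennreal_plus)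
  finally have "emeasure P0 (E1 \<union> E2 \<union> E3) \<le> ennreal (2 / real p + exp (- R) + 2 / \<epsilon> * exp (- R))" .
  moreover have "E1 \<union> E2 \<union> E3 \<in> sets P0" using E1s E2s E3s by blast
  ultimately show ?thesis using sub by blast
qed

end

text \<open>The scale-free prior width \<open>y = t * sqrt N * P^2\<close> lies between
  \<open>sqrt l\<close> and \<open>sqrt u\<close>, and the claims are rewritten in terms of it. In
  \<open>C\<close>, the part \<open>4 + g\<close> pays for up to four powers of \<open>P\<close> and
  for \<open>N \<le> P powr g\<close>; the last term pays for the zero entries.\<close>

lemma calibration:
  fixes P N t l u g L T R :: real
  assumes P: "1 \<le> P" and N: "1 \<le> N" "N \<le> P powr g" and g: "g \<ge> 0" and R: "P \<le> R" and t: "t > 0"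
    and lu: "l > 0" "u > 0" "l / (N * P ^ 4) \<le> t\<^sup>2" "t\<^sup>2 \<le> u / (N * P ^ 4)" and T: "T \<ge> 1"
    and P1: "exp (L * (T + 1) / 2) \<le> P" and P2: "(2 + (T + 1)\<^sup>2) \<le> P * (density_const * sqrt l)"
    and P3: "16 * density_const * sqrt u \<le> P" and P4: "sqrt u \<le> P"
    and C: "C = 4 + g + 16 * density_const * sqrt u" and r: "r = (1 / sqrt N) / (2 * P)" and d: "d = sqrt (R / N) / P"
  shows "exp (- (C * ln P)) \<le> 2 * r * exp (- (L * (T + 1) / 2))"
    "exp (- (C * ln P)) \<le> 2 * r * (density_const * t / (2 * t\<^sup>2 + (T + 1)\<^sup>2))"
    "2 * r * (density_const * t / (2 * t\<^sup>2 + (T + 1)\<^sup>2)) \<le> 1"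
    "8 * density_const * t / r \<le> 1" "8 * density_const * t / r * P ^ 2 \<le> C * P"
    "sqrt P * (4 * density_const * t / d) * P ^ 2 \<le> C * P"
proof -
  define q where "q = sqrt N"
  have q: "q \<ge> 1" "q > 0" "q\<^sup>2 = N" "q * q = N" using N by (auto simp: q_def)
  have P0: "P > 0" using P by simp
  have su: "sqrt u > 0" "sqrt l > 0" using lu by auto
  define y where "y = t * (q * P\<^sup>2)"
  have y2: "y\<^sup>2 = t\<^sup>2 * (N * P ^ 4)" by (simp add: y_def power_mult_distrib q power_mult[symmetric])
  have y0: "y > 0" using t q P0 by (simp add: y_def)
  have NP: "N * P ^ 4 > 0" using N P0 by simp
  have "l \<le> y\<^sup>2" "y\<^sup>2 \<le> u" using lu(3,4) NP by (auto simp: y2 field_simps)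
  then have y: "sqrt l \<le> y" "y \<le> sqrt u" using y0 by (auto intro: real_le_lsqrt real_le_rsqrt simp: real_sqrt_le_iff)
  have ty: "t = y / (q * P\<^sup>2)" using q P0 by (simp add: y_def)
  have rq: "2 * r = 1 / (P * q)" unfolding r q_def by simp
  have r0: "r > 0" using P0 q by (simp add: r q_def[symmetric])
  have qg: "q \<le> P powr g"
  proof -
    have "q * 1 \<le> q * q" using q by (intro mult_left_mono) auto
    then show ?thesis using N q by simp
  qed
  have Pg0: "P powr g > 0" using P0 by simp
  have expC: "exp (- (C * ln P)) \<le> 1 / (P ^ k * P powr g)" if "k \<le> 4" for k :: nat
  proof -
    have "exp (- (C * ln P)) = P powr (- C)" using P0 by (simp add: powr_def)
    also have "\<dots> \<le> P powr (- (real k + g))"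
    proof (rule powr_mono)
      have "0 \<le> 16 * density_const * sqrt u" using su density_const_pos by simp
      moreover have "real k \<le> 4" using that by simp
      ultimately show "- C \<le> - (real k + g)" unfolding C by linarith
    qed (rule P)
    also have "\<dots> = 1 / (P ^ k * P powr g)" using P0 by (simp only: powr_minus powr_add powr_realpow inverse_eq_divide)
    finally show ?thesis .
  qed
  show "exp (- (C * ln P)) \<le> 2 * r * exp (- (L * (T + 1) / 2))"
  proof -
    have "exp (- (C * ln P)) \<le> 1 / (P ^ 2 * P powr g)" by (rule expC) simp
    also have "\<dots> = 1 / (P * P powr g) * (1 / P)" by (simp add: power2_eq_square)
    also have "\<dots> \<le> 1 / (P * q) * (1 / exp (L * (T + 1) / 2))"
      using P0 q qg P1 by (intro mult_mono divide_left_mono mult_left_mono mult_pos_pos) auto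
    also have "\<dots> = 2 * r * exp (- (L * (T + 1) / 2))" by (simp add: rq exp_minus inverse_eq_divide)
    finally show ?thesis .
  qed
  have t1: "t \<le> sqrt u / P"
  proof -
    have "P \<le> q * P\<^sup>2" using mult_mono[of 1 q P "P * P"] q P by (simp add: power2_eq_square)
    then have "y / (q * P\<^sup>2) \<le> sqrt u / P" using y(2) less_imp_le[OF su(1)] P0 by (intro frac_le)
    then show ?thesis using ty by simp
  qed
  moreover have "sqrt u / P \<le> 1" using P4 P0 by simp
  ultimately have t2: "t \<le> 1" by linarith
  have den: "1 \<le> 2 * t\<^sup>2 + (T + 1)\<^sup>2"
  proof -
    have "1 \<le> (T + 1)\<^sup>2" using T by (intro one_le_power) auto
    then show ?thesis using zero_le_power2[of t] by linarith
  qed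
  have den2: "2 * t\<^sup>2 + (T + 1)\<^sup>2 \<le> 2 + (T + 1)\<^sup>2" using t t2 by (simp add: power_le_one)
  show "exp (- (C * ln P)) \<le> 2 * r * (density_const * t / (2 * t\<^sup>2 + (T + 1)\<^sup>2))"
  proof -
    \<comment> \<open>Box width times \<open>t\<close> is \<open>y / (P^3 * N)\<close>; the fourth
      power of \<open>P\<close> pays for the constants, through \<open>P2\<close>.\<close>
    have "exp (- (C * ln P)) \<le> 1 / (P ^ 4 * P powr g)" by (rule expC) simp
    also have "\<dots> = 1 / (P ^ 3 * P powr g) * (1 / P)" by (simp add: eval_nat_numeral)
    also have "\<dots> \<le> 1 / (P ^ 3 * N) * (density_const * sqrt l / (2 + (T + 1)\<^sup>2))"
    proof (intro mult_mono)
      show "1 / (P ^ 3 * P powr g) \<le> 1 / (P ^ 3 * N)" using P0 N by (intro divide_left_mono mult_left_mono mult_pos_pos) auto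
      show "1 / P \<le> density_const * sqrt l / (2 + (T + 1)\<^sup>2)"
        using P2 P0 by (simp add: field_simps add_pos_nonneg)
    qed (use P0 N in auto)
    also have "\<dots> \<le> 1 / (P ^ 3 * N) * (density_const * y / (2 * t\<^sup>2 + (T + 1)\<^sup>2))"
      using y y0 density_const_pos P0 N den den2 by (intro mult_left_mono frac_le mult_left_mono) auto
    also have "\<dots> = 2 * r * (density_const * t / (2 * t\<^sup>2 + (T + 1)\<^sup>2))"
      unfolding rq y_def q(4)[symmetric] using q(2) P0 by (simp add: power2_eq_square power3_eq_cube)
    finally show ?thesis .
  qed
  have Pq: "1 \<le> P * q" using mult_mono[of 1 P 1 q] P q by simp
  have cBt: "density_const * t \<le> 1"
  proof -
    have "density_const * t \<le> density_const * (sqrt u / P)" using t1 density_const_pos by (intro mult_left_mono) auto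
    also have "\<dots> \<le> 1"
    proof -
      have "0 < density_const * sqrt u" using density_const_pos su by simp
      then have "density_const * sqrt u \<le> P" using P3 by linarith
      then show ?thesis using P0 by simp
    qed
    finally show ?thesis .
  qed
  show "2 * r * (density_const * t / (2 * t\<^sup>2 + (T + 1)\<^sup>2)) \<le> 1"
  proof -
    have "2 * r \<le> 1" unfolding rq using Pq by simp
    moreover have "0 \<le> density_const * t / (2 * t\<^sup>2 + (T + 1)\<^sup>2)" using density_const_pos t den by simp
    moreover have "density_const * t / (2 * t\<^sup>2 + (T + 1)\<^sup>2) \<le> 1" using cBt den by (simp add: pos_divide_le_eq)
    ultimately show ?thesis by (rule mult_le_one)
  qed
  have tr: "8 * density_const * t / r = 16 * density_const * y / P"
  proof -
    have "r = 1 / (2 * P * q)" using rq by simp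
    then show ?thesis using q P0 by (simp add: ty power2_eq_square)
  qed
  have cy: "16 * density_const * y \<le> 16 * density_const * sqrt u" using y density_const_pos by simp
  show "8 * density_const * t / r \<le> 1" unfolding tr using cy P3 P0 by simp
  show "8 * density_const * t / r * P ^ 2 \<le> C * P"
  proof -
    have "8 * density_const * t / r * P ^ 2 = 16 * density_const * y * P" unfolding tr using P0 by (simp add: power2_eq_square)
    also have "\<dots> \<le> C * P" using cy g P0 by (intro mult_right_mono) (auto simp: C)
    finally show ?thesis .
  qed
  show "sqrt P * (4 * density_const * t / d) * P ^ 2 \<le> C * P"
  proof -
    have sR: "sqrt R > 0" "sqrt P \<le> sqrt R" "sqrt P > 0" using R P0 by auto
    \<comment> \<open>The Chernoff weight \<open>sqrt P\<close> is compensated by the factor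
      \<open>sqrt R\<close> in \<open>d\<close>, as \<open>P \<le> R\<close>.\<close>
    have "d = sqrt R / (q * P)" unfolding d q_def by (simp add: real_sqrt_divide)
    then have "sqrt P * (4 * density_const * t / d) * P ^ 2 = (4 * density_const * y * P) * (sqrt P / sqrt R)"
      using q P0 sR by (simp add: ty power2_eq_square)
    also have "\<dots> \<le> (4 * density_const * y * P) * 1"
      using sR y0 density_const_pos P0 by (intro mult_left_mono) auto
    also have "\<dots> \<le> C * P"
    proof -
      have "0 < density_const * y" using density_const_pos y0 by simp
      then have "4 * density_const * y \<le> C" using cy g unfolding C by linarith
      then show ?thesis using P0 by simp
    qed
    finally show ?thesis .
  qed
qed

section \<open>Asymptotics and the theorem\<close>

lemma U_sparse_spectral_bounds:
  assumes A: "A \<in> U_sparse p s \<tau>" and p: "p > 0" and tau: "\<tau> > 0"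
  shows "kernel_mat p (\<lambda>i j. A $$ (i,j)) = A" "spectral_bounds p \<tau> (\<lambda>i j. A $$ (i,j))" "num_offsupp p (\<lambda>i j. A $$ (i,j)) \<le> s"
proof -
  have c: "A \<in> carrier_mat p p" using A by (auto simp: U_sparse_def pos_def_def)
  show k: "kernel_mat p (\<lambda>i j. A $$ (i,j)) = A" by (rule kernel_mat_index[OF c])
  have "A \<in> U_set p \<tau>" using A by (auto simp: U_sparse_def U_set_def)
  then show "spectral_bounds p \<tau> (\<lambda>i j. A $$ (i,j))" using U_set_kernel_mat_iff[OF p tau, of "\<lambda>i j. A $$ (i,j)"] by (simp only: k)
  have "{z \<in> {..<p} \<times> {..<p}. fst z \<noteq> snd z \<and> A $$ (fst z, snd z) \<noteq> 0} =
     {(i,j). i < dim_row A \<and> j < dim_col A \<and> i \<noteq> j \<and> A $$ (i,j) \<noteq> 0}"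
    using c by auto
  then have "num_offsupp p (\<lambda>i j. A $$ (i,j)) = num_offdiag A" by (simp add: num_offsupp_def num_offdiag_def)
  then show "num_offsupp p (\<lambda>i j. A $$ (i,j)) \<le> s" using A by (simp add: U_sparse_def)
qed

theorem theorem1:
  fixes p s0 :: "nat \<Rightarrow> nat"
    and \<tau>1 \<tau> lam :: "nat \<Rightarrow> real"
    and \<tau>0 \<beta> :: real
    and \<Sigma>0 :: "nat \<Rightarrow> real mat"
  assumes A1: "\<And>n. \<Sigma>0 n \<in> U_sparse (p n) (s0 n) \<tau>0"
      and A1s: "\<And>n. 0 < s0 n \<and> s0 n < p n * (p n - 1)"
      and A1t: "\<tau>0 > 1"
      and A2: "0 < \<beta>" "\<beta> < 1" "(\<lambda>n. real (p n)) \<in> \<Theta>(\<lambda>n. real n powr \<beta>)"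
      and A3: "\<And>n. \<tau> n \<ge> max 3 \<tau>0" "\<tau> \<in> O(\<lambda>_. 1)"
              "\<And>n. lam n > 0" "lam \<in> O(\<lambda>_. 1)"
              "\<And>n. \<tau>1 n > 0" "(\<lambda>n. (\<tau>1 n)\<^sup>2) \<in> \<Theta>(\<lambda>n. 1 / (real n * real (p n) ^ 4))"
      and rate: "(\<lambda>n. real (p n + s0 n) * ln (real (p n))) \<in> o(\<lambda>n. real n)"
  shows "\<exists>M > 0. \<forall>\<epsilon> > 0. \<exists>E :: nat \<Rightarrow> (nat \<Rightarrow> nat \<Rightarrow> real) set.
     (\<forall>n. E n \<in> sets (sample_law n (p n) (\<Sigma>0 n)) \<and>
        {x \<in> space (sample_law n (p n) (\<Sigma>0 n)).
           posterior (prior (p n) (\<tau>1 n) (1/2) (1/2) (lam n) (\<tau> n)) n (p n)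
             {S. frob_sq (S - \<Sigma>0 n) \<ge> M * real (p n + s0 n) * ln (real (p n)) / real n} x > \<epsilon>}
        \<subseteq> E n) \<and>
     (\<lambda>n. measure (sample_law n (p n) (\<Sigma>0 n)) (E n)) \<longlonglongrightarrow> 0"
proof -
  define R where "R n = real (p n + s0 n) * ln (real (p n))" for n
  obtain cT where cT: "cT > 0" "eventually (\<lambda>n. norm (\<tau> n) \<le> cT * norm (1::real)) sequentially"
    using landau_o.bigE[OF A3(2)] by blast
  \<comment> \<open>A bound independent of \<open>n\<close>: for large \<open>n\<close> it dominates
    \<open>\<tau> n\<close>, hence also the spectral bound \<open>\<tau>0\<close> of the
    truth.\<close>
  define T where "T = max 3 cT"
  have T: "T \<ge> 3" "T \<ge> 1" "T > 0" by (auto simp: T_def)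
  have evT: "eventually (\<lambda>n. \<tau> n \<le> T) sequentially"
    using cT(2) by eventually_elim (auto simp: T_def)
  obtain L where L: "L > 0" "eventually (\<lambda>n. norm (lam n) \<le> L * norm (1::real)) sequentially"
    using landau_o.bigE[OF A3(4)] by blast
  have evL: "eventually (\<lambda>n. lam n \<le> L) sequentially"
    using L(2) by eventually_elim auto
  obtain u where u: "u > 0" "eventually (\<lambda>n. norm ((\<tau>1 n)\<^sup>2) \<le> u * norm (1 / (real n * real (p n) ^ 4))) sequentially"
    using landau_o.bigE[OF bigthetaD1[OF A3(6)]] by blast
  obtain l where l: "l > 0" "eventually (\<lambda>n. norm ((\<tau>1 n)\<^sup>2) \<ge> l * norm (1 / (real n * real (p n) ^ 4))) sequentially"
    using landau_omega.bigE[OF bigthetaD2[OF A3(6)]] by blast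
  obtain cp where cp: "cp > 0" "eventually (\<lambda>n. norm (real (p n)) \<ge> cp * norm (real n powr \<beta>)) sequentially"
    using landau_omega.bigE[OF bigthetaD2[OF A2(3)]] by blast
  have pinf: "filterlim (\<lambda>n. real (p n)) at_top sequentially"
  proof (rule filterlim_at_top_mono)
    show "filterlim (\<lambda>n. cp * real n powr \<beta>) at_top sequentially" using cp(1) A2(1) by real_asymp
    show "eventually (\<lambda>n. cp * real n powr \<beta> \<le> real (p n)) sequentially"
      using cp(2) by eventually_elim auto
  qed
  have evP: "eventually (\<lambda>n. B \<le> real (p n)) sequentially" for B
    using pinf by (simp add: filterlim_at_top)
  \<comment> \<open>Eventually \<open>p \<ge> n powr (\<beta> / 2)\<close>, since halving the
    exponent absorbs the constant \<open>cp\<close>; raising this to the power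
    \<open>2 / \<beta>\<close> bounds \<open>n\<close>.\<close>
  define g where "g = 2 / \<beta>"
  have g: "g \<ge> 0" using A2(1) by (simp add: g_def)
  have evN: "eventually (\<lambda>n. real n \<le> real (p n) powr g) sequentially"
  proof -
    have "eventually (\<lambda>n. real n powr (\<beta> / 2) \<le> cp * real n powr \<beta>) sequentially"
      using cp(1) A2(1) by real_asymp
    with cp(2) eventually_gt_at_top[of 0] show ?thesis
    proof eventually_elim
      case (elim n)
      then have "real n powr (\<beta> / 2) \<le> real (p n)" by simp
      then have "(real n powr (\<beta> / 2)) powr g \<le> real (p n) powr g" using g by (intro powr_mono2) auto
      then show ?case using elim A2(1) by (simp add: powr_powr g_def)
    qed
  qed
  have evR: "eventually (\<lambda>n. R n \<le> c * real n) sequentially" if "c > 0" for c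
    using landau_o.smallD[OF rate that] unfolding R_def[symmetric] by eventually_elim auto
  define C where "C = 4 + g + 16 * density_const * sqrt u"
  have C: "C \<ge> 0" using g density_const_pos u(1) by (simp add: C_def)
  define Q where "Q = ln T + 3 * C + evidence_const T + 2"
  have Q: "Q > 0" using C T evidence_const_nonneg[of T] by (simp add: Q_def add_nonneg_pos)
  define K where "K = nat \<lceil>2 * Q\<rceil>"
  have K: "2 * Q \<le> real K" unfolding K_def by linarith
  \<comment> \<open>\<open>M\<close> is built from \<open>T\<close>, \<open>C\<close> and
    \<open>K\<close> only, so it is fixed before \<open>\<epsilon>\<close>.\<close>
  define M where "M = 1 + max (64 * T\<^sup>2 * Q) (4 * (4 * T\<^sup>2 + 3)\<^sup>2 * (2 * real K + 1))"
  have M: "64 * T\<^sup>2 * Q \<le> M - 1" "4 * (4 * T\<^sup>2 + 3)\<^sup>2 * (2 * real K + 1) \<le> M - 1" by (auto simp: M_def)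
  have M1: "M - 1 > 0" using M(1) Q T by (smt (verit) mult_pos_pos zero_less_power)
  let ?S = "\<lambda>n i j. \<Sigma>0 n $$ (i,j)"
  let ?P0 = "\<lambda>n. sample_law n (p n) (\<Sigma>0 n)"
  let ?bad = "\<lambda>\<epsilon> n. {x \<in> space (?P0 n). posterior (prior (p n) (\<tau>1 n) (1/2) (1/2) (lam n) (\<tau> n)) n (p n)
             {S. frob_sq (S - \<Sigma>0 n) \<ge> M * real (p n + s0 n) * ln (real (p n)) / real n} x > \<epsilon>}"
  have p0: "p n > 0" for n using A1s[of n] by (cases "p n") auto
  have \<tau>0: "\<tau>0 > 0" using A1t by simp
  note sp = U_sparse_spectral_bounds[OF A1 p0 \<tau>0]
  have spt: "spectral_bounds (p n) (\<tau> n) (?S n)" for n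
    using A3(1)[of n] by (intro spectral_bounds_mono[OF sp(2) \<tau>0]) simp
  have law: "?P0 n = gauss_sample n (p n) (?S n)" for n
  proof -
    from mvn_eq_gauss_law[OF spectral_bounds_coercive[OF sp(2) \<tau>0]] show ?thesis
      unfolding sample_law_def gauss_sample_def by (simp add: sp(1))
  qed
  have main: "eventually (\<lambda>n. real (p n) \<le> R n \<and> (\<exists>E\<in>sets (?P0 n). ?bad \<epsilon> n \<subseteq> E \<and>
      emeasure (?P0 n) E \<le> ennreal (2 / real (p n) + exp (- R n) + 2 / \<epsilon> * exp (- R n)))) sequentially"
    if eps: "\<epsilon> > 0" for \<epsilon>
  proof -
    \<comment> \<open>The three terms make \<open>R / n \<le> c\<close> imply the closeness required
      by the chi-square bound, the tilt range of the concentration bound, and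
      \<open>v \<le> 1\<close>.\<close>
    define c where "c = min (1 / (4 * T ^ 6 * (5 + 4 * T\<^sup>2))) (min (1 / (16 * T\<^sup>2)) (1 / (M - 1)))"
    have c: "c > 0" using T M1 by (auto simp: c_def intro!: mult_pos_pos add_pos_nonneg)
    have sl: "density_const * sqrt l > 0" using density_const_pos l by simp
    show ?thesis
      using evT evL u(2) l(2) evN evR[OF c] eventually_gt_at_top[of 0]
        evP[of "exp 1"] evP[of "exp (L * (T + 1) / 2)"] evP[of "(2 + (T + 1)\<^sup>2) / (density_const * sqrt l)"]
        evP[of "16 * density_const * sqrt u"] evP[of "sqrt u"]
    proof eventually_elim
      case (elim n)
      let ?p = "real (p n)" and ?n = "real n"
      have "0 < \<tau> n" using A3(1)[of n] by linarith
      then have "spectral_bounds (p n) T (?S n)" using elim by (intro spectral_bounds_mono[OF spt]) auto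
      then have ps: "prior_setup (p n) (\<tau>1 n) (lam n) T (?S n)"
        using A3(3,5) T by unfold_locales auto
      have n0: "?n > 0" using elim by simp
      have n1: "1 \<le> ?n" using elim by simp
      have lnp: "1 \<le> ln ?p" using elim p0[of n] by (simp add: ln_ge_iff)
      have p1: "1 \<le> ?p" using p0[of n] by simp
      have Rp: "?p \<le> R n"
      proof -
        have "?p * 1 \<le> real (p n + s0 n) * ln ?p" using lnp by (intro mult_mono) auto
        then show ?thesis by (simp add: R_def)
      qed
      have Rl: "ln ?p \<le> R n"
      proof -
        have "1 * ln ?p \<le> real (p n + s0 n) * ln ?p" using lnp p1 by (intro mult_right_mono) auto
        then show ?thesis by (simp add: R_def)
      qed
      have u': "(\<tau>1 n)\<^sup>2 \<le> u / (?n * ?p ^ 4)" and l': "l / (?n * ?p ^ 4) \<le> (\<tau>1 n)\<^sup>2"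
        using elim by (simp_all add: abs_mult)
      have P2: "2 + (T + 1)\<^sup>2 \<le> ?p * (density_const * sqrt l)" using elim sl by (simp add: pos_divide_le_eq)
      note cal = calibration[OF p1 n1 _ g Rp A3(5) l(1) u(1) l' u' T(2) _ P2 _ _ C_def refl refl, of L]
      have Rc: "R n / ?n \<le> c" using elim n0 by (simp add: pos_divide_le_eq)
      have c5: "2 * T ^ 3 * sqrt ((1 / sqrt ?n)\<^sup>2 * (?p * (5 + 4 * T\<^sup>2))) \<le> 1"
      proof -
        have "?p / ?n \<le> R n / ?n" using Rp n0 by (intro divide_right_mono) auto
        also have "\<dots> \<le> 1 / (4 * T ^ 6 * (5 + 4 * T\<^sup>2))" using Rc by (simp add: c_def)
        finally have "?p / ?n * (5 + 4 * T\<^sup>2) \<le> 1 / (4 * T ^ 6 * (5 + 4 * T\<^sup>2)) * (5 + 4 * T\<^sup>2)"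
          by (rule mult_right_mono) simp
        also have "\<dots> = (1 / (2 * T ^ 3))\<^sup>2"
        proof -
          have "5 + 4 * T\<^sup>2 > 0" by (simp add: add_pos_nonneg)
          then show ?thesis by (simp add: power_divide power_mult_distrib power_mult[symmetric])
        qed
        finally have "sqrt (?p / ?n * (5 + 4 * T\<^sup>2)) \<le> 1 / (2 * T ^ 3)"
          using T by (intro real_le_lsqrt) auto
        moreover have "(1 / sqrt ?n)\<^sup>2 * (?p * (5 + 4 * T\<^sup>2)) = ?p / ?n * (5 + 4 * T\<^sup>2)"
          using n0 by (simp add: power_divide)
        ultimately show ?thesis using T by (simp add: field_simps)
      qed
      have c6: "4 * T * sqrt (ln ?p / ?n) \<le> 1"
      proof -
        have "ln ?p / ?n \<le> R n / ?n" using Rl n0 by (intro divide_right_mono) auto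
        also have "\<dots> \<le> 1 / (16 * T\<^sup>2)" using Rc by (simp add: c_def)
        also have "\<dots> = (1 / (4 * T))\<^sup>2" by (simp add: power_divide power_mult_distrib)
        finally have "sqrt (ln ?p / ?n) \<le> 1 / (4 * T)" using T by (intro real_le_lsqrt) auto
        then show ?thesis using T by (simp add: field_simps)
      qed
      have M3: "(M - 1) * R n / ?n \<le> 1"
      proof -
        have "(M - 1) * (R n / ?n) \<le> (M - 1) * (1 / (M - 1))"
          using Rc M1 by (intro mult_left_mono) (auto simp: c_def)
        then show ?thesis using M1 by simp
      qed
      have "\<exists>E\<in>sets (gauss_sample n (p n) (?S n)). {x \<in> space (gauss_sample n (p n) (?S n)).
          posterior (prior (p n) (\<tau>1 n) (1/2) (1/2) (lam n) (\<tau> n)) n (p n)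
          {S. frob_sq (S - kernel_mat (p n) (?S n)) \<ge> M * R n / ?n} x > \<epsilon>} \<subseteq> E \<and>
          emeasure (gauss_sample n (p n) (?S n)) E \<le> ennreal (2 / ?p + exp (- R n) + 2 / \<epsilon> * exp (- R n))"
        using elim A3(1)[of n] n0
        by (intro prior_setup.posterior_bound[OF ps lnp _ _ _ spt sp(3) _ C R_def refl refl cal(1,2,3,4,5) refl cal(6) c5 c6 K[unfolded Q_def] M(1)[unfolded Q_def] M(2) M3 eps]) auto
      then show ?case unfolding law sp(1) using Rp by (simp add: R_def mult.assoc)
    qed
  qed
  show ?thesis
  proof (intro exI[of _ M] conjI allI impI)
    show "M > 0" using M1 by simp
    fix \<epsilon> :: real assume eps: "\<epsilon> > 0"
    let ?good = "\<lambda>n E. E \<in> sets (?P0 n) \<and> ?bad \<epsilon> n \<subseteq> E \<and>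
      emeasure (?P0 n) E \<le> ennreal (2 / real (p n) + exp (- R n) + 2 / \<epsilon> * exp (- R n))"
    \<comment> \<open>Where no good cover is available, which happens for finitely many
      \<open>n\<close> only, the whole space is taken; the limit does not see these
      \<open>n\<close>.\<close>
    define E where "E n = (if \<exists>E. ?good n E then SOME E. ?good n E else space (?P0 n))" for n
    have Eg: "?good n (E n)" if "\<exists>E. ?good n E" for n
      using someI_ex[OF that] that by (simp add: E_def)
    have "E n \<in> sets (?P0 n) \<and> ?bad \<epsilon> n \<subseteq> E n" for n
    proof (cases "\<exists>E. ?good n E")
      case True
      then show ?thesis using Eg by blast
    next
      case False
      then have "E n = space (?P0 n)" unfolding E_def by (rule if_not_P)
      then show ?thesis by auto
    qed
    moreover have "(\<lambda>n. measure (?P0 n) (E n)) \<longlonglongrightarrow> 0"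
    proof (rule tendsto_sandwich)
      show "eventually (\<lambda>n. 0 \<le> measure (?P0 n) (E n)) sequentially" by simp
      show "(\<lambda>_. 0) \<longlonglongrightarrow> (0::real)" by simp
      show "eventually (\<lambda>n. measure (?P0 n) (E n) \<le> 2 / real (p n) + (1 + 2 / \<epsilon>) * exp (- real (p n))) sequentially"
        using main[OF eps]
      proof eventually_elim
        case (elim n)
        then have "emeasure (?P0 n) (E n) \<le> ennreal (2 / real (p n) + exp (- R n) + 2 / \<epsilon> * exp (- R n))"
          using Eg[of n] by blast
        then have "measure (?P0 n) (E n) \<le> 2 / real (p n) + exp (- R n) + 2 / \<epsilon> * exp (- R n)"
          unfolding measure_def using eps by (intro enn2real_leI) auto
        also have "\<dots> = 2 / real (p n) + (1 + 2 / \<epsilon>) * exp (- R n)" by (simp add: algebra_simps)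
        \<comment> \<open>Since \<open>R \<ge> p\<close>, the bound depends on \<open>n\<close> only
          through \<open>p\<close>, which tends to infinity.\<close>
        also have "\<dots> \<le> 2 / real (p n) + (1 + 2 / \<epsilon>) * exp (- real (p n))"
          using elim eps by (intro add_left_mono mult_left_mono) auto
        finally show ?case .
      qed
      have "((\<lambda>x. 2 / x + (1 + 2 / \<epsilon>) * exp (- x)) \<longlongrightarrow> 0) at_top" by real_asymp
      from filterlim_compose[OF this pinf]
      show "(\<lambda>n. 2 / real (p n) + (1 + 2 / \<epsilon>) * exp (- real (p n))) \<longlonglongrightarrow> 0" .
    qed
    ultimately show "\<exists>E :: nat \<Rightarrow> (nat \<Rightarrow> nat \<Rightarrow> real) set. (\<forall>n. E n \<in> sets (?P0 n) \<and> ?bad \<epsilon> n \<subseteq> E n) \<and>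
        (\<lambda>n. measure (?P0 n) (E n)) \<longlonglongrightarrow> 0"
      by blast
  qed
qed

end
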